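(* Let $D\subset\mathbb{C}^n$ be a bounded homogeneous domain with $0\in D$ and let $\varphi:D\to D$ be holomorphic with $\varphi(0)=0$. Suppose there exists a sequence $\{S_j\}$ in $\mathrm{Aut}(D)$ such that $\{\varphi\circ S_j\}$ converges locally uniformly in $D$ to the identity. If the Bergman constant $B_\varphi$ of $\varphi$ does not exceed $1$, then $C_\varphi:f\mapsto f\circ\varphi$ is an isometry on the Bloch space $\mathcal{B}$ of $D$.
   Context: A domain $D\subset\mathbb{C}^n$ is homogeneous if its group $\mathrm{Aut}(D)$ of biholomorphic self-maps acts transitively on $D$. For a bounded homogeneous domain $D$, $H_z(u,\overline v)$ ($z\in D$, $u,v\in\mathbb{C}^n$) denotes the Bergman metric, a positive definite Hermitian form invariant under automorphisms, normalized by $H_z(u,\overline v)=\frac12\sum_{j,k}\frac{\partial^2\log K(z,z)}{\partial z_j\partial\overline{z_k}}u_j\overline{v_k}$ with $K$ the Bergman kernel of $D$ (so on the unit disk $H_z(u,\overline u)=|u|^2/(1-|z|^2)^2$). For holomorphic $f:D\to\mathbb{C}$ put $Q_f(z)=\sup_{u\ne0}|(\nabla f)(z)u|/H_z(u,\overline u)^{1/2}$ with $(\nabla f)(z)u=\sum_k\frac{\partial f}{\partial z_k}(z)u_k$, and $\beta_f=\sup_{z\in D}Q_f(z)$. The Bloch space $\mathcal{B}$ of $D$ is the Banach space of holomorphic $f$ with $\beta_f<\infty$, with norm $\|f\|_{\mathcal{B}}=|f(0)|+\beta_f$. "Isometry on $\mathcal{B}$" means $\|f\circ\varphi\|_{\mathcal{B}}=\|f\|_{\mathcal{B}}$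 for all $f\in\mathcal{B}$. The Bergman constant of a holomorphic $\varphi:D\to D$ is $$B_\varphi=\sup_{z\in D}\sup_{u\in\mathbb{C}^n\setminus\{0\}}\frac{H_{\varphi(z)}(J\varphi(z)u,\overline{J\varphi(z)u})^{1/2}}{H_z(u,\overline u)^{1/2}},$$ where $J\varphi(z)$ is the Jacobian matrix $(\partial\varphi_j(z)/\partial z_k)_{j,k}$. *)

theory Defs
  imports "HOL-Analysis.Analysis"
begin

section \<open>Holomorphic functions and maps on open subsets of \<open>\<complex>\<^sup>n\<close>\<close>

text \<open>Complex Frechet differentiability at every point; only used for open \<open>D\<close>.\<close>

definition holo_fun :: "(complex ^ 'n) set \<Rightarrow> (complex ^ 'n \<Rightarrow> complex) \<Rightarrow> bool" where
  "holo_fun D f \<longleftrightarrow>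
     (\<forall>z\<in>D. \<exists>a :: complex ^ 'n. (f has_derivative (\<lambda>h. \<Sum>k\<in>UNIV. a $ k * h $ k)) (at z))"

definition holo_map :: "(complex ^ 'n) set \<Rightarrow> (complex ^ 'n \<Rightarrow> complex ^ 'm) \<Rightarrow> bool" where
  "holo_map D \<phi> \<longleftrightarrow> (\<forall>j. holo_fun D (\<lambda>z. \<phi> z $ j))"

definition partial_z :: "'n \<Rightarrow> (complex ^ 'n \<Rightarrow> complex) \<Rightarrow> complex ^ 'n \<Rightarrow> complex" where
  "partial_z k f z = deriv (\<lambda>t. f (z + axis k t)) 0"

definition gradient_app :: "(complex ^ 'n \<Rightarrow> complex) \<Rightarrow> complex ^ 'n \<Rightarrow> complex ^ 'n \<Rightarrow> complex" where
  "gradient_app f z u = (\<Sum>k\<in>UNIV. partial_z k f z * u $ k)"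

definition jacobian :: "(complex ^ 'n \<Rightarrow> complex ^ 'm) \<Rightarrow> complex ^ 'n \<Rightarrow> complex ^ 'n ^ 'm" where
  "jacobian \<phi> z = (\<chi> j k. partial_z k (\<lambda>w. \<phi> w $ j) z)"


section \<open>Bounded homogeneous domains\<close>

definition Aut :: "(complex ^ 'n) set \<Rightarrow> (complex ^ 'n \<Rightarrow> complex ^ 'n) set" where
  "Aut D = {S. bij_betw S D D \<and> holo_map D S \<and> holo_map D (inv_into D S)}"

definition bounded_homogeneous_domain :: "(complex ^ 'n) set \<Rightarrow> bool" where
  "bounded_homogeneous_domain D \<longleftrightarrow>
     open D \<and> connected D \<and> D \<noteq> {} \<and> bounded D \<and>
     (\<forall>z\<in>D. \<forall>w\<in>D. \<exists>S\<in>Aut D. S z = w)"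

definition locally_uniform_limit ::
    "(complex ^ 'n) set \<Rightarrow> (nat \<Rightarrow> complex ^ 'n \<Rightarrow> complex ^ 'n) \<Rightarrow> (complex ^ 'n \<Rightarrow> complex ^ 'n) \<Rightarrow> bool"
  where
  "locally_uniform_limit D F g \<longleftrightarrow>
     (\<forall>z\<in>D. \<exists>U. open U \<and> z \<in> U \<and> U \<subseteq> D \<and> uniform_limit U F g sequentially)"


section \<open>Bergman kernel and Bergman metric\<close>

definition bergman_space :: "(complex ^ 'n) set \<Rightarrow> (complex ^ 'n \<Rightarrow> complex) set" where
  "bergman_space D = {f. holo_fun D f \<and> set_integrable lborel D (\<lambda>z. (cmod (f z))\<^sup>2)}"

text \<open>For \<open>w \<in> D\<close>, the function \<open>\<lambda>z. bergman_kernel D z w\<close> is the element of the Bergman space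
  representing evaluation at \<open>w\<close>. Such an element is uniquely determined on \<open>D\<close> only (its values
  off \<open>D\<close> are irrelevant), hence the choice operator instead of a definite description.\<close>

definition bergman_kernel :: "(complex ^ 'n) set \<Rightarrow> complex ^ 'n \<Rightarrow> complex ^ 'n \<Rightarrow> complex" where
  "bergman_kernel D z w =
     (SOME g. g \<in> bergman_space D \<and>
        (\<forall>f\<in>bergman_space D. f w = (LINT x:D|lborel. f x * cnj (g x)))) z"

text \<open>Wirtinger derivatives of functions that need not be holomorphic.\<close>

definition partial_x :: "'n \<Rightarrow> (complex ^ 'n \<Rightarrow> complex) \<Rightarrow> complex ^ 'n \<Rightarrow> complex" where
  "partial_x k f z = vector_derivative (\<lambda>t::real. f (z + axis k (of_real t))) (at 0)"

definition partial_y :: "'n \<Rightarrow> (complex ^ 'n \<Rightarrow> complex) \<Rightarrow> complex ^ 'n \<Rightarrow> complex" where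
  "partial_y k f z = vector_derivative (\<lambda>t::real. f (z + axis k (\<i> * of_real t))) (at 0)"

definition wirtinger :: "'n \<Rightarrow> (complex ^ 'n \<Rightarrow> complex) \<Rightarrow> complex ^ 'n \<Rightarrow> complex" where
  "wirtinger k f z = (partial_x k f z - \<i> * partial_y k f z) / 2"

definition wirtinger_bar :: "'n \<Rightarrow> (complex ^ 'n \<Rightarrow> complex) \<Rightarrow> complex ^ 'n \<Rightarrow> complex" where
  "wirtinger_bar k f z = (partial_x k f z + \<i> * partial_y k f z) / 2"

text \<open>\<open>bergman_metric D z u v\<close> is \<open>H\<^sub>z(u, v\<^sup>-)\<close>, conjugate linear in \<open>v\<close>; the conjugate is part of
  the definition. The factor \<open>1/2\<close> makes it \<open>\<bar>u\<bar>\<^sup>2 / (1 - \<bar>z\<bar>\<^sup>2)\<^sup>2\<close> on the unit disk.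
  On the diagonal the kernel is real and, for bounded \<open>D\<close>, positive.\<close>

definition bergman_metric :: "(complex ^ 'n) set \<Rightarrow> complex ^ 'n \<Rightarrow> complex ^ 'n \<Rightarrow> complex ^ 'n \<Rightarrow> complex"
  where
  "bergman_metric D z u v =
     (1/2) * (\<Sum>j\<in>UNIV. \<Sum>k\<in>UNIV.
        wirtinger j (wirtinger_bar k (\<lambda>w. complex_of_real (ln (Re (bergman_kernel D w w))))) z
          * u $ j * cnj (v $ k))"

definition bergman_length :: "(complex ^ 'n) set \<Rightarrow> complex ^ 'n \<Rightarrow> complex ^ 'n \<Rightarrow> real" where
  "bergman_length D z u = sqrt (Re (bergman_metric D z u u))"


section \<open>Bloch space and Bergman constant\<close>

text \<open>The suprema may be infinite, so they are taken in \<open>ennreal\<close>.\<close>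

definition bloch_Q :: "(complex ^ 'n) set \<Rightarrow> (complex ^ 'n \<Rightarrow> complex) \<Rightarrow> complex ^ 'n \<Rightarrow> ennreal" where
  "bloch_Q D f z = (SUP u\<in>UNIV - {0}. ennreal (cmod (gradient_app f z u) / bergman_length D z u))"

definition bloch_beta :: "(complex ^ 'n) set \<Rightarrow> (complex ^ 'n \<Rightarrow> complex) \<Rightarrow> ennreal" where
  "bloch_beta D f = (SUP z\<in>D. bloch_Q D f z)"

definition bloch_space :: "(complex ^ 'n) set \<Rightarrow> (complex ^ 'n \<Rightarrow> complex) set" where
  "bloch_space D = {f. holo_fun D f \<and> bloch_beta D f < \<infinity>}"

definition bloch_norm :: "(complex ^ 'n) set \<Rightarrow> (complex ^ 'n \<Rightarrow> complex) \<Rightarrow> real" where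
  "bloch_norm D f = cmod (f 0) + enn2real (bloch_beta D f)"

definition bergman_constant :: "(complex ^ 'n) set \<Rightarrow> (complex ^ 'n \<Rightarrow> complex ^ 'n) \<Rightarrow> ennreal" where
  "bergman_constant D \<phi> =
     (SUP z\<in>D. SUP u\<in>UNIV - {0}.
        ennreal (bergman_length D (\<phi> z) (jacobian \<phi> z *v u) / bergman_length D z u))"

end

theory Submission
  imports Defs "HOL-Complex_Analysis.Cauchy_Integral_Formula"
begin

text \<open>
  Since \<open>\<phi> 0 = 0\<close>, only the Bloch seminorms of \<open>f \<circ> \<phi>\<close> and \<open>f\<close> have to be compared. The chain
  rule turns the quotient \<open>\<bar>\<nabla>(f \<circ> \<phi>)(z)u\<bar> / H\<^sub>z(u,u)\<^sup>1\<^sup>/\<^sup>2\<close> into the quotient of \<open>f\<close> at \<open>\<phi> z\<close> in the direction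
  \<open>v = J\<phi>(z)u\<close>, multiplied by the ratio of the Bergman lengths of \<open>v\<close> and \<open>u\<close>; that ratio is at most
  \<open>1\<close> because the Bergman constant is (\<open>bloch_beta_compose_le\<close>). For the converse let \<open>S j\<close> be the given
  automorphisms. They preserve the Bergman length, so every quotient of \<open>f \<circ> \<phi> \<circ> S j\<close> at \<open>z\<close> is a
  quotient of \<open>f \<circ> \<phi>\<close> at \<open>S j z\<close> and is bounded by the seminorm of \<open>f \<circ> \<phi>\<close>. Now \<open>f \<circ> \<phi> \<circ> S j\<close>
  converges to \<open>f\<close> uniformly near \<open>z\<close>, hence by the Cauchy estimates so do the gradients at \<open>z\<close>, and
  the quotient of \<open>f\<close> at \<open>z\<close> obeys the same bound (\<open>bloch_beta_compose_ge\<close>).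

  The work lies in two facts about the Bergman metric: it is positive definite
  (\<open>bergman_length_pos\<close>) and invariant under automorphisms (\<open>bergman_length_invariant\<close>). Both follow
  from its extremal description. Let \<open>k\<close> represent evaluation at \<open>z\<close>, and \<open>p\<close> represent the derivative at
  \<open>z\<close> in the direction \<open>u\<close>, as functionals on the Bergman space. Then \<open>2 H\<^sub>z(u,u) \<parallel>k\<parallel>\<^sup>2\<close> is the squared distance
  \<open>R\<close> of \<open>p\<close> from the line through \<open>k\<close> (\<open>bergman_metric_eq_residual\<close>), and \<open>R\<close> is also the least
  constant with \<open>\<bar>\<nabla>g(z)u\<bar>\<^sup>2 \<le> R \<parallel>g\<parallel>\<^sup>2\<close> for all \<open>g\<close> vanishing at \<open>z\<close> (\<open>residual_energy_kern\<close>). An affine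
  function vanishing at \<open>z\<close> with nonzero derivative along \<open>u\<close> shows \<open>R > 0\<close>. For an automorphism
  \<open>S\<close> the map \<open>g \<mapsto> det(JS) (g \<circ> S)\<close> preserves the Bergman norm, so \<open>R\<close> and \<open>\<parallel>k\<parallel>\<^sup>2\<close> scale by the same factor
  \<open>\<bar>det(JS(z))\<bar>\<^sup>2\<close>, which cancels in the quotient.

  The isometry is the change of variables formula together with the identity that a complex matrix
  multiplies volume by the squared modulus of its complex determinant (\<open>volume_factor_matrix\<close>). The
  representers come from the Riesz theorem (\<open>riesz\<close>), whose completeness hypothesis holds because point
  evaluations are bounded locally uniformly (\<open>point_evaluation_bound\<close>). The identification of the
  metric with the extremal quantity differentiates \<open>w \<mapsto> \<langle>k\<^sub>w, k\<^sub>w\<rangle>\<close> through a first order expansion of the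
  representers in norm (\<open>repr_expansion\<close>).
\<close>

section \<open>Complex matrices as real linear maps\<close>

text \<open>
  The coordinate index is \<open>'n bit0\<close> because the change of variables theorem for \<open>real ^ 'm\<close> asks for a
  finite well-ordered index type; \<open>'n bit0\<close> is one for every finite \<open>'n\<close>, and it has \<open>2 * CARD('n)\<close>
  elements, the real dimension of \<open>complex ^ 'n\<close>.
\<close>

definition basis_enum :: "'n bit0 \<Rightarrow> complex ^ 'n::finite" where
  "basis_enum = (SOME b. bij_betw b UNIV Basis)"

definition to_real :: "complex ^ 'n::finite \<Rightarrow> real ^ 'n bit0" where
  "to_real x = (\<chi> i. x \<bullet> basis_enum i)"

definition of_realvec :: "real ^ 'n bit0 \<Rightarrow> complex ^ 'n::finite" where
  "of_realvec y = (\<Sum>i\<in>UNIV. (y $ i) *\<^sub>R basis_enum i)"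

lemma bij_basis_enum: "bij_betw (basis_enum :: 'n bit0 \<Rightarrow> complex ^ 'n::finite) UNIV Basis"
proof -
  have "card (UNIV :: 'n bit0 set) = card (Basis :: (complex ^ 'n) set)"
    by simp
  then have "\<exists>b. bij_betw b (UNIV :: 'n bit0 set) (Basis :: (complex ^ 'n) set)"
    by (intro finite_same_card_bij) auto
  then show ?thesis
    unfolding basis_enum_def by (rule someI_ex)
qed

lemma basis_enum_in_Basis: "basis_enum i \<in> (Basis :: (complex ^ 'n::finite) set)"
  using bij_basis_enum bij_betwE by blast

lemma inner_basis_enum:
  "(basis_enum i :: complex ^ 'n::finite) \<bullet> basis_enum j = of_bool (i = j)"
  using bij_basis_enum[where 'n = 'n]
  by (auto simp: inner_Basis basis_enum_in_Basis bij_betw_def inj_def)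

lemma sum_basis_enum:
  "(\<Sum>i\<in>UNIV. F (basis_enum i :: complex ^ 'n::finite)) = (\<Sum>b\<in>Basis. F b)"
  by (rule sum.reindex_bij_betw[OF bij_basis_enum])

lemma prod_basis_enum:
  "(\<Prod>i\<in>UNIV. F (basis_enum i :: complex ^ 'n::finite)) = (\<Prod>b\<in>Basis. F b)"
  by (rule prod.reindex_bij_betw[OF bij_basis_enum])

lemma of_realvec_to_real [simp]: "of_realvec (to_real x) = x"
proof -
  have "of_realvec (to_real x) = (\<Sum>i\<in>UNIV. (x \<bullet> basis_enum i) *\<^sub>R basis_enum i)"
    by (simp add: of_realvec_def to_real_def)
  also have "\<dots> = (\<Sum>b\<in>Basis. (x \<bullet> b) *\<^sub>R b)"
    by (rule sum_basis_enum)
  finally show ?thesis by (simp add: euclidean_representation)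
qed

lemma to_real_of_realvec [simp]: "to_real (of_realvec y) = y"
  by (simp add: vec_eq_iff to_real_def of_realvec_def inner_sum_left inner_basis_enum)

lemma linear_to_real [simp]: "linear to_real"
  by (intro linearI) (auto simp: vec_eq_iff to_real_def inner_add_left)

lemma linear_of_realvec [simp]: "linear of_realvec"
  by (intro linearI) (auto simp: of_realvec_def scaleR_add_left sum.distrib scaleR_sum_right)

lemma inner_to_real [simp]: "to_real x \<bullet> to_real y = x \<bullet> y"
proof -
  have "to_real x \<bullet> to_real y = (\<Sum>i\<in>UNIV. (x \<bullet> basis_enum i) * (y \<bullet> basis_enum i))"
    by (simp add: inner_vec_def to_real_def)
  also have "\<dots> = (\<Sum>b\<in>Basis. (x \<bullet> b) * (y \<bullet> b))"
    by (rule sum_basis_enum)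
  finally show ?thesis by (simp add: euclidean_inner[of x y])
qed

lemma norm_to_real [simp]: "norm (to_real x) = norm x"
  by (simp add: norm_eq_sqrt_inner)

lemma norm_of_realvec [simp]: "norm (of_realvec x) = norm x"
  by (metis norm_to_real to_real_of_realvec)

lemma bij_to_real: "bij to_real"
  by (rule o_bij[of of_realvec]) (auto simp: fun_eq_iff)

lemma bounded_linear_to_real: "bounded_linear to_real"
  using linear_conv_bounded_linear linear_to_real by blast

lemma bounded_linear_of_realvec: "bounded_linear of_realvec"
  using linear_conv_bounded_linear linear_of_realvec by blast

definition volume_factor :: "(complex ^ 'n::finite \<Rightarrow> complex ^ 'n) \<Rightarrow> real" where
  "volume_factor L = \<bar>det (matrix (to_real \<circ> L \<circ> of_realvec))\<bar>"

lemma volume_factor_compose: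
  fixes L M :: "complex ^ 'n::finite \<Rightarrow> complex ^ 'n"
  assumes "linear L" "linear M"
  shows "volume_factor (L \<circ> M) = volume_factor L * volume_factor M"
proof -
  let ?L = "to_real \<circ> L \<circ> of_realvec" and ?M = "to_real \<circ> M \<circ> of_realvec"
  have "linear ?L" "linear ?M"
    using assms by (auto intro!: linear_compose)
  moreover have "to_real \<circ> (L \<circ> M) \<circ> of_realvec = ?L \<circ> ?M"
    by (simp add: fun_eq_iff)
  ultimately show ?thesis
    by (simp add: volume_factor_def matrix_compose det_mul abs_mult)
qed

lemma volume_factor_isometry:
  fixes L :: "complex ^ 'n::finite \<Rightarrow> complex ^ 'n"
  assumes "linear L" "\<And>x. norm (L x) = norm x"
  shows "volume_factor L = 1"
proof -
  have "orthogonal_transformation (to_real \<circ> L \<circ> of_realvec)"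
    using assms unfolding orthogonal_transformation
    by (auto intro!: linear_compose)
  then show ?thesis
    unfolding volume_factor_def by simp
qed

lemma volume_factor_singular:
  fixes L :: "complex ^ 'n::finite \<Rightarrow> complex ^ 'n"
  assumes "linear L" "L v = 0" "v \<noteq> 0"
  shows "volume_factor L = 0"
proof -
  let ?L = "to_real \<circ> L \<circ> of_realvec"
  have lin: "linear ?L"
    using assms by (auto intro!: linear_compose)
  have "?L (to_real v) = 0"
    using assms linear_0[OF linear_to_real] by simp
  then have "\<not> inj ?L"
    using assms lin linear_injective_0 by (metis of_realvec_to_real linear_0 linear_of_realvec)
  then have "det (matrix ?L) = 0"
    using det_nz_iff_inj lin by blast
  then show ?thesis by (simp add: volume_factor_def)
qed

text \<open>
  Gaussian elimination by columns needs scalings and shears; matrices that differ from the identity in a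
  single column include both, so one family has to be treated.
\<close>

definition column_elem :: "'n \<Rightarrow> complex ^ 'n \<Rightarrow> complex ^ 'n ^ 'n::finite" where
  "column_elem k a = (\<chi> i j. if j = k then a $ i else mat 1 $ i $ j)"

lemma column_elem_mult: "column_elem k a *v x = x + (x $ k) *s (a - axis k 1)"
proof -
  have "(\<Sum>j\<in>UNIV. (if j = k then a $ i else of_bool (i = j)) * x $ j)
        = x $ i + x $ k * (a $ i - of_bool (i = k))" for i
  proof -
    have "(\<Sum>j\<in>UNIV. (if j = k then a $ i else of_bool (i = j)) * x $ j)
      = (\<Sum>j\<in>UNIV. of_bool (i = j) * x $ j + (if j = k then (a $ i - of_bool (i = j)) * x $ j else 0))"
      by (rule sum.cong) (auto simp: algebra_simps)
    also have "\<dots> = x $ i + x $ k * (a $ i - of_bool (i = k))"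
      by (simp add: sum.distrib of_bool_def if_distrib[of "\<lambda>c. c * _"] sum.delta cong: if_cong)
    finally show ?thesis .
  qed
  then have "(column_elem k a *v x) $ i = (x + (x $ k) *s (a - axis k 1)) $ i" for i
    unfolding column_elem_def matrix_vector_mult_def mat_def axis_def of_bool_def
    by (simp only: vec_lambda_beta vector_add_component vector_minus_component
        vector_smult_component)
  then show ?thesis
    unfolding vec_eq_iff by blast
qed

lemma det_column_elem: "det (column_elem k a) = a $ k"
  using cramer_lemma[of k "mat 1" a] by (simp add: column_elem_def cong: if_cong)

lemma linear_matrix_vector: "linear ((*v) (A :: complex ^ 'n ^ 'n::finite))"
  by (intro linearI) (auto simp: matrix_vector_right_distrib, auto simp: matrix_vector_mult_def vec_eq_iff scaleR_sum_right)

lemma volume_factor_scale_real: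
  fixes k :: "'n::finite"
  assumes "r \<noteq> 0"
  shows "volume_factor ((*v) (column_elem k (axis k (complex_of_real r)))) = r\<^sup>2"
proof -
  let ?L = "(*v) (column_elem k (axis k (complex_of_real r)))"
  define d where "d b = (if b $ k = 0 then 1 else r)" for b :: "complex ^ 'n"
  have L: "?L b = d b *\<^sub>R b" if b: "b \<in> Basis" for b
    using b unfolding column_elem_mult d_def Basis_vec_def
    by (auto simp: vec_eq_iff axis_def scaleR_conv_of_real[where 'a = complex] algebra_simps)
  have mat: "matrix (to_real \<circ> ?L \<circ> of_realvec) $ i $ j = (if i = j then d (basis_enum i) else 0)" for i j
  proof -
    have "of_realvec (axis j 1) = (basis_enum j :: complex ^ 'n)"
      by (simp add: of_realvec_def axis_def if_distrib[of "\<lambda>c. c *\<^sub>R _"] cong: if_cong)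
    then show ?thesis
      by (simp add: matrix_def to_real_def L[OF basis_enum_in_Basis] inner_basis_enum)
  qed
  have "det (matrix (to_real \<circ> ?L \<circ> of_realvec)) = (\<Prod>i\<in>UNIV. d (basis_enum i))"
    by (subst det_diagonal) (auto simp: mat)
  also have "\<dots> = (\<Prod>b\<in>Basis. d b)"
    by (rule prod_basis_enum)
  also have "\<dots> = (\<Prod>b\<in>{axis k 1, axis k \<i>}. d b)"
    by (rule prod.mono_neutral_right)
      (auto simp: Basis_vec_def d_def Basis_complex_def, auto simp: axis_def split: if_splits)
  also have "\<dots> = r\<^sup>2"
    by (auto simp: d_def axis_eq_axis power2_eq_square)
  finally show ?thesis
    by (simp add: volume_factor_def)
qed

lemma volume_factor_mult:
  "volume_factor ((*v) (A ** B)) = volume_factor ((*v) A) * volume_factor ((*v) (B :: complex ^ 'n ^ 'n::finite))"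
  by (metis linear_matrix_vector matrix_vector_mult_matrix_matrix_mult_compose volume_factor_compose)

lemma matrix_ext: "(\<And>x. A *v x = B *v x) \<Longrightarrow> A = (B :: complex ^ 'n ^ 'n::finite)"
  using matrix_eq by blast

lemma volume_factor_nonzero:
  fixes A :: "complex ^ 'n ^ 'n::finite"
  assumes "det A \<noteq> 0"
  shows "volume_factor ((*v) A) \<noteq> 0"
proof -
  obtain B where B: "A ** B = mat 1"
    using assms invertible_det_nz invertible_right_inverse by blast
  have "volume_factor ((*v) (mat 1 :: complex ^ 'n ^ 'n)) = 1"
    by (rule volume_factor_isometry[OF linear_matrix_vector]) simp
  then show ?thesis
    using volume_factor_mult[of A B] B by auto
qed

text \<open>
  Split \<open>c\<close> into modulus and phase: the modulus acts as a real diagonal matrix with two equal entries,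
  the phase is an isometry.
\<close>

lemma volume_factor_scale:
  fixes k :: "'n::finite"
  assumes "c \<noteq> 0"
  shows "volume_factor ((*v) (column_elem k (axis k c))) = (cmod c)\<^sup>2"
proof -
  define r where "r = cmod c"
  have r: "r \<noteq> 0" "c = complex_of_real r * sgn c"
    using assms by (auto simp: r_def sgn_eq)
  have eq: "column_elem k (axis k c) = column_elem k (axis k (complex_of_real r)) ** column_elem k (axis k (sgn c))"
    by (rule matrix_ext)
      (use r(2) in \<open>auto simp: matrix_vector_mul_assoc[symmetric] column_elem_mult vec_eq_iff axis_def algebra_simps\<close>)
  have "norm (column_elem k (axis k (sgn c)) *v x) = norm x" for x
  proof -
    have "norm ((column_elem k (axis k (sgn c)) *v x) $ i) = norm (x $ i)" for i
      using assms by (auto simp: column_elem_mult axis_def algebra_simps norm_mult norm_sgn)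
    then show ?thesis by (simp add: norm_vec_def)
  qed
  then have "volume_factor ((*v) (column_elem k (axis k (sgn c)))) = 1"
    by (rule volume_factor_isometry[OF linear_matrix_vector])
  then show ?thesis
    unfolding eq volume_factor_mult using volume_factor_scale_real[OF r(1), of k]
    by (simp add: r_def)
qed

text \<open>
  A shear is conjugate to its own square by a scaling of one coordinate, so its volume factor \<open>m\<close>
  satisfies \<open>m = m\<^sup>2\<close>, and it is nonzero.
\<close>

lemma volume_factor_shear:
  fixes k :: "'n::finite"
  assumes "a $ k = 1"
  shows "volume_factor ((*v) (column_elem k a)) = 1"
proof -
  \<comment> \<open>conjugating the shear by \<open>D\<close> doubles it, and so does composing it with itself\<close>
  define D where "D = column_elem k (axis k (2::complex))"
  have "column_elem k a ** D = D ** (column_elem k a ** column_elem k a)"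
    unfolding D_def
    by (rule matrix_ext)
      (use assms in \<open>auto simp: matrix_vector_mul_assoc[symmetric] column_elem_mult vec_eq_iff axis_def algebra_simps\<close>)
  then have "volume_factor ((*v) (column_elem k a)) * volume_factor ((*v) D)
     = volume_factor ((*v) D) * (volume_factor ((*v) (column_elem k a)) * volume_factor ((*v) (column_elem k a)))"
    by (metis volume_factor_mult)
  moreover have "volume_factor ((*v) D) \<noteq> 0" "volume_factor ((*v) (column_elem k a)) \<noteq> 0"
    by (rule volume_factor_nonzero; simp add: D_def det_column_elem assms)+
  ultimately show ?thesis by simp
qed

lemma volume_factor_column_elem:
  fixes k :: "'n::finite"
  assumes "a $ k \<noteq> 0"
  shows "volume_factor ((*v) (column_elem k a)) = (cmod (a $ k))\<^sup>2"
proof -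
  define b where "b = (\<chi> i. if i = k then 1 else a $ i / a $ k)"
  have "column_elem k a = column_elem k b ** column_elem k (axis k (a $ k))"
    by (rule matrix_ext)
      (use assms in \<open>auto simp: matrix_vector_mul_assoc[symmetric] column_elem_mult vec_eq_iff axis_def b_def field_simps\<close>)
  then show ?thesis
    using volume_factor_shear[of b k] volume_factor_scale[OF assms, of k]
    by (simp add: volume_factor_mult b_def)
qed

text \<open>
  Column elimination. The set \<open>K\<close> contains the columns that may still differ from those of the
  identity; splitting off a \<open>column_elem\<close> factor that carries the \<open>k\<close>-th column removes \<open>k\<close> from it. If the
  pivot entry vanishes, a shear that adds a suitable row first makes it nonzero.
\<close>

lemma volume_factor_invertible:
  fixes A :: "complex ^ 'n ^ 'n::finite"
  assumes "finite K" "\<And>j. j \<notin> K \<Longrightarrow> A *v axis j 1 = axis j 1" "det A \<noteq> 0"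
  shows "volume_factor ((*v) A) = (cmod (det A))\<^sup>2"
  using assms
proof (induction K arbitrary: A rule: finite_induct)
  case empty
  have "A $ i $ j = mat 1 $ i $ j" for i j
    using empty(1)[of j] by (auto simp: vec_eq_iff matrix_vector_mul_component mat_def inner_axis matrix_vector_mult_def axis_def if_distrib cong: if_cong)
  then have "A = mat 1" by (simp add: vec_eq_iff)
  moreover have "volume_factor ((*v) (mat 1 :: complex ^ 'n ^ 'n)) = 1"
    by (rule volume_factor_isometry[OF linear_matrix_vector]) simp
  ultimately show ?case
    by (simp del: matrix_vector_mul_lid)
next
  case (insert k K)
  have main: "volume_factor ((*v) A) = (cmod (det A))\<^sup>2"
    if A: "\<And>j. j \<notin> insert k K \<Longrightarrow> A *v axis j 1 = axis j 1" "det A \<noteq> 0" "(A *v axis k 1) $ k \<noteq> 0" for A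
  proof -
    define E where "E = column_elem k (A *v axis k 1)"
    have detE: "det E \<noteq> 0" using A(3) by (simp add: E_def det_column_elem)
    then obtain F where F: "F ** E = mat 1" "E ** F = mat 1"
      using invertible_det_nz[of E] by (auto simp: invertible_def)
    define B where "B = F ** A"
    have AEB: "A = E ** B" by (simp add: B_def matrix_mul_assoc F)
    have "E *v axis j 1 = (if j = k then A *v axis k 1 else axis j 1)" for j
      by (auto simp: E_def column_elem_mult axis_def vec_eq_iff)
    then have "E *v axis j 1 = A *v axis j 1" if "j \<notin> K" for j
      using A(1)[of j] that by auto
    then have "B *v axis j 1 = axis j 1" if "j \<notin> K" for j
      using that by (metis B_def F(1) matrix_vector_mul_assoc matrix_vector_mul_lid)
    moreover have "det B \<noteq> 0"
      using A(2) AEB by (auto simp: det_mul)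
    ultimately have "volume_factor ((*v) B) = (cmod (det B))\<^sup>2"
      by (rule insert.IH)
    moreover have "volume_factor ((*v) E) = (cmod (det E))\<^sup>2"
      unfolding E_def det_column_elem by (rule volume_factor_column_elem) (rule A(3))
    ultimately show ?thesis
      by (simp add: AEB volume_factor_mult det_mul norm_mult power_mult_distrib)
  qed
  show ?case
  proof (cases "(A *v axis k 1) $ k = 0")
    case False
    then show ?thesis using main insert.prems by blast
  next
    case True
    (* otherwise the column is supported outside K and k, where A fixes the basis vectors,
       so that A identifies it with axis k 1 *)
    have "\<exists>i\<in>K. (A *v axis k 1) $ i \<noteq> 0"
    proof (rule ccontr)
      assume *: "\<not> ?thesis"
      define v where "v = A *v axis k 1 - axis k 1"
      have "A *v (A *v axis k 1) = A *v axis k 1"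
      proof -
        have fixed: "A *v w = w" if w: "\<And>j. j \<in> insert k K \<Longrightarrow> w $ j = 0" for w
        proof -
          have ww: "w = (\<Sum>j\<in>UNIV. (w $ j) *s axis j 1)"
            by (simp add: basis_expansion)
          have "A *v w = (\<Sum>j\<in>UNIV. (w $ j) *s (A *v axis j 1))"
            by (subst ww) (simp add: vec.sum vec.scale)
          also have "\<dots> = (\<Sum>j\<in>UNIV. (w $ j) *s axis j 1)"
            by (rule sum.cong) (use w insert.prems(1) in \<open>auto simp: vec_eq_iff\<close>)
          finally show ?thesis using ww by simp
        qed
        show ?thesis by (rule fixed) (use * True in auto)
      qed
      then have "A *v v = 0" by (simp add: v_def matrix_vector_mult_diff_distrib)
      moreover have "v \<noteq> 0"
        using True by (metis v_def axis_nth right_minus_eq zero_neq_one)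
      ultimately show False
        using insert.prems(2) invertible_det_nz invertible_left_inverse
          matrix_left_invertible_ker by metis
    qed
    then obtain i where i: "i \<in> K" "(A *v axis k 1) $ i \<noteq> 0" by blast
    with insert.hyps have ik: "i \<noteq> k" by auto
    define E where "E = column_elem i (axis i 1 + axis k (1::complex))"
    have Ei: "(axis i 1 + axis k (1::complex)) $ i = 1" using ik by (simp add: axis_def)
    have detE: "det E = 1" "volume_factor ((*v) E) = 1"
      unfolding E_def det_column_elem using Ei volume_factor_shear[OF Ei] by auto
    have Emul: "E *v x = x + axis k (x $ i)" for x
      by (auto simp: E_def column_elem_mult vec_eq_iff axis_def)
    have "volume_factor ((*v) (E ** A)) = (cmod (det (E ** A)))\<^sup>2"
    proof (rule main)
      fix j assume "j \<notin> insert k K"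
      with i have "j \<noteq> i" "A *v axis j 1 = axis j 1" using insert.prems(1) by auto
      then show "(E ** A) *v axis j 1 = axis j 1"
        by (auto simp: matrix_vector_mul_assoc[symmetric] Emul axis_def vec_eq_iff)
    next
      show "det (E ** A) \<noteq> 0" using detE insert.prems by (simp add: det_mul)
    next
      show "((E ** A) *v axis k 1) $ k \<noteq> 0"
        using i True by (simp add: matrix_vector_mul_assoc[symmetric] Emul)
    qed
    then show ?thesis
      using detE by (simp add: volume_factor_mult det_mul)
  qed
qed

text \<open>
  A singular matrix collapses a real direction as well; an invertible one is handled by elimination.
\<close>

theorem volume_factor_matrix:
  fixes A :: "complex ^ 'n ^ 'n::finite"
  shows "volume_factor ((*v) A) = (cmod (det A))\<^sup>2"
proof (cases "det A = 0")
  case True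
  then obtain v where "A *v v = 0" "v \<noteq> 0"
    using invertible_det_nz invertible_left_inverse matrix_left_invertible_ker by metis
  with True show ?thesis
    using volume_factor_singular[OF linear_matrix_vector] by simp
next
  case False
  then show ?thesis by (intro volume_factor_invertible[of UNIV]) auto
qed

section \<open>Change of variables for injective holomorphic maps\<close>

lemma lborel_eq_distr_to_real:
  "distr lborel borel (to_real :: complex ^ 'n::finite \<Rightarrow> _) = lborel"
proof (rule lborel_eqI[symmetric])
  fix l u :: "real ^ 'n bit0"
  assume le: "\<And>b. b \<in> Basis \<Longrightarrow> l \<bullet> b \<le> u \<bullet> b"
  have meas: "(to_real :: complex ^ 'n \<Rightarrow> _) \<in> borel_measurable lborel"
    using borel_measurable_continuous_onI[OF linear_continuous_on[OF bounded_linear_to_real]] by simp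
  have inner_l: "of_realvec v \<bullet> basis_enum i = v $ i" for v :: "real ^ 'n bit0" and i
    by (simp add: of_realvec_def inner_sum_left inner_basis_enum)
  have surj: "b \<in> Basis \<Longrightarrow> \<exists>i. b = basis_enum i" for b :: "complex ^ 'n"
    using bij_basis_enum[where 'n = 'n] by (auto simp: bij_betw_def)
  have "to_real -` box l u \<inter> space lborel = box (of_realvec l) (of_realvec u :: complex ^ 'n)"
  proof -
    have "to_real x \<in> box l u \<longleftrightarrow> x \<in> box (of_realvec l) (of_realvec u)" for x :: "complex ^ 'n"
    proof -
      have "to_real x \<in> box l u \<longleftrightarrow> (\<forall>i. l $ i < x \<bullet> basis_enum i \<and> x \<bullet> basis_enum i < u $ i)"
        by (simp add: mem_box_cart to_real_def)
      also have "\<dots> \<longleftrightarrow> x \<in> box (of_realvec l) (of_realvec u)"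
        unfolding mem_box using surj basis_enum_in_Basis by (metis inner_l)
      finally show ?thesis .
    qed
    then show ?thesis by auto
  qed
  then have "emeasure (distr lborel borel (to_real :: complex ^ 'n \<Rightarrow> _)) (box l u)
      = emeasure lborel (box (of_realvec l) (of_realvec u :: complex ^ 'n))"
    using meas by (subst emeasure_distr) auto
  also have "\<dots> = (\<Prod>b\<in>Basis. (of_realvec u - of_realvec l :: complex ^ 'n) \<bullet> b)"
  proof (rule emeasure_lborel_box)
    fix b :: "complex ^ 'n" assume "b \<in> Basis"
    then obtain i where "b = basis_enum i" using surj by blast
    then show "of_realvec l \<bullet> b \<le> of_realvec u \<bullet> b"
      using le[of "axis i 1"] by (simp add: inner_l inner_axis axis_in_Basis_iff)
  qed
  also have "(\<Prod>b\<in>Basis. (of_realvec u - of_realvec l :: complex ^ 'n) \<bullet> b) = (\<Prod>i\<in>UNIV. (u - l) $ i)"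
    unfolding prod_basis_enum[symmetric] by (simp add: inner_diff_left inner_l)
  also have "\<dots> = (\<Prod>b\<in>Basis. (u - l) \<bullet> b)"
  proof -
    have "(\<Prod>b\<in>(\<lambda>i. axis i 1) ` UNIV. (u - l) \<bullet> b) = (\<Prod>i\<in>UNIV. (u - l) $ i)"
      by (subst prod.reindex) (auto simp: inj_def axis_eq_axis inner_axis)
    moreover have "(Basis :: (real ^ 'n bit0) set) = (\<lambda>i. axis i 1) ` UNIV"
      by (auto simp: Basis_vec_def)
    ultimately show ?thesis by simp
  qed
  finally show "emeasure (distr lborel borel (to_real :: complex ^ 'n \<Rightarrow> _)) (box l u) = (\<Prod>b\<in>Basis. (u - l) \<bullet> b)" .
qed simp

lemma measurable_to_real: "(to_real :: complex ^ 'n::finite \<Rightarrow> _) \<in> borel_measurable borel"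
  using borel_measurable_continuous_onI[OF linear_continuous_on[OF bounded_linear_to_real]] by simp

lemma to_real_mem_image [simp]: "to_real x \<in> to_real ` S \<longleftrightarrow> x \<in> S"
  by (metis bij_to_real bij_is_inj inj_image_mem_iff)

lemma open_to_real_image:
  assumes "open S" shows "open (to_real ` S)"
proof -
  have "to_real ` S = of_realvec -` S"
    using image_iff by fastforce
  then show ?thesis
    using assms linear_continuous_on[OF bounded_linear_of_realvec]
    by (metis continuous_on_open_vimage open_UNIV Int_UNIV_right)
qed

text \<open>
  Continuity on an open set makes the integrand Borel, so that the Lebesgue integral over \<open>real ^ 'n bit0\<close>
  used by the change of variables theorem and the Borel integral over \<open>complex ^ 'n\<close> can be compared.
\<close>

lemma to_real_transfer:
  fixes f :: "real ^ 'n::finite bit0 \<Rightarrow> real"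
  assumes S: "open S" and cont: "continuous_on (to_real ` S) f"
  shows "f absolutely_integrable_on (to_real ` S) \<longleftrightarrow> set_integrable lborel S (\<lambda>x. f (to_real x))"
    and "f absolutely_integrable_on (to_real ` S) \<Longrightarrow>
      integral (to_real ` S) f = (LINT x:S|lborel. f (to_real x))"
proof -
  let ?h = "\<lambda>x. indicator (to_real ` S) x *\<^sub>R f x"
  have meas: "?h \<in> borel_measurable borel"
    by (rule borel_measurable_continuous_on_indicator)
      (use cont open_to_real_image[OF S] in auto)
  have ind: "indicator (to_real ` S) (to_real x) = indicator S x" for x
    by (simp add: indicator_def)
  have "f absolutely_integrable_on (to_real ` S) \<longleftrightarrow> integrable lborel ?h"
    unfolding set_integrable_def by (rule integrable_completion) (use meas in simp)
  also have "\<dots> \<longleftrightarrow> integrable (distr lborel borel (to_real :: complex ^ 'n \<Rightarrow> _)) ?h"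
    by (simp add: lborel_eq_distr_to_real)
  also have "\<dots> \<longleftrightarrow> integrable lborel (\<lambda>x. ?h (to_real x))"
    by (rule integrable_distr_eq) (use meas measurable_to_real in auto)
  finally show iff: "f absolutely_integrable_on (to_real ` S) \<longleftrightarrow> set_integrable lborel S (\<lambda>x. f (to_real x))"
    by (simp add: set_integrable_def ind)
  assume *: "f absolutely_integrable_on (to_real ` S)"
  have "integral (to_real ` S) f = integral\<^sup>L lebesgue ?h"
    using set_lebesgue_integral_eq_integral(2)[OF *] by (simp add: set_lebesgue_integral_def)
  also have "\<dots> = integral\<^sup>L lborel ?h"
    by (rule integral_completion) (use meas in simp)
  also have "\<dots> = integral\<^sup>L (distr lborel borel (to_real :: complex ^ 'n \<Rightarrow> _)) ?h"
    by (simp add: lborel_eq_distr_to_real)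
  also have "\<dots> = integral\<^sup>L lborel (\<lambda>x. ?h (to_real x))"
    by (rule integral_distr) (use meas measurable_to_real in auto)
  finally show "integral (to_real ` S) f = (LINT x:S|lborel. f (to_real x))"
    by (simp add: set_lebesgue_integral_def ind)
qed

theorem complex_change_of_variables:
  fixes g :: "complex ^ 'n::finite \<Rightarrow> complex ^ 'n" and F :: "complex ^ 'n \<Rightarrow> real"
  assumes D: "open D" "open (g ` D)"
    and der: "\<And>z. z \<in> D \<Longrightarrow> (g has_derivative ((*v) (A z))) (at z)"
    and inj: "inj_on g D"
    and F: "continuous_on (g ` D) F"
    and A: "continuous_on D (\<lambda>z. det (A z))"
  shows "set_integrable lborel (g ` D) F \<longleftrightarrow>
           set_integrable lborel D (\<lambda>z. (cmod (det (A z)))\<^sup>2 * F (g z))"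
    and "set_integrable lborel (g ` D) F \<Longrightarrow>
           (LINT z:g ` D|lborel. F z) = (LINT z:D|lborel. (cmod (det (A z)))\<^sup>2 * F (g z))"
proof -
  define G where "G = to_real \<circ> g \<circ> of_realvec"
  define R where "R y = to_real \<circ> (*v) (A (of_realvec y)) \<circ> of_realvec" for y
  define F1 where "F1 = F \<circ> of_realvec"
  define F2 where "F2 y = (cmod (det (A (of_realvec y))))\<^sup>2 * F (g (of_realvec y))" for y
  have derG: "(G has_derivative R y) (at y within to_real ` D)" if "y \<in> to_real ` D" for y
  proof -
    have "of_realvec y \<in> D" using that by auto
    have "(G has_derivative R y) (at y)"
      unfolding G_def R_def
      by (intro diff_chain_at bounded_linear_imp_has_derivative bounded_linear_to_real
          bounded_linear_of_realvec)
        (use der[OF \<open>of_realvec y \<in> D\<close>] in auto)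
    then show ?thesis by (rule has_derivative_at_withinI)
  qed
  have injG: "inj_on G (to_real ` D)"
    unfolding G_def
    by (rule inj_onI) (metis comp_apply imageE inj inj_onD of_realvec_to_real)
  have detR: "\<bar>det (matrix (R y))\<bar> = (cmod (det (A (of_realvec y))))\<^sup>2" for y
    using volume_factor_matrix[of "A (of_realvec y)"] unfolding volume_factor_def R_def .
  have imG: "G ` to_real ` D = to_real ` g ` D"
    by (simp add: G_def image_comp comp_def)
  have contg: "continuous_on D g"
    by (meson der differentiable_imp_continuous_on differentiable_def differentiable_on_def
        has_derivative_at_withinI)
  have c_of: "continuous_on T of_realvec" for T :: "(real ^ 'n bit0) set"
    by (rule linear_continuous_on[OF bounded_linear_of_realvec])
  have cF1: "continuous_on (to_real ` g ` D) F1"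
    unfolding F1_def
    by (rule continuous_on_compose[OF c_of]) (use F in \<open>simp add: image_image\<close>)
  have "continuous_on D (\<lambda>z. (cmod (det (A z)))\<^sup>2 * F (g z))"
    by (intro continuous_intros A continuous_on_compose2[OF F contg]) auto
  then have cF2: "continuous_on (to_real ` D) F2"
    unfolding F2_def
    by (intro continuous_on_compose2[OF _ c_of, where g = "\<lambda>z. (cmod (det (A z)))\<^sup>2 * F (g z)"]) auto
  (* the real integrands enter the theorem for vector-valued functions as vectors of length 1 *)
  have F2_eq: "\<bar>det (matrix (R y))\<bar> *\<^sub>R vec (F1 (G y)) = (vec (F2 y) :: real ^ 1)" for y
    by (simp add: detR F1_def G_def F2_def vec_eq_iff)
  have cov: "F2 absolutely_integrable_on to_real ` D \<and> integral (to_real ` D) F2 = b \<longleftrightarrow>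
        F1 absolutely_integrable_on to_real ` g ` D \<and> integral (to_real ` g ` D) F1 = b" for b
    using has_absolute_integral_change_of_variables[OF _ derG injG, where f = "\<lambda>y. (vec (F1 y) :: real ^ 1)" and b = "vec b"]
      open_to_real_image[OF D(1)]
    unfolding F2_eq imG
    by (simp add: absolutely_integrable_on_1_iff integral_on_1_eq borel_open)
  have i: "F1 absolutely_integrable_on to_real ` g ` D \<longleftrightarrow> set_integrable lborel (g ` D) F"
    "F2 absolutely_integrable_on to_real ` D \<longleftrightarrow> set_integrable lborel D (\<lambda>z. (cmod (det (A z)))\<^sup>2 * F (g z))"
    using to_real_transfer(1)[OF D(2) cF1] to_real_transfer(1)[OF D(1) cF2]
    by (simp_all add: F1_def F2_def)
  then show "set_integrable lborel (g ` D) F \<longleftrightarrow>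
           set_integrable lborel D (\<lambda>z. (cmod (det (A z)))\<^sup>2 * F (g z))"
    using cov by blast
  assume "set_integrable lborel (g ` D) F"
  then have F1: "F1 absolutely_integrable_on to_real ` g ` D"
    and F2: "F2 absolutely_integrable_on to_real ` D"
    and eq: "integral (to_real ` D) F2 = integral (to_real ` g ` D) F1"
    using i cov by blast+
  show "(LINT z:g ` D|lborel. F z) = (LINT z:D|lborel. (cmod (det (A z)))\<^sup>2 * F (g z))"
    using to_real_transfer(2)[OF D(2) cF1 F1] to_real_transfer(2)[OF D(1) cF2 F2] eq
    by (simp add: F1_def F2_def)
qed

section \<open>Holomorphic functions of several variables\<close>

lemma norm_smult_vec: "norm (t *s u) = cmod t * norm (u :: complex ^ 'n::finite)"
  by (simp add: norm_vec_def norm_mult L2_set_right_distrib)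

lemma complex_linear_expansion:
  fixes L :: "complex ^ 'n::finite \<Rightarrow> complex"
  assumes "linear L" "\<And>c h. L (c *s h) = c * L h"
  shows "L h = (\<Sum>k\<in>UNIV. L (axis k 1) * h $ k)"
proof -
  have "L h = L (\<Sum>k\<in>UNIV. (h $ k) *s axis k 1)"
    by (simp add: basis_expansion)
  also have "\<dots> = (\<Sum>k\<in>UNIV. L ((h $ k) *s axis k 1))"
    by (rule linear_sum[OF assms(1)])
  finally show ?thesis by (simp add: assms(2) mult.commute)
qed

lemma has_field_derivative_along_line:
  fixes f :: "complex ^ 'n::finite \<Rightarrow> complex"
  assumes "(f has_derivative L) (at (z + t *s u))" "\<And>c h. L (c *s h) = c * L h"
  shows "((\<lambda>t. f (z + t *s u)) has_field_derivative L u) (at t)"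
proof -
  have "bounded_linear (\<lambda>t::complex. t *s u)"
    by (rule bounded_linear_intro[where K = "norm u"])
      (auto simp: norm_smult_vec vec_eq_iff algebra_simps)
  then have "((\<lambda>t. z + t *s u) has_derivative (\<lambda>t. t *s u)) (at t)"
    by (auto intro!: derivative_eq_intros bounded_linear_imp_has_derivative)
  from diff_chain_at[OF this assms(1)]
  have "((\<lambda>t. f (z + t *s u)) has_derivative (\<lambda>t. L (t *s u))) (at t)"
    by (simp add: comp_def)
  then show ?thesis
    by (simp add: assms(2) has_field_derivative_def mult_commute_abs)
qed

lemma axis_eq_smult: "axis k t = t *s axis k (1::complex)"
  by (simp add: vec_eq_iff axis_def)

text \<open>
  \<open>gradient_app\<close> is built from partial derivatives; once the total derivative is known to exist and to be
  complex homogeneous, it is recovered by restricting to the coordinate lines.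
\<close>

lemma gradient_app_eqI:
  fixes f :: "complex ^ 'n::finite \<Rightarrow> complex"
  assumes "(f has_derivative L) (at z)" "\<And>c h. L (c *s h) = c * L h"
  shows "gradient_app f z = L"
proof
  fix u
  have "partial_z k f z = L (axis k 1)" for k
  proof -
    have "((\<lambda>t. f (z + t *s axis k 1)) has_field_derivative L (axis k 1)) (at 0)"
      by (rule has_field_derivative_along_line) (use assms in auto)
    then show ?thesis
      unfolding partial_z_def by (intro DERIV_imp_deriv) (simp only: axis_eq_smult[symmetric])
  qed
  then show "gradient_app f z u = L u"
    using complex_linear_expansion[OF has_derivative_linear[OF assms(1)] assms(2), of u]
    by (simp add: gradient_app_def)
qed

lemma holo_funI:
  assumes "\<And>z. z \<in> D \<Longrightarrow> \<exists>L. (f has_derivative L) (at z) \<and> (\<forall>c h. L (c *s h) = c * L h)"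
  shows "holo_fun D (f :: complex ^ 'n::finite \<Rightarrow> complex)"
  unfolding holo_fun_def
proof
  fix z assume "z \<in> D"
  then obtain L where L: "(f has_derivative L) (at z)" "\<And>c h. L (c *s h) = c * L h"
    using assms by blast
  define a where "a = (\<chi> k. L (axis k 1))"
  have "L = (\<lambda>h. \<Sum>k\<in>UNIV. a $ k * h $ k)"
    unfolding a_def vec_lambda_beta
    by (rule ext) (rule complex_linear_expansion[OF has_derivative_linear[OF L(1)] L(2)])
  with L(1) have "(f has_derivative (\<lambda>h. \<Sum>k\<in>UNIV. a $ k * h $ k)) (at z)"
    by (rule subst[rotated])
  then show "\<exists>a. (f has_derivative (\<lambda>h. \<Sum>k\<in>UNIV. a $ k * h $ k)) (at z)" ..
qed

lemma gradient_app_smult: "gradient_app f z (c *s u) = c * gradient_app f z u"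
  by (simp add: gradient_app_def sum_distrib_left algebra_simps)

lemma gradient_app_expand: "gradient_app f z u = (\<Sum>k\<in>UNIV. u $ k * gradient_app f z (axis k 1))"
  by (simp add: gradient_app_def axis_def if_distrib mult.commute cong: if_cong)

lemma holo_fun_has_derivative:
  fixes f :: "complex ^ 'n::finite \<Rightarrow> complex"
  assumes "holo_fun D f" "z \<in> D"
  shows "(f has_derivative gradient_app f z) (at z)"
proof -
  from bspec[OF assms(1)[unfolded holo_fun_def] assms(2)] obtain a :: "complex ^ 'n"
    where a: "(f has_derivative (\<lambda>h. \<Sum>k\<in>UNIV. a $ k * h $ k)) (at z)" ..
  have "gradient_app f z = (\<lambda>h. \<Sum>k\<in>UNIV. a $ k * h $ k)"
    by (rule gradient_app_eqI[OF a]) (simp add: sum_distrib_left mult.left_commute)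
  with a show ?thesis by (simp only:)
qed

lemma holo_fun_subset: "holo_fun D f \<Longrightarrow> E \<subseteq> D \<Longrightarrow> holo_fun E f"
  unfolding holo_fun_def by blast

lemma holo_fun_continuous_on: "holo_fun D f \<Longrightarrow> continuous_on D f"
  by (intro continuous_at_imp_continuous_on ballI)
    (rule has_derivative_continuous[OF holo_fun_has_derivative])

lemma holo_fun_line:
  assumes "holo_fun D f" "z + t *s u \<in> D"
  shows "((\<lambda>t. f (z + t *s u)) has_field_derivative gradient_app f (z + t *s u) u) (at t)"
  by (rule has_field_derivative_along_line[OF holo_fun_has_derivative[OF assms]])
    (rule gradient_app_smult)

lemma holo_fun_const [simp]: "holo_fun D (\<lambda>z. c)"
  by (rule holo_funI) (auto intro!: exI[of _ "\<lambda>h. 0"])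

lemma gradient_app_const [simp]: "gradient_app (\<lambda>z. c) z = (\<lambda>u. 0)"
  by (rule gradient_app_eqI) auto

lemma has_derivative_coord: "((\<lambda>z. z $ k) has_derivative (\<lambda>h. h $ k)) (at z)"
  by (rule bounded_linear_imp_has_derivative) (rule bounded_linear_vec_nth)

lemma holo_fun_coord [simp]: "holo_fun D (\<lambda>z. z $ k)"
  by (rule holo_funI) (auto intro!: exI[of _ "\<lambda>h. h $ k"] has_derivative_coord)

lemma gradient_app_add:
  assumes "holo_fun D f" "holo_fun D g" "z \<in> D"
  shows "gradient_app (\<lambda>z. f z + g z) z = (\<lambda>u. gradient_app f z u + gradient_app g z u)"
  by (rule gradient_app_eqI[OF has_derivative_add[OF holo_fun_has_derivative holo_fun_has_derivative]])
    (use assms in \<open>auto simp: gradient_app_smult algebra_simps\<close>)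

lemma holo_fun_add:
  assumes "holo_fun D f" "holo_fun D g"
  shows "holo_fun D (\<lambda>z. f z + g z)"
  by (rule holo_funI, rule exI, rule conjI,
      rule has_derivative_add[OF holo_fun_has_derivative holo_fun_has_derivative])
    (use assms in \<open>auto simp: gradient_app_smult algebra_simps\<close>)

lemma gradient_app_mult:
  assumes "holo_fun D f" "holo_fun D g" "z \<in> D"
  shows "gradient_app (\<lambda>z. f z * g z) z = (\<lambda>u. f z * gradient_app g z u + gradient_app f z u * g z)"
  by (rule gradient_app_eqI[OF has_derivative_mult[OF holo_fun_has_derivative holo_fun_has_derivative]])
    (use assms in \<open>auto simp: gradient_app_smult algebra_simps\<close>)

lemma holo_fun_mult:
  assumes "holo_fun D f" "holo_fun D g"
  shows "holo_fun D (\<lambda>z. f z * g z)"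
  by (rule holo_funI, rule exI, rule conjI,
      rule has_derivative_mult[OF holo_fun_has_derivative holo_fun_has_derivative])
    (use assms in \<open>auto simp: gradient_app_smult algebra_simps\<close>)

lemma gradient_app_cmult:
  assumes "holo_fun D f" "z \<in> D"
  shows "gradient_app (\<lambda>z. c * f z) z = (\<lambda>u. c * gradient_app f z u)"
  using gradient_app_mult[OF holo_fun_const assms] by simp

lemma holo_fun_cmult: "holo_fun D f \<Longrightarrow> holo_fun D (\<lambda>z. c * f z)"
  by (rule holo_fun_mult) auto

lemma holo_fun_diff: "holo_fun D f \<Longrightarrow> holo_fun D g \<Longrightarrow> holo_fun D (\<lambda>z. f z - g z)"
  using holo_fun_add[of D f "\<lambda>z. -1 * g z"] holo_fun_cmult[of D g "-1"] by simp

lemma gradient_app_diff: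
  assumes "holo_fun D f" "holo_fun D g" "z \<in> D"
  shows "gradient_app (\<lambda>z. f z - g z) z = (\<lambda>u. gradient_app f z u - gradient_app g z u)"
  using gradient_app_add[OF assms(1) holo_fun_cmult[OF assms(2), of "-1"] assms(3)]
    gradient_app_cmult[OF assms(2,3), of "-1"] by simp

lemma holo_fun_sum:
  "(\<And>i. i \<in> I \<Longrightarrow> holo_fun D (f i)) \<Longrightarrow> holo_fun D (\<lambda>z. \<Sum>i\<in>I. f i z)"
  by (induction I rule: infinite_finite_induct) (auto intro: holo_fun_add)

lemma holo_fun_prod:
  "(\<And>i. i \<in> I \<Longrightarrow> holo_fun D (f i)) \<Longrightarrow> holo_fun D (\<lambda>z. \<Prod>i\<in>I. f i z)"
  by (induction I rule: infinite_finite_induct) (auto intro: holo_fun_mult)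

lemma jacobian_mult_component:
  "(jacobian g z *v u) $ j = gradient_app (\<lambda>w. g w $ j) z u"
  by (simp add: jacobian_def gradient_app_def matrix_vector_mult_def)

lemma holo_map_has_derivative:
  fixes g :: "complex ^ 'n::finite \<Rightarrow> complex ^ 'm::finite"
  assumes "holo_map D g" "z \<in> D"
  shows "(g has_derivative ((*v) (jacobian g z))) (at z)"
proof (subst has_derivative_componentwise_within, intro ballI)
  fix i :: "complex ^ 'm" assume "i \<in> Basis"
  then obtain j b where i: "i = axis j b" by (auto simp: Basis_vec_def)
  have "((\<lambda>x. g x $ j) has_derivative gradient_app (\<lambda>x. g x $ j) z) (at z)"
    using assms unfolding holo_map_def by (intro holo_fun_has_derivative) auto
  then show "((\<lambda>x. g x \<bullet> i) has_derivative (\<lambda>x. (jacobian g z *v x) \<bullet> i)) (at z)"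
    unfolding i inner_axis jacobian_mult_component by (rule has_derivative_inner_left)
qed

lemma matrix_vector_smult: "A *v (c *s h) = c *s (A *v (h :: complex ^ 'n))"
  by (simp add: vec.scale)

lemma holo_fun_chain:
  fixes f :: "complex ^ 'm::finite \<Rightarrow> complex" and g :: "complex ^ 'n::finite \<Rightarrow> complex ^ 'm"
  assumes "holo_map D g" "holo_fun E f" "g ` D \<subseteq> E" "z \<in> D"
  shows "((f \<circ> g) has_derivative (\<lambda>u. gradient_app f (g z) (jacobian g z *v u))) (at z)"
  using diff_chain_at[OF holo_map_has_derivative[OF assms(1,4)] holo_fun_has_derivative[OF assms(2)]] assms
  by (auto simp: comp_def)

lemma holo_fun_compose:
  assumes "holo_map D g" "holo_fun E f" "g ` D \<subseteq> E"
  shows "holo_fun D (f \<circ> g)"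
  by (rule holo_funI, rule exI, rule conjI, rule holo_fun_chain[OF assms])
    (auto simp: matrix_vector_smult gradient_app_smult)

lemma gradient_app_compose:
  assumes "holo_map D g" "holo_fun E f" "g ` D \<subseteq> E" "z \<in> D"
  shows "gradient_app (f \<circ> g) z u = gradient_app f (g z) (jacobian g z *v u)"
  using gradient_app_eqI[OF holo_fun_chain[OF assms]]
  by (simp add: matrix_vector_smult gradient_app_smult)

lemma gradient_app_cong:
  assumes "open D" "z \<in> D" "\<And>w. w \<in> D \<Longrightarrow> f w = g w" "holo_fun D f"
  shows "gradient_app f z = gradient_app g z"
proof -
  have "(g has_derivative gradient_app f z) (at z)"
    by (rule has_derivative_transform_within_open[OF holo_fun_has_derivative[OF assms(4,2)] assms(1,2)])
      (use assms in auto)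
  then show ?thesis
    by (metis gradient_app_eqI gradient_app_smult)
qed

lemma line_holomorphic:
  assumes f: "holo_fun D f" and D: "cball z r \<subseteq> D" and u: "norm u \<le> 1" and r: "r > 0"
  shows "(\<lambda>t. f (z + t *s u)) holomorphic_on (cball 0 r)"
    and "\<And>t. t \<in> cball 0 r \<Longrightarrow> z + t *s u \<in> cball z r"
proof -
  show *: "z + t *s u \<in> cball z r" if "t \<in> cball 0 r" for t
    using that mult_mono[of "cmod t" r "norm u" 1] u r by (simp add: dist_norm norm_smult_vec)
  show "(\<lambda>t. f (z + t *s u)) holomorphic_on (cball 0 r)"
    using holo_fun_line[OF f] * D
    by (meson field_differentiable_at_within field_differentiable_def holomorphic_onI subset_iff)
qed

lemma half_cball: "w \<in> cball z (r/2) \<Longrightarrow> cball w (r/2) \<subseteq> cball z r"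
proof
  fix x assume "w \<in> cball z (r/2)" "x \<in> cball w (r/2)"
  then show "x \<in> cball z r"
    using dist_triangle[of z x w] by auto
qed

text \<open>
  The Cauchy estimate on the complex line through \<open>z\<close> in the direction \<open>u\<close>.
\<close>

lemma gradient_bound:
  fixes f :: "complex ^ 'n::finite \<Rightarrow> complex"
  assumes f: "holo_fun D f" and D: "cball z r \<subseteq> D" and r: "r > 0"
    and M: "\<And>w. w \<in> cball z r \<Longrightarrow> cmod (f w) \<le> M"
  shows "cmod (gradient_app f z u) \<le> M / r * norm u"
proof -
  have unit: "cmod (gradient_app f z e) \<le> M / r" if e: "norm e \<le> 1" for e
  proof -
    note hol = line_holomorphic[OF f D e r]
    have "cmod ((deriv ^^ 1) (\<lambda>t. f (z + t *s e)) 0) \<le> fact 1 * M / r ^ 1"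
      by (rule Cauchy_inequality)
        (use hol M r in \<open>auto intro: holomorphic_on_subset holomorphic_on_imp_continuous_on\<close>)
    moreover have "deriv (\<lambda>t. f (z + t *s e)) 0 = gradient_app f z e"
      using holo_fun_line[OF f, of z 0 e] subsetD[OF D, of z] r by (auto intro!: DERIV_imp_deriv)
    ultimately show ?thesis by simp
  qed
  show ?thesis
  proof (cases "u = 0")
    case True
    then show ?thesis by (simp add: gradient_app_def)
  next
    case False
    define e where "e = (1 / complex_of_real (norm u)) *s u"
    have e: "norm e \<le> 1" "u = complex_of_real (norm u) *s e"
      using False by (auto simp: e_def norm_smult_vec norm_divide)
    then have "cmod (gradient_app f z u) = norm u * cmod (gradient_app f z e)"
      by (metis abs_of_nonneg gradient_app_smult norm_ge_zero norm_mult norm_of_real)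
    then show ?thesis
      using unit[OF e(1)] mult_left_mono[of _ _ "norm u"] by (metis mult.commute norm_ge_zero)
  qed
qed

text \<open>
  On the line through \<open>z\<close> in the direction \<open>h\<close> the Cauchy estimate on discs of radius \<open>r/2\<close> bounds the second
  derivative by \<open>2 M / (r/2)\<^sup>2 = 8 M / r\<^sup>2\<close>.
\<close>

lemma taylor_bound:
  fixes f :: "complex ^ 'n::finite \<Rightarrow> complex"
  assumes f: "holo_fun D f" and D: "cball z r \<subseteq> D" and r: "r > 0"
    and M: "\<And>w. w \<in> cball z r \<Longrightarrow> cmod (f w) \<le> M"
    and h: "norm h \<le> r / 2"
  shows "cmod (f (z + h) - f z - gradient_app f z h) \<le> 8 * M / r\<^sup>2 * (norm h)\<^sup>2"
proof (cases "h = 0")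
  case True
  then show ?thesis by (simp add: gradient_app_def)
next
  case False
  define e where "e = (1 / complex_of_real (norm h)) *s h"
  define s where "s = complex_of_real (norm h)"
  have e: "norm e \<le> 1" and he: "h = s *s e"
    using False by (auto simp: e_def s_def norm_smult_vec norm_divide)
  define g where "g t = f (z + t *s e)" for t
  note hol = line_holomorphic[OF f D e r, folded g_def]
  have sub: "t \<in> cball 0 (r/2) \<Longrightarrow> cball t (r/2) \<subseteq> cball (0::complex) r" for t
    by (rule half_cball)
  have holb: "g holomorphic_on ball 0 r"
    using hol(1) by (rule holomorphic_on_subset) auto
  have g2: "cmod ((deriv ^^ 2) g t) \<le> 8 * M / r\<^sup>2" if t: "t \<in> cball 0 (r/2)" for t
  proof -
    have "cmod ((deriv ^^ 2) g t) \<le> fact 2 * M / (r/2) ^ 2"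
    proof (rule Cauchy_inequality)
      show "g holomorphic_on ball t (r/2)"
        by (rule holomorphic_on_subset[OF hol(1)])
          (use sub[OF t] ball_subset_cball[of t "r/2"] in blast)
      show "continuous_on (cball t (r/2)) g"
        by (rule continuous_on_subset[OF holomorphic_on_imp_continuous_on[OF hol(1)]]) (use sub[of t] t in blast)
      fix x assume "cmod (t - x) = r / 2"
      then have "x \<in> cball 0 r" using subsetD[OF sub[OF t], of x] by (simp add: dist_norm)
      then show "cmod (g x) \<le> M" unfolding g_def using hol(2) M by blast
    qed (use r in auto)
    then show ?thesis by (simp add: power2_eq_square fact_numeral)
  qed
  have der: "((deriv ^^ i) g has_field_derivative (deriv ^^ Suc i) g x) (at x within cball 0 (r/2))"
    if "x \<in> cball 0 (r/2)" for i x
  proof -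
    have "(deriv ^^ i) g holomorphic_on ball 0 r"
      by (rule holomorphic_higher_deriv[OF holb]) auto
    moreover have "x \<in> ball 0 r" using that r by auto
    ultimately show ?thesis
      using holomorphic_derivI[of "(deriv ^^ i) g" "ball 0 r" x] has_field_derivative_at_within by auto
  qed
  have "cmod ((deriv ^^ 0) g s - (\<Sum>i\<le>1. (deriv ^^ i) g 0 * (s - 0) ^ i / fact i))
      \<le> 8 * M / r\<^sup>2 * cmod (s - 0) ^ Suc 1 / fact 1"
    by (rule complex_Taylor[where S = "cball 0 (r/2)"])
      (use der g2 r h in \<open>auto simp: s_def numeral_2_eq_2\<close>)
  moreover have "deriv g 0 = gradient_app f z e"
    unfolding g_def using holo_fun_line[OF f, of z 0 e] subsetD[OF D, of z] r by (auto intro!: DERIV_imp_deriv)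
  moreover have "gradient_app f z h = s * gradient_app f z e"
    by (simp add: he gradient_app_smult)
  moreover have "g s = f (z + h)" "g 0 = f z" by (simp_all add: g_def he)
  moreover have "cmod s = norm h" by (simp add: s_def)
  ultimately show ?thesis by (simp add: power2_eq_square algebra_simps)
qed

text \<open>
  Weierstrass' theorem. The Cauchy estimates make the derivatives uniformly Cauchy on the smaller ball, so
  the theorem on termwise differentiation produces the total derivative of the limit; homogeneity over
  the complex numbers passes to the limit.
\<close>

theorem holo_fun_uniform_limit_ball:
  fixes f :: "nat \<Rightarrow> complex ^ 'n::finite \<Rightarrow> complex"
  assumes f: "\<And>n. holo_fun D (f n)" and D: "cball z r \<subseteq> D" and r: "r > 0"
    and lim: "uniform_limit (cball z r) f g sequentially"
  shows "holo_fun (ball z (r/2)) g"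
proof -
  have sub: "w \<in> ball z (r/2) \<Longrightarrow> cball w (r/2) \<subseteq> cball z r" for w
    by (rule half_cball) auto
  have cauchy: "\<exists>N. \<forall>m\<ge>N. \<forall>n\<ge>N. \<forall>w\<in>ball z (r/2). \<forall>h.
      cmod (gradient_app (f m) w h - gradient_app (f n) w h) \<le> e * norm h" if e: "e > 0" for e
  proof -
    have "e * r / 4 > 0" using e r by auto
    then obtain N where N: "\<And>n w. n \<ge> N \<Longrightarrow> w \<in> cball z r \<Longrightarrow> dist (f n w) (g w) < e * r / 4"
      using lim unfolding uniform_limit_sequentially_iff by blast
    have "cmod (gradient_app (f m) w h - gradient_app (f n) w h) \<le> e * norm h"
      if mn: "m \<ge> N" "n \<ge> N" and w: "w \<in> ball z (r/2)" for m n w h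
    proof -
      have wD: "w \<in> D" using subsetD[OF sub[OF w], of w] D r by auto
      have "cmod (f m x - f n x) \<le> e * r / 2" if "x \<in> cball w (r/2)" for x
      proof -
        have x: "x \<in> cball z r" using sub[OF w] that by blast
        have "cmod (f m x - f n x) \<le> dist (f m x) (g x) + dist (f n x) (g x)"
          by (metis dist_norm dist_triangle2)
        with N[OF mn(1) x] N[OF mn(2) x] show ?thesis by (simp add: field_simps)
      qed
      then have "cmod (gradient_app (\<lambda>x. f m x - f n x) w h) \<le> (e * r / 2) / (r / 2) * norm h"
        by (intro gradient_bound[of D]) (use sub[OF w] D r f in \<open>auto intro: holo_fun_diff\<close>)
      then show ?thesis
        using r by (simp add: gradient_app_diff[OF f f wD])
    qed
    then show ?thesis by blast
  qed
  define g' where "g' w h = lim (\<lambda>n. gradient_app (f n) w h)" for w h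
  have conv: "(\<lambda>n. gradient_app (f n) w h) \<longlonglongrightarrow> g' w h" if w: "w \<in> ball z (r/2)" for w h
  proof -
    have "Cauchy (\<lambda>n. gradient_app (f n) w h)"
    proof (rule CauchyI)
      fix e :: real assume "e > 0"
      define e' where "e' = e / (2 * (norm h + 1))"
      have e': "e' > 0" "e' * norm h < e"
      proof -
        have pos: "norm h + 1 > 0" by (simp add: add_nonneg_pos)
        then show "e' > 0" using \<open>e > 0\<close> by (simp add: e'_def)
        then have "e' * norm h < e' * (2 * (norm h + 1))"
          using norm_ge_zero[of h] by (intro mult_strict_left_mono) (simp_all add: add_strict_increasing2)
        also have "\<dots> = e" using pos by (simp add: e'_def)
        finally show "e' * norm h < e" .
      qed
      obtain N where "\<forall>m\<ge>N. \<forall>n\<ge>N. \<forall>w\<in>ball z (r/2). \<forall>h.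
        cmod (gradient_app (f m) w h - gradient_app (f n) w h) \<le> e' * norm h"
        using cauchy[OF e'(1)] by blast
      then show "\<exists>M. \<forall>m\<ge>M. \<forall>n\<ge>M. cmod (gradient_app (f m) w h - gradient_app (f n) w h) < e"
        using w e' by (intro exI[of _ N]) (meson le_less_trans)
    qed
    then show ?thesis
      unfolding g'_def by (simp add: Cauchy_convergent_iff convergent_LIMSEQ_iff)
  qed
  have smult: "g' w (c *s h) = c * g' w h" if "w \<in> ball z (r/2)" for w c h
  proof (rule LIMSEQ_unique)
    show "(\<lambda>n. gradient_app (f n) w (c *s h)) \<longlonglongrightarrow> c * g' w h"
      unfolding gradient_app_smult by (intro tendsto_mult conv that tendsto_const)
  qed (rule conv[OF that])
  have "\<exists>G. \<forall>w\<in>ball z (r/2). (\<lambda>n. f n w) \<longlonglongrightarrow> G w \<and> (G has_derivative g' w) (at w within ball z (r/2))"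
  proof (rule has_derivative_sequence[where f = f and f' = "\<lambda>n. gradient_app (f n)" and g' = g'
        and S = "ball z (r/2)" and ?x0.0 = z and l = "g z"])
    show "(f n has_derivative gradient_app (f n) x) (at x within ball z (r/2))" if "x \<in> ball z (r/2)" for n x
      using subsetD[OF sub[OF that], of x] D r f
      by (intro has_derivative_at_withinI[OF holo_fun_has_derivative[of D]]) auto
    show "\<forall>\<^sub>F n in sequentially. \<forall>x\<in>ball z (r/2). \<forall>h. cmod (gradient_app (f n) x h - g' x h) \<le> e * norm h"
      if "e > 0" for e
    proof -
      obtain N where N: "\<forall>m\<ge>N. \<forall>n\<ge>N. \<forall>w\<in>ball z (r/2). \<forall>h.
        cmod (gradient_app (f m) w h - gradient_app (f n) w h) \<le> e * norm h"
        using cauchy[OF \<open>e > 0\<close>] by blast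
      have "cmod (gradient_app (f n) x h - g' x h) \<le> e * norm h"
        if "n \<ge> N" "x \<in> ball z (r/2)" for n x h
        by (rule Lim_norm_ubound[where net = sequentially and f = "\<lambda>m. gradient_app (f n) x h - gradient_app (f m) x h"])
          (use N that in \<open>auto intro!: tendsto_diff conv eventually_sequentiallyI[of N]\<close>)
      then show ?thesis by (intro eventually_sequentiallyI[of N]) blast
    qed
    show "(\<lambda>n. f n z) \<longlonglongrightarrow> g z"
      by (rule tendsto_uniform_limitI[OF lim]) (use r in auto)
    show "convex (ball z (r/2))" by simp
    show "z \<in> ball z (r/2)" using r by simp
  qed
  then obtain G where G: "\<And>w. w \<in> ball z (r/2) \<Longrightarrow> (\<lambda>n. f n w) \<longlonglongrightarrow> G w"
    "\<And>w. w \<in> ball z (r/2) \<Longrightarrow> (G has_derivative g' w) (at w within ball z (r/2))"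
    by blast
  have Gg: "G w = g w" if "w \<in> ball z (r/2)" for w
    using LIMSEQ_unique[OF G(1)[OF that] tendsto_uniform_limitI[OF lim]] that r by auto
  show ?thesis
  proof (rule holo_funI)
    fix w assume w: "w \<in> ball z (r/2)"
    have "(G has_derivative g' w) (at w)"
      using G(2)[OF w] at_within_open[OF w] by simp
    then have "(g has_derivative g' w) (at w)"
      by (rule has_derivative_transform_within_open[OF _ open_ball w Gg])
    then show "\<exists>L. (g has_derivative L) (at w) \<and> (\<forall>c h. L (c *s h) = c * L h)"
      using smult[OF w] by blast
  qed
qed

lemma holo_fun_locally:
  assumes "\<And>z. z \<in> D \<Longrightarrow> \<exists>r>0. holo_fun (ball z r) f"
  shows "holo_fun D f"
  unfolding holo_fun_def
proof
  fix z assume "z \<in> D"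
  then obtain r where "r > 0" "holo_fun (ball z r) f"
    using assms by blast
  from bspec[OF this(2)[unfolded holo_fun_def], of z] this(1)
  show "\<exists>a. (f has_derivative (\<lambda>h. \<Sum>k\<in>UNIV. a $ k * h $ k)) (at z)"
    by simp
qed

lemma bounded_on_cball:
  fixes f :: "complex ^ 'n::finite \<Rightarrow> complex"
  assumes "holo_fun D f" "cball z r \<subseteq> D"
  obtains M where "M > 0" "\<And>w. w \<in> cball z r \<Longrightarrow> cmod (f w) \<le> M"
proof -
  have "compact (f ` cball z r)"
    by (intro compact_continuous_image continuous_on_subset[OF holo_fun_continuous_on[OF assms(1)] assms(2)] compact_cball)
  then obtain M where "M > 0" "\<forall>x\<in>f ` cball z r. norm x \<le> M"
    using compact_imp_bounded bounded_pos by metis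
  with that show ?thesis by blast
qed

text \<open>
  The difference quotients with steps \<open>u/n\<close> are holomorphic and, by the quadratic Taylor bound,
  converge to the directional derivative locally uniformly.
\<close>

lemma holo_fun_gradient:
  fixes f :: "complex ^ 'n::finite \<Rightarrow> complex"
  assumes D: "open D" and f: "holo_fun D f"
  shows "holo_fun D (\<lambda>z. gradient_app f z u)"
proof (rule holo_fun_locally)
  fix z assume "z \<in> D"
  then obtain R where R: "R > 0" "cball z R \<subseteq> D"
    using D open_contains_cball by blast
  obtain M where M: "M > 0" "\<And>w. w \<in> cball z R \<Longrightarrow> cmod (f w) \<le> M"
    using bounded_on_cball[OF f R(2)] by blast
  \<comment> \<open>starting at \<open>N\<close> keeps all shifted points inside the ball of radius \<open>R\<close>\<close>
  obtain N :: nat where N: "norm u < real N * (R / 4)"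
    using R reals_Archimedean3[of "R/4"] by auto
  define s :: "nat \<Rightarrow> complex" where "s n = of_nat (n + N + 1)" for n
  define F where "F n w = s n * (f (w + (1 / s n) *s u) - f w)" for n w
  have small: "norm ((1 / s n) *s u) \<le> R / 4" for n
  proof -
    have "real N * (R / 4) \<le> real (n + N + 1) * (R / 4)"
      by (rule mult_right_mono) (use R in auto)
    with N have "norm u \<le> real (n + N + 1) * (R / 4)"
      by linarith
    then show ?thesis
      by (simp add: norm_smult_vec norm_divide s_def field_simps del: of_nat_add of_nat_Suc)
  qed
  have sub: "w \<in> ball z (R/2) \<Longrightarrow> cball w (R/2) \<subseteq> cball z R" for w
    by (rule half_cball) auto
  have sh: "holo_fun (ball z (R/2)) (\<lambda>w. f (w + (1 / s n) *s u))" for n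
  proof -
    have "holo_fun (ball z (R/2)) (f \<circ> (\<lambda>w. w + (1 / s n) *s u))"
    proof (rule holo_fun_compose[OF _ f])
      show "holo_map (ball z (R/2)) (\<lambda>w. w + (1 / s n) *s u)"
        unfolding holo_map_def by (auto intro!: holo_fun_add)
      show "(\<lambda>w. w + (1 / s n) *s u) ` ball z (R/2) \<subseteq> D"
      proof clarify
        fix w assume w: "w \<in> ball z (R/2)"
        have "w + (1 / s n) *s u \<in> cball w (R/2)"
          using small[of n] R by (simp add: dist_norm)
        then show "w + (1 / s n) *s u \<in> D" using sub[OF w] R by blast
      qed
    qed
    then show ?thesis by (simp add: comp_def)
  qed
  have "holo_fun (ball z (R/4/2)) (\<lambda>w. gradient_app f w u)"
  proof (rule holo_fun_uniform_limit_ball)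
    show "holo_fun (ball z (R/2)) (F n)" for n
      unfolding F_def
      by (intro holo_fun_cmult holo_fun_diff sh holo_fun_subset[OF f])
        (use R in \<open>auto simp: subset_iff\<close>)
    show "cball z (R/4) \<subseteq> ball z (R/2)" using R by auto
    define C where "C = 8 * M / (R/2)\<^sup>2 * (norm u)\<^sup>2"
    have bound: "cmod (F n w - gradient_app f w u) \<le> C / real (n + 1)" if w: "w \<in> cball z (R/4)" for n w
    proof -
      let ?h = "(1 / s n) *s u"
      have w2: "w \<in> ball z (R/2)" using w R by auto
      have sn: "s n \<noteq> 0" "cmod (s n) = real (n + N + 1)"
        unfolding s_def by (simp_all del: of_nat_add of_nat_Suc)
      have "cmod (f (w + ?h) - f w - gradient_app f w ?h) \<le> 8 * M / (R/2)\<^sup>2 * (norm ?h)\<^sup>2"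
        by (rule taylor_bound[OF f]) (use sub[OF w2] R M small[of n] in auto)
      also have "norm ?h = norm u / cmod (s n)"
        by (simp add: norm_smult_vec norm_divide)
      finally have "cmod (s n) * cmod (f (w + ?h) - f w - gradient_app f w ?h)
          \<le> cmod (s n) * (8 * M / (R/2)\<^sup>2 * (norm u / cmod (s n))\<^sup>2)"
        by (rule mult_left_mono) auto
      also have "\<dots> = C / cmod (s n)"
        using sn(1) by (simp add: C_def power_divide power2_eq_square)
      also have "cmod (s n) * cmod (f (w + ?h) - f w - gradient_app f w ?h) = cmod (F n w - gradient_app f w u)"
        using sn(1) by (simp add: F_def norm_mult[symmetric] gradient_app_smult algebra_simps)
      also have "C / cmod (s n) \<le> C / real (n + 1)"
        unfolding sn(2) using M by (intro divide_left_mono) (auto simp: C_def)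
      finally show ?thesis .
    qed
    show "uniform_limit (cball z (R/4)) F (\<lambda>w. gradient_app f w u) sequentially"
    proof (rule uniform_limitI)
      fix e :: real assume e: "e > 0"
      have "(\<lambda>n. C / real (n + 1)) \<longlonglongrightarrow> 0"
        using LIMSEQ_ignore_initial_segment[OF lim_const_over_n[of C], of 1] by simp
      then have "\<forall>\<^sub>F n in sequentially. C / real (n + 1) < e"
        using e order_tendstoD(2) by blast
      then show "\<forall>\<^sub>F n in sequentially. \<forall>w\<in>cball z (R/4). dist (F n w) (gradient_app f w u) < e"
      proof eventually_elim
        case (elim n)
        show ?case
        proof
          fix w assume "w \<in> cball z (R/4)"
          from bound[OF this, of n] elim show "dist (F n w) (gradient_app f w u) < e"
            unfolding dist_norm by linarith
        qed
      qed
    qed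
  qed (use R in auto)
  then show "\<exists>r>0. holo_fun (ball z r) (\<lambda>w. gradient_app f w u)"
    using R by (intro exI[of _ "R/4/2"]) auto
qed

section \<open>Riesz representation in complete Hermitian function spaces\<close>

text \<open>
  The form is only semidefinite, since functions may differ outside the domain on which they are
  integrated.
\<close>

locale hermitian_function_space =
  fixes H :: "('x \<Rightarrow> complex) set"
    and ip :: "('x \<Rightarrow> complex) \<Rightarrow> ('x \<Rightarrow> complex) \<Rightarrow> complex"
  assumes H_zero: "(\<lambda>x. 0) \<in> H"
    and H_add: "f \<in> H \<Longrightarrow> g \<in> H \<Longrightarrow> (\<lambda>x. f x + g x) \<in> H"
    and H_scale: "f \<in> H \<Longrightarrow> (\<lambda>x. c * f x) \<in> H"
    and ip_add: "f \<in> H \<Longrightarrow> g \<in> H \<Longrightarrow> h \<in> H \<Longrightarrow> ip (\<lambda>x. f x + g x) h = ip f h + ip g h"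
    and ip_scale: "f \<in> H \<Longrightarrow> h \<in> H \<Longrightarrow> ip (\<lambda>x. c * f x) h = c * ip f h"
    and ip_cnj: "f \<in> H \<Longrightarrow> g \<in> H \<Longrightarrow> ip g f = cnj (ip f g)"
    and ip_nonneg: "f \<in> H \<Longrightarrow> 0 \<le> Re (ip f f)"
begin

definition nrm :: "('x \<Rightarrow> complex) \<Rightarrow> real" where
  "nrm f = sqrt (Re (ip f f))"

lemma H_diff: "f \<in> H \<Longrightarrow> g \<in> H \<Longrightarrow> (\<lambda>x. f x - g x) \<in> H"
  using H_add[of f "\<lambda>x. -1 * g x"] H_scale[of g "-1"] by simp

lemma ip_diff: "f \<in> H \<Longrightarrow> g \<in> H \<Longrightarrow> h \<in> H \<Longrightarrow> ip (\<lambda>x. f x - g x) h = ip f h - ip g h"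
  using ip_add[of f "\<lambda>x. -1 * g x" h] H_scale[of g "-1"] ip_scale[of g h "-1"] by simp

lemma ip_add_right:
  "f \<in> H \<Longrightarrow> g \<in> H \<Longrightarrow> h \<in> H \<Longrightarrow> ip h (\<lambda>x. f x + g x) = ip h f + ip h g"
  using ip_cnj[of "\<lambda>x. f x + g x" h] ip_add[of f g h] ip_cnj[of f h] ip_cnj[of g h] H_add by simp

lemma ip_scale_right:
  "f \<in> H \<Longrightarrow> h \<in> H \<Longrightarrow> ip h (\<lambda>x. c * f x) = cnj c * ip h f"
  using ip_cnj[of "\<lambda>x. c * f x" h] ip_scale[of f h c] ip_cnj[of f h] H_scale by simp

lemma ip_diff_right:
  "f \<in> H \<Longrightarrow> g \<in> H \<Longrightarrow> h \<in> H \<Longrightarrow> ip h (\<lambda>x. f x - g x) = ip h f - ip h g"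
  using ip_cnj[of "\<lambda>x. f x - g x" h] ip_diff[of f g h] ip_cnj[of f h] ip_cnj[of g h] H_diff by simp

lemma ip_self_real: "f \<in> H \<Longrightarrow> ip f f = complex_of_real (Re (ip f f))"
  using ip_cnj[of f f] by (simp add: complex_eq_iff)

lemma nrm_nonneg [simp]: "f \<in> H \<Longrightarrow> 0 \<le> nrm f"
  by (simp add: nrm_def ip_nonneg)

lemma nrm_sq: "f \<in> H \<Longrightarrow> (nrm f)\<^sup>2 = Re (ip f f)"
  by (simp add: nrm_def ip_nonneg)

lemma ip_self: "f \<in> H \<Longrightarrow> ip f f = complex_of_real ((nrm f)\<^sup>2)"
  by (metis nrm_sq ip_self_real)

lemma ip_expand:
  assumes "f \<in> H" "g \<in> H"
  shows "Re (ip (\<lambda>x. f x - c * g x) (\<lambda>x. f x - c * g x))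
    = Re (ip f f) - 2 * Re (cnj c * ip f g) + (cmod c)\<^sup>2 * Re (ip g g)"
proof -
  have "ip (\<lambda>x. f x - c * g x) (\<lambda>x. f x - c * g x)
    = ip f f - cnj c * ip f g - c * cnj (ip f g) + c * cnj c * ip g g"
    using assms by (simp add: ip_diff ip_diff_right ip_scale ip_scale_right H_scale H_diff
        ip_cnj[of f g] algebra_simps)
  moreover have "Re (c * cnj c * ip g g) = (cmod c)\<^sup>2 * Re (ip g g)"
    by (simp add: complex_mult_cnj cmod_power2 complex_norm_square[symmetric] del: of_real_add)
  moreover have "Re (c * cnj (ip f g)) = Re (cnj c * ip f g)"
    by simp
  ultimately show ?thesis by simp
qed

lemma cauchy_schwarz:
  assumes f: "f \<in> H" and g: "g \<in> H"
  shows "cmod (ip f g) \<le> nrm f * nrm g"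
proof -
  let ?c = "ip f g" and ?a = "Re (ip f f)" and ?b = "Re (ip g g)"
  have pos: "0 \<le> ?a - 2 * Re (cnj c * ?c) + (cmod c)\<^sup>2 * ?b" for c
    using ip_nonneg[of "\<lambda>x. f x - c * g x"] ip_expand[OF f g, of c] f g H_diff H_scale by simp
  have "(cmod ?c)\<^sup>2 \<le> ?a * ?b"
  proof (cases "?b = 0")
    case False
    then have b: "?b > 0" using ip_nonneg[OF g] by simp
    define c where "c = ?c / of_real ?b"
    have "cnj c * ?c = (?c * cnj ?c) / of_real ?b"
      by (simp add: c_def)
    then have "cnj c * ?c = of_real ((cmod ?c)\<^sup>2 / ?b)"
      unfolding complex_norm_square[symmetric] by simp
    then have "Re (cnj c * ?c) = (cmod ?c)\<^sup>2 / ?b"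
      by (metis Re_complex_of_real)
    moreover have "(cmod c)\<^sup>2 * ?b = (cmod ?c)\<^sup>2 / ?b"
      using b by (simp add: c_def norm_divide power2_eq_square)
    ultimately have "(cmod ?c)\<^sup>2 / ?b \<le> ?a"
      using pos[of c] by simp
    then show ?thesis using b by (simp add: pos_divide_le_eq)
  next
    case True
    have key: "2 * t * (cmod ?c)\<^sup>2 \<le> ?a" for t :: real
    proof -
      have "cnj (of_real t * ?c) * ?c = of_real t * (?c * cnj ?c)"
        by simp
      then have "cnj (of_real t * ?c) * ?c = of_real (t * (cmod ?c)\<^sup>2)"
        unfolding complex_norm_square[symmetric] by simp
      then have "Re (cnj (of_real t * ?c) * ?c) = t * (cmod ?c)\<^sup>2"
        by (metis Re_complex_of_real)
      then show ?thesis using pos[of "of_real t * ?c"] True by simp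
    qed
    have "(cmod ?c)\<^sup>2 = 0"
    proof (rule ccontr)
      assume "(cmod ?c)\<^sup>2 \<noteq> 0"
      then show False using key[of "(?a + 1) / (cmod ?c)\<^sup>2"] ip_nonneg[OF f] by simp
    qed
    then show ?thesis using True by simp
  qed
  then have "(cmod ?c)\<^sup>2 \<le> (nrm f * nrm g)\<^sup>2"
    using f g by (simp add: power_mult_distrib nrm_sq)
  then show ?thesis
    by (rule power2_le_imp_le) (use f g in simp)
qed

lemma nrm_scale: "f \<in> H \<Longrightarrow> nrm (\<lambda>x. c * f x) = cmod c * nrm f"
proof -
  assume f: "f \<in> H"
  have "ip (\<lambda>x. c * f x) (\<lambda>x. c * f x) = of_real ((cmod c)\<^sup>2) * ip f f"
    unfolding complex_norm_square using f by (simp add: ip_scale ip_scale_right H_scale)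
  then have "Re (ip (\<lambda>x. c * f x) (\<lambda>x. c * f x)) = (cmod c)\<^sup>2 * Re (ip f f)"
    by (simp del: of_real_power)
  then show ?thesis
    by (simp add: nrm_def real_sqrt_mult)
qed

lemma nrm_triangle:
  assumes f: "f \<in> H" and g: "g \<in> H"
  shows "nrm (\<lambda>x. f x + g x) \<le> nrm f + nrm g"
proof -
  have "(nrm (\<lambda>x. f x + g x))\<^sup>2 = (nrm f)\<^sup>2 + 2 * Re (ip f g) + (nrm g)\<^sup>2"
    using f g by (simp add: nrm_sq H_add ip_add ip_add_right ip_cnj[of f g])
  also have "\<dots> \<le> (nrm f)\<^sup>2 + 2 * (nrm f * nrm g) + (nrm g)\<^sup>2"
    using cauchy_schwarz[OF f g] complex_Re_le_cmod[of "ip f g"] by simp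
  also have "\<dots> = (nrm f + nrm g)\<^sup>2"
    by (simp add: power2_sum)
  finally show ?thesis
    by (rule power2_le_imp_le) (use f g in simp)
qed

text \<open>
  Test the functional represented by \<open>g\<close> on \<open>g\<close> itself.
\<close>

lemma nrm_le_of_functional:
  assumes g: "g \<in> H" and "0 \<le> C" and "\<And>f. f \<in> H \<Longrightarrow> cmod (ip f g) \<le> C * nrm f"
  shows "nrm g \<le> C"
proof -
  have "nrm g * nrm g \<le> C * nrm g"
    using assms(3)[OF g] ip_self[OF g] by (simp add: power2_eq_square norm_mult)
  then show ?thesis
    using assms(2) nrm_nonneg[OF g] by (cases "nrm g = 0") auto
qed

text \<open>
  A representer depends antiholomorphically on its base point, so its first order term carries \<open>cnj t\<close>;
  through the second, conjugate linear, slot of the product it contributes a term in \<open>t\<close>. This is where the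
  two Wirtinger derivatives separate.
\<close>

lemma ip_has_derivative:
  assumes "\<delta> > 0"
    and a: "\<And>t. cmod t < \<delta> \<Longrightarrow> a t \<in> H" "a1 \<in> H"
      "\<And>t. cmod t < \<delta> \<Longrightarrow> nrm (\<lambda>x. a t x - a 0 x - cnj t * a1 x) \<le> C * (cmod t)\<^sup>2"
    and b: "\<And>t. cmod t < \<delta> \<Longrightarrow> b t \<in> H" "b1 \<in> H"
      "\<And>t. cmod t < \<delta> \<Longrightarrow> nrm (\<lambda>x. b t x - b 0 x - cnj t * b1 x) \<le> C * (cmod t)\<^sup>2"
  shows "((\<lambda>t. ip (a t) (b t)) has_derivative (\<lambda>t. cnj t * ip a1 (b 0) + t * ip (a 0) b1)) (at 0)"
proof -
  have 0: "a 0 \<in> H" "b 0 \<in> H" using assms by auto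
  define M where "M = C * (nrm (b 0) + nrm b1 + C) + (nrm (a 0) + nrm a1) * C + cmod (ip a1 b1)"
  have bound: "cmod (ip (a t) (b t) - ip (a 0) (b 0) - (cnj t * ip a1 (b 0) + t * ip (a 0) b1)) \<le> M * (cmod t)\<^sup>2"
    if t: "cmod t < \<delta>" "cmod t \<le> 1" for t
  proof -
    define A where "A = (\<lambda>x. a 0 x + cnj t * a1 x)"
    define B where "B = (\<lambda>x. b 0 x + cnj t * b1 x)"
    define ra where "ra = (\<lambda>x. a t x - a 0 x - cnj t * a1 x)"
    define rb where "rb = (\<lambda>x. b t x - b 0 x - cnj t * b1 x)"
    have inH: "A \<in> H" "B \<in> H" "ra \<in> H" "rb \<in> H" "a t \<in> H" "b t \<in> H"
      unfolding A_def B_def ra_def rb_def using 0 a b t by (auto intro!: H_add H_diff H_scale)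
    have at: "a t = (\<lambda>x. A x + ra x)" and bt: "b t = (\<lambda>x. B x + rb x)"
      by (auto simp: A_def B_def ra_def rb_def)
    have t2: "(cmod t)\<^sup>2 \<le> 1" using t by (simp add: power_le_one)
    have ra: "nrm ra \<le> C * (cmod t)\<^sup>2" and rb: "nrm rb \<le> C * (cmod t)\<^sup>2"
      unfolding ra_def rb_def using a b t by auto
    have C: "C * (cmod t)\<^sup>2 \<ge> 0"
      using ra nrm_nonneg[OF inH(3)] by linarith
    have nA: "nrm A \<le> nrm (a 0) + nrm a1"
    proof -
      have "nrm A \<le> nrm (a 0) + cmod t * nrm a1"
        using nrm_triangle[OF 0(1) H_scale[OF a(2), of "cnj t"]] nrm_scale[OF a(2), of "cnj t"] unfolding A_def by simp
      moreover have "cmod t * nrm a1 \<le> 1 * nrm a1"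
        by (rule mult_right_mono) (use t a in auto)
      ultimately show ?thesis by simp
    qed
    have nB: "nrm B \<le> nrm (b 0) + nrm b1"
    proof -
      have "nrm B \<le> nrm (b 0) + cmod t * nrm b1"
        using nrm_triangle[OF 0(2) H_scale[OF b(2), of "cnj t"]] nrm_scale[OF b(2), of "cnj t"] unfolding B_def by simp
      moreover have "cmod t * nrm b1 \<le> 1 * nrm b1"
        by (rule mult_right_mono) (use t b in auto)
      ultimately show ?thesis by simp
    qed
    have nb: "nrm (b t) \<le> nrm (b 0) + nrm b1 + \<bar>C\<bar>"
    proof -
      have "nrm (b t) \<le> nrm B + nrm rb" unfolding bt by (rule nrm_triangle[OF inH(2,4)])
      moreover have "C * (cmod t)\<^sup>2 \<le> \<bar>C\<bar> * 1"
        using t2 by (intro mult_mono) auto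
      ultimately show ?thesis using nB rb by linarith
    qed
    have AB: "ip A B = ip (a 0) (b 0) + (cnj t * ip a1 (b 0) + t * ip (a 0) b1) + cnj t * t * ip a1 b1"
      unfolding A_def B_def using 0 a b
      by (simp add: ip_add ip_add_right ip_scale ip_scale_right H_add H_scale algebra_simps)
    have "ip (a t) (b t) = ip A (b t) + ip ra (b t)"
      by (subst at) (rule ip_add[OF inH(1,3,6)])
    also have "ip A (b t) = ip A B + ip A rb"
      by (subst bt) (rule ip_add_right[OF inH(2,4,1)])
    finally have "ip (a t) (b t) - ip (a 0) (b 0) - (cnj t * ip a1 (b 0) + t * ip (a 0) b1)
       = ip ra (b t) + ip A rb + cnj t * t * ip a1 b1"
      by (simp add: AB)
    also have "cmod \<dots> \<le> cmod (ip ra (b t)) + cmod (ip A rb) + cmod (cnj t * t * ip a1 b1)"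
      by (rule norm_triangle_le) (simp add: norm_triangle_ineq)
    also have "\<dots> \<le> C * (cmod t)\<^sup>2 * (nrm (b 0) + nrm b1 + C) + (nrm (a 0) + nrm a1) * (C * (cmod t)\<^sup>2)
        + (cmod t)\<^sup>2 * cmod (ip a1 b1)"
    proof (intro add_mono)
      show "cmod (ip ra (b t)) \<le> C * (cmod t)\<^sup>2 * (nrm (b 0) + nrm b1 + C)"
      proof (cases "t = 0")
        case True
        then have "nrm ra \<le> 0" using ra by simp
        then have "nrm ra = 0" using nrm_nonneg[OF inH(3)] by linarith
        then show ?thesis using cauchy_schwarz[OF inH(3,6)] True by simp
      next
        case False
        then have "C \<ge> 0" using C by (simp add: zero_le_mult_iff)
        have "cmod (ip ra (b t)) \<le> nrm ra * nrm (b t)" by (rule cauchy_schwarz[OF inH(3,6)])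
        also have "\<dots> \<le> C * (cmod t)\<^sup>2 * (nrm (b 0) + nrm b1 + C)"
          by (rule mult_mono) (use ra nb inH \<open>C \<ge> 0\<close> in auto)
        finally show ?thesis .
      qed
      have "cmod (ip A rb) \<le> nrm A * nrm rb" by (rule cauchy_schwarz[OF inH(1,4)])
      also have "\<dots> \<le> (nrm (a 0) + nrm a1) * (C * (cmod t)\<^sup>2)"
        by (rule mult_mono) (use nA rb inH 0 a in auto)
      finally show "cmod (ip A rb) \<le> (nrm (a 0) + nrm a1) * (C * (cmod t)\<^sup>2)" .
      show "cmod (cnj t * t * ip a1 b1) \<le> (cmod t)\<^sup>2 * cmod (ip a1 b1)"
        by (simp add: norm_mult power2_eq_square)
    qed
    also have "\<dots> = M * (cmod t)\<^sup>2"
      by (simp add: M_def algebra_simps)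
    finally show ?thesis .
  qed
  show ?thesis
    unfolding has_derivative_at_alt
  proof (intro conjI allI impI)
    show "bounded_linear (\<lambda>t. cnj t * ip a1 (b 0) + t * ip (a 0) b1)"
      by (intro bounded_linear_add bounded_linear_mult_const bounded_linear_cnj bounded_linear_ident)
    fix e :: real assume e: "e > 0"
    define d where "d = min (min \<delta> 1) (e / (\<bar>M\<bar> + 1))"
    have "d > 0" using e \<open>\<delta> > 0\<close> by (simp add: d_def)
    moreover have "cmod (ip (a y) (b y) - ip (a 0) (b 0) - (cnj (y - 0) * ip a1 (b 0) + (y - 0) * ip (a 0) b1)) \<le> e * cmod (y - 0)"
      if y: "cmod (y - 0) < d" for y
    proof -
      have "cmod (ip (a y) (b y) - ip (a 0) (b 0) - (cnj y * ip a1 (b 0) + y * ip (a 0) b1)) \<le> M * (cmod y)\<^sup>2"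
        by (rule bound) (use y in \<open>auto simp: d_def\<close>)
      also have "\<dots> \<le> (\<bar>M\<bar> + 1) * (cmod y)\<^sup>2"
        by (rule mult_right_mono) auto
      also have "\<dots> = ((\<bar>M\<bar> + 1) * cmod y) * cmod y"
        by (simp add: power2_eq_square)
      also have "\<dots> \<le> e * cmod y"
      proof (rule mult_right_mono)
        have "cmod y \<le> e / (\<bar>M\<bar> + 1)" using y by (simp add: d_def)
        then show "(\<bar>M\<bar> + 1) * cmod y \<le> e" by (simp add: pos_le_divide_eq mult.commute)
      qed simp
      finally show ?thesis by simp
    qed
    ultimately show "\<exists>d>0. \<forall>y. cmod (y - 0) < d \<longrightarrow>
      cmod (ip (a y) (b y) - ip (a 0) (b 0) - (cnj (y - 0) * ip a1 (b 0) + (y - 0) * ip (a 0) b1)) \<le> e * cmod (y - 0)"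
      by blast
  qed
qed

text \<open>
  The element of least norm on the affine hyperplane \<open>l f = 1\<close> exists by the parallelogram law and
  completeness. It is orthogonal to the kernel of \<open>l\<close>, so a multiple of it represents \<open>l\<close>.
\<close>

theorem riesz:
  fixes l :: "('x \<Rightarrow> complex) \<Rightarrow> complex"
  assumes complete: "\<And>f. (\<And>n. f n \<in> H) \<Longrightarrow>
      (\<And>e. e > 0 \<Longrightarrow> \<exists>N. \<forall>m\<ge>N. \<forall>n\<ge>N. nrm (\<lambda>x. f m x - f n x) < e) \<Longrightarrow>
      \<exists>g\<in>H. (\<lambda>n::nat. nrm (\<lambda>x. f n x - g x)) \<longlonglongrightarrow> 0"
    and add: "\<And>f g. f \<in> H \<Longrightarrow> g \<in> H \<Longrightarrow> l (\<lambda>x. f x + g x) = l f + l g"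
    and scale: "\<And>f c. f \<in> H \<Longrightarrow> l (\<lambda>x. c * f x) = c * l f"
    and bounded: "\<And>f. f \<in> H \<Longrightarrow> cmod (l f) \<le> C * nrm f"
  shows "\<exists>g\<in>H. \<forall>f\<in>H. l f = ip f g"
proof (cases "\<forall>f\<in>H. l f = 0")
  case True
  have "ip f (\<lambda>x. 0) = 0" if "f \<in> H" for f
    using ip_scale_right[OF H_zero that, of 0] by simp
  with True show ?thesis using H_zero by (intro bexI[of _ "\<lambda>x. 0"]) auto
next
  case False
  have diff: "l (\<lambda>x. f x - g x) = l f - l g" if "f \<in> H" "g \<in> H" for f g
    using add[OF that(1) H_scale[OF that(2), of "-1"]] scale[OF that(2), of "-1"] by simp
  define S where "S = {f \<in> H. l f = 1}"
  obtain f1 where f1: "f1 \<in> H" "l f1 \<noteq> 0" using False by blast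
  then have S: "(\<lambda>x. (1 / l f1) * f1 x) \<in> S"
    unfolding S_def using scale[OF f1(1), of "1 / l f1"] H_scale[OF f1(1), of "1 / l f1"] by simp
  define d where "d = (INF f\<in>S. (nrm f)\<^sup>2)"
  have bdd: "bdd_below ((\<lambda>f. (nrm f)\<^sup>2) ` S)"
    by (rule bdd_belowI[of _ 0]) auto
  have dle: "d \<le> (nrm f)\<^sup>2" if "f \<in> S" for f
    unfolding d_def by (rule cINF_lower[OF bdd that])
  have "\<exists>f\<in>S. (nrm f)\<^sup>2 < d + 1 / real (Suc n)" for n
  proof -
    have "d < d + 1 / real (Suc n)" by simp
    then show ?thesis
      using S bdd unfolding d_def by (subst (asm) cINF_less_iff) auto
  qed
  then obtain F where F: "\<And>n. F n \<in> S" "\<And>n. (nrm (F n))\<^sup>2 < d + 1 / real (Suc n)"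
    by metis
  have FH: "F n \<in> H" "l (F n) = 1" for n using F(1)[of n] by (auto simp: S_def)
  have par: "(nrm (\<lambda>x. F m x - F n x))\<^sup>2 \<le> 2 / real (Suc m) + 2 / real (Suc n)" for m n
  proof -
    have mid: "(\<lambda>x. (1/2) * (F m x + F n x)) \<in> S"
    proof -
      have "(\<lambda>x. (1/2) * (F m x + F n x)) \<in> H"
        by (intro H_scale H_add FH)
      moreover have "l (\<lambda>x. (1/2) * (F m x + F n x)) = 1"
        by (subst scale) (auto simp: FH H_add add)
      ultimately show ?thesis unfolding S_def by blast
    qed
    have "d \<le> (nrm (\<lambda>x. (1/2) * (F m x + F n x)))\<^sup>2" by (rule dle[OF mid])
    also have "\<dots> = (nrm (\<lambda>x. F m x + F n x))\<^sup>2 / 4"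
      by (subst nrm_scale) (simp_all add: FH H_add power_mult_distrib power2_eq_square)
    finally have 1: "4 * d \<le> (nrm (\<lambda>x. F m x + F n x))\<^sup>2" by simp
    have "(nrm (\<lambda>x. F m x - F n x))\<^sup>2 + (nrm (\<lambda>x. F m x + F n x))\<^sup>2 = 2 * (nrm (F m))\<^sup>2 + 2 * (nrm (F n))\<^sup>2"
      using FH by (simp add: nrm_sq H_diff H_add ip_diff ip_diff_right ip_add ip_add_right)
    with 1 F(2)[of m] F(2)[of n] show ?thesis by simp
  qed
  have "\<exists>g\<in>H. (\<lambda>n::nat. nrm (\<lambda>x. F n x - g x)) \<longlonglongrightarrow> 0"
  proof (rule complete[OF FH(1)])
    fix e :: real assume e: "e > 0"
    obtain N where N: "4 / e\<^sup>2 < real N" using reals_Archimedean2 by blast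
    have "nrm (\<lambda>x. F m x - F n x) < e" if mn: "m \<ge> N" "n \<ge> N" for m n
    proof -
      have e2: "4 < real N * e\<^sup>2" using N e by (simp add: pos_divide_less_eq)
      have "0 < 4 / e\<^sup>2" using e by simp
      with N have N0: "real N > 0" by linarith
      have "2 / real (Suc k) \<le> 2 / real N" if "k \<ge> N" for k
        using that N0 by (intro divide_left_mono) auto
      from par[of m n] this[OF mn(1)] this[OF mn(2)]
      have "(nrm (\<lambda>x. F m x - F n x))\<^sup>2 \<le> 4 / real N" by simp
      also have "\<dots> < e\<^sup>2" using e2 N0 by (simp add: pos_divide_less_eq mult.commute)
      finally show ?thesis
        by (rule power2_less_imp_less) (use e in simp)
    qed
    then show "\<exists>N. \<forall>m\<ge>N. \<forall>n\<ge>N. nrm (\<lambda>x. F m x - F n x) < e" by blast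
  qed
  then obtain g where g: "g \<in> H" "(\<lambda>n. nrm (\<lambda>x. F n x - g x)) \<longlonglongrightarrow> 0" by blast
  have lg: "l g = 1"
  proof -
    have lim: "(\<lambda>n. C * nrm (\<lambda>x. F n x - g x)) \<longlonglongrightarrow> 0"
      using tendsto_mult_left[OF g(2), of C] by simp
    moreover have "cmod (1 - l g) \<le> C * nrm (\<lambda>x. F n x - g x)" for n
      using bounded[OF H_diff[OF FH(1) g(1)], of n] diff[OF FH(1) g(1), of n] FH(2) by simp
    ultimately have "cmod (1 - l g) \<le> 0"
      by (intro LIMSEQ_le_const[OF lim]) blast
    then show ?thesis by simp
  qed
  have gd: "(nrm g)\<^sup>2 \<le> d"
  proof -
    have lim: "(\<lambda>n. (sqrt (d + 1 / real (Suc n)) + nrm (\<lambda>x. F n x - g x))\<^sup>2) \<longlonglongrightarrow> (sqrt (d + 0) + 0)\<^sup>2"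
      by (intro tendsto_intros g(2) LIMSEQ_Suc[OF lim_1_over_n])
    moreover have "(nrm g)\<^sup>2 \<le> (sqrt (d + 1 / real (Suc n)) + nrm (\<lambda>x. F n x - g x))\<^sup>2" for n
    proof (rule power_mono)
      have dH: "(\<lambda>x. F n x - g x) \<in> H" by (rule H_diff[OF FH(1) g(1)])
      have "(\<lambda>x. F n x + -1 * (F n x - g x)) = g" by auto
      then have "nrm g \<le> nrm (F n) + nrm (\<lambda>x. -1 * (F n x - g x))"
        using nrm_triangle[OF FH(1)[of n] H_scale[OF dH, of "-1"]] by (simp only:)
      also have "nrm (\<lambda>x. -1 * (F n x - g x)) = nrm (\<lambda>x. F n x - g x)"
        using nrm_scale[OF dH, of "-1"] by simp
      also have "nrm (F n) \<le> sqrt (d + 1 / real (Suc n))"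
        using F(2)[of n] by (intro real_le_rsqrt) simp
      finally show "nrm g \<le> sqrt (d + 1 / real (Suc n)) + nrm (\<lambda>x. F n x - g x)" by simp
    qed (use g in auto)
    ultimately have "(nrm g)\<^sup>2 \<le> (sqrt (d + 0) + 0)\<^sup>2"
      by (intro LIMSEQ_le_const[OF lim]) blast
    moreover have "d \<ge> 0"
      unfolding d_def using S by (intro cINF_greatest) auto
    ultimately show ?thesis by simp
  qed
  have orth: "ip g h = 0" if h: "h \<in> H" "l h = 0" for h
  proof -
    have pos: "0 \<le> - 2 * Re (cnj c * ip g h) + (cmod c)\<^sup>2 * Re (ip h h)" for c
    proof -
      have "(\<lambda>x. g x - c * h x) \<in> S"
        unfolding S_def using g h lg diff[OF g(1) H_scale[OF h(1)], of c] scale[OF h(1), of c]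
        by (auto intro: H_diff H_scale)
      from dle[OF this] gd have "(nrm g)\<^sup>2 \<le> (nrm (\<lambda>x. g x - c * h x))\<^sup>2" by simp
      then show ?thesis
        using ip_expand[OF g(1) h(1), of c] g h by (simp add: nrm_sq H_diff H_scale)
    qed
    \<comment> \<open>adding \<open>1\<close> avoids a case distinction for \<open>h\<close> of norm zero\<close>
    define b where "b = Re (ip h h) + 1"
    have b: "b > 0" "Re (ip h h) < b" using ip_nonneg[OF h(1)] by (auto simp: b_def)
    define c where "c = ip g h / of_real b"
    have "cnj c * ip g h = (ip g h * cnj (ip g h)) / of_real b"
      by (simp add: c_def)
    then have "cnj c * ip g h = of_real ((cmod (ip g h))\<^sup>2 / b)"
      unfolding complex_norm_square[symmetric] by simp
    then have "Re (cnj c * ip g h) = (cmod (ip g h))\<^sup>2 / b"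
      by (metis Re_complex_of_real)
    moreover have "(cmod c)\<^sup>2 * Re (ip h h) \<le> (cmod c)\<^sup>2 * b"
      using b by (intro mult_left_mono) auto
    moreover have "(cmod c)\<^sup>2 * b = (cmod (ip g h))\<^sup>2 / b"
      using b by (simp add: c_def norm_divide power2_eq_square)
    ultimately have "(cmod (ip g h))\<^sup>2 / b \<le> 0"
      using pos[of c] by simp
    then show ?thesis using b by (simp add: divide_le_0_iff)
  qed
  have nz: "nrm g \<noteq> 0"
    using bounded[OF g(1)] lg by auto
  define k where "k = (\<lambda>x. (1 / complex_of_real ((nrm g)\<^sup>2)) * g x)"
  have kH: "k \<in> H" unfolding k_def by (rule H_scale[OF g(1)])
  have "l f = ip f k" if f: "f \<in> H" for f
  proof -
    have h: "(\<lambda>x. f x - l f * g x) \<in> H" using f g by (auto intro: H_diff H_scale)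
    have "l (\<lambda>x. f x - l f * g x) = 0"
      using diff[OF f H_scale[OF g(1)]] scale[OF g(1)] lg by simp
    from orth[OF h this] have "ip (\<lambda>x. f x - l f * g x) g = 0"
      using ip_cnj[OF g(1) h] by simp
    then have "ip f g = l f * complex_of_real ((nrm g)\<^sup>2)"
      using f g by (simp add: ip_diff ip_scale H_scale ip_self)
    then show ?thesis
      unfolding k_def by (subst ip_scale_right[OF g(1) f]) (use nz in simp)
  qed
  with kH show ?thesis by blast
qed

text \<open>
  The squared distance of \<open>p\<close> from the line spanned by \<open>k\<close>.
\<close>

definition residual_energy :: "('x \<Rightarrow> complex) \<Rightarrow> ('x \<Rightarrow> complex) \<Rightarrow> real" where
  "residual_energy p k = Re (ip p p) - (cmod (ip p k))\<^sup>2 / Re (ip k k)"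

text \<open>
  The extremal element is the component \<open>q\<close> of \<open>p\<close> orthogonal to \<open>k\<close>: on the orthogonal complement of
  \<open>k\<close> the functionals represented by \<open>p\<close> and by \<open>q\<close> coincide.
\<close>

lemma residual_energy_extremal:
  assumes p: "p \<in> H" and k: "k \<in> H" and nz: "nrm k \<noteq> 0"
  shows "\<And>f. f \<in> H \<Longrightarrow> ip f k = 0 \<Longrightarrow> (cmod (ip f p))\<^sup>2 \<le> residual_energy p k * (nrm f)\<^sup>2"
    and "\<exists>q\<in>H. ip q k = 0 \<and> ip q p = of_real (residual_energy p k) \<and> (nrm q)\<^sup>2 = residual_energy p k"
proof -
  define c where "c = ip p k / ip k k"
  define q where "q = (\<lambda>x. p x - c * k x)"
  have kk: "ip k k \<noteq> 0" using nz by (simp add: ip_self[OF k])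
  have q: "q \<in> H" unfolding q_def using p k by (auto intro: H_diff H_scale)
  have qk: "ip q k = 0"
  proof -
    have "ip q k = ip p k - c * ip k k"
      unfolding q_def using p k by (simp add: ip_diff ip_scale H_scale)
    then show ?thesis using kk by (simp add: c_def)
  qed
  have fq: "ip f q = ip f p" if "f \<in> H" "ip f k = 0" for f
    unfolding q_def using p k that by (simp add: ip_diff_right ip_scale_right H_scale)
  have qp: "ip q p = of_real (residual_energy p k)"
  proof -
    have "ip q p = ip p p - c * ip k p"
      unfolding q_def using p k by (simp add: ip_diff ip_scale H_scale)
    also have "\<dots> = ip p p - ip p k / ip k k * ip k p"
      by (simp add: c_def)
    also have "ip k p = cnj (ip p k)" by (rule ip_cnj[OF p k])
    also have "ip p p - ip p k / ip k k * cnj (ip p k) = of_real (residual_energy p k)"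
      unfolding residual_energy_def of_real_diff of_real_divide complex_norm_square
        ip_self_real[OF p, symmetric] ip_self_real[OF k, symmetric] by simp
    finally show ?thesis .
  qed
  have nq: "(nrm q)\<^sup>2 = residual_energy p k"
    using fq[OF q qk] qp by (simp add: nrm_sq[OF q])
  show "\<exists>q\<in>H. ip q k = 0 \<and> ip q p = of_real (residual_energy p k) \<and> (nrm q)\<^sup>2 = residual_energy p k"
    using q qk qp nq by blast
  fix f assume f: "f \<in> H" "ip f k = 0"
  have "(cmod (ip f p))\<^sup>2 \<le> (nrm f * nrm q)\<^sup>2"
    using cauchy_schwarz[OF f(1) q] by (intro power_mono) (simp_all add: fq[OF f])
  then show "(cmod (ip f p))\<^sup>2 \<le> residual_energy p k * (nrm f)\<^sup>2"
    by (simp add: power_mult_distrib nq mult.commute)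
qed

end

section \<open>The Bergman space as a Hilbert space\<close>

definition bergman_ip :: "(complex ^ 'n::finite) set \<Rightarrow> (complex ^ 'n \<Rightarrow> complex) \<Rightarrow> (complex ^ 'n \<Rightarrow> complex) \<Rightarrow> complex" where
  "bergman_ip D f g = (LINT x:D|lborel. f x * cnj (g x))"

lemma measurable_on_open:
  fixes f :: "complex ^ 'n::finite \<Rightarrow> 'b::{real_normed_vector,second_countable_topology}"
  assumes "open D" "continuous_on D f"
  shows "(\<lambda>x. indicator D x *\<^sub>R f x) \<in> borel_measurable lborel"
proof -
  have "(\<lambda>x. indicator D x *\<^sub>R f x) \<in> borel_measurable borel"
    by (rule borel_measurable_continuous_on_indicator) (use assms in auto)
  then show ?thesis by simp
qed

lemma bergman_spaceD:
  assumes "f \<in> bergman_space D"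
  shows "holo_fun D f" "set_integrable lborel D (\<lambda>z. (cmod (f z))\<^sup>2)"
  using assms by (auto simp: bergman_space_def)

lemma bergman_product_integrable:
  assumes D: "open D" and f: "f \<in> bergman_space D" and g: "g \<in> bergman_space D"
  shows "set_integrable lborel D (\<lambda>x. f x * cnj (g x))"
  unfolding set_integrable_def
proof (rule Bochner_Integration.integrable_bound)
  show "integrable lborel (\<lambda>x. indicator D x *\<^sub>R (cmod (f x))\<^sup>2 + indicator D x *\<^sub>R (cmod (g x))\<^sup>2)"
    using bergman_spaceD(2)[OF f] bergman_spaceD(2)[OF g] unfolding set_integrable_def by auto
  show "(\<lambda>x. indicator D x *\<^sub>R (f x * cnj (g x))) \<in> borel_measurable lborel"
    by (intro measurable_on_open D continuous_intros holo_fun_continuous_on bergman_spaceD(1) f g)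
  have "cmod a * cmod b \<le> (cmod a)\<^sup>2 + (cmod b)\<^sup>2" for a b
  proof -
    have "0 \<le> cmod a * cmod b" by simp
    then show ?thesis using sum_squares_bound[of "cmod a" "cmod b"] by linarith
  qed
  then show "AE x in lborel. norm (indicator D x *\<^sub>R (f x * cnj (g x)))
      \<le> norm (indicator D x *\<^sub>R (cmod (f x))\<^sup>2 + indicator D x *\<^sub>R (cmod (g x))\<^sup>2)"
    by (intro AE_I2) (auto simp: indicator_def norm_mult)
qed

lemma bergman_ip_self:
  "bergman_ip D f f = of_real (LINT x:D|lborel. (cmod (f x))\<^sup>2)"
  unfolding bergman_ip_def complex_norm_square[symmetric] by (rule set_integral_complex_of_real)

lemma bergman_add:
  assumes D: "open D" and f: "f \<in> bergman_space D" and g: "g \<in> bergman_space D"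
  shows "(\<lambda>x. f x + g x) \<in> bergman_space D"
  unfolding bergman_space_def mem_Collect_eq
proof
  show h: "holo_fun D (\<lambda>x. f x + g x)"
    using f g by (auto intro: holo_fun_add bergman_spaceD)
  show "set_integrable lborel D (\<lambda>z. (cmod (f z + g z))\<^sup>2)"
    unfolding set_integrable_def
  proof (rule Bochner_Integration.integrable_bound)
    show "integrable lborel (\<lambda>x. 2 *\<^sub>R (indicator D x *\<^sub>R (cmod (f x))\<^sup>2) + 2 *\<^sub>R (indicator D x *\<^sub>R (cmod (g x))\<^sup>2))"
      using bergman_spaceD(2)[OF f] bergman_spaceD(2)[OF g] unfolding set_integrable_def by auto
    show "(\<lambda>x. indicator D x *\<^sub>R (cmod (f x + g x))\<^sup>2) \<in> borel_measurable lborel"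
      by (intro measurable_on_open D continuous_intros holo_fun_continuous_on bergman_spaceD(1) f g)
    have "(cmod (a + b))\<^sup>2 \<le> 2 * (cmod a)\<^sup>2 + 2 * (cmod b)\<^sup>2" for a b
    proof -
      have "(cmod (a + b))\<^sup>2 \<le> (cmod a + cmod b)\<^sup>2"
        by (intro power_mono norm_triangle_ineq) auto
      also have "\<dots> \<le> 2 * (cmod a)\<^sup>2 + 2 * (cmod b)\<^sup>2"
        using sum_squares_bound[of "cmod a" "cmod b"] by (simp add: power2_sum)
      finally show ?thesis .
    qed
    then show "AE x in lborel. norm (indicator D x *\<^sub>R (cmod (f x + g x))\<^sup>2)
      \<le> norm (2 *\<^sub>R (indicator D x *\<^sub>R (cmod (f x))\<^sup>2) + 2 *\<^sub>R (indicator D x *\<^sub>R (cmod (g x))\<^sup>2))"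
      by (intro AE_I2) (auto simp: indicator_def)
  qed
qed

lemma bergman_scale:
  assumes f: "f \<in> bergman_space D"
  shows "(\<lambda>x. c * f x) \<in> bergman_space D"
  using f unfolding bergman_space_def mem_Collect_eq norm_mult power_mult_distrib
  by (auto intro: holo_fun_cmult)

theorem bergman_space_hermitian:
  assumes D: "open D"
  shows "hermitian_function_space (bergman_space D) (bergman_ip D)"
proof
  show "(\<lambda>x. 0) \<in> bergman_space D"
    by (simp add: bergman_space_def set_integrable_def)
next
  fix f g assume "f \<in> bergman_space D" "g \<in> bergman_space D"
  then show "(\<lambda>x. f x + g x) \<in> bergman_space D" by (rule bergman_add[OF D])
next
  fix f c assume "f \<in> bergman_space D"
  then show "(\<lambda>x. c * f x) \<in> bergman_space D" by (rule bergman_scale)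
next
  fix f g h assume fgh: "f \<in> bergman_space D" "g \<in> bergman_space D" "h \<in> bergman_space D"
  show "bergman_ip D (\<lambda>x. f x + g x) h = bergman_ip D f h + bergman_ip D g h"
    unfolding bergman_ip_def distrib_right
    by (rule set_integral_add) (intro bergman_product_integrable D fgh)+
next
  fix f h c assume fh: "f \<in> bergman_space D" "h \<in> bergman_space D"
  show "bergman_ip D (\<lambda>x. c * f x) h = c * bergman_ip D f h"
    unfolding bergman_ip_def mult.assoc by simp
next
  fix f g assume "f \<in> bergman_space D" "g \<in> bergman_space D"
  show "bergman_ip D g f = cnj (bergman_ip D f g)"
  proof -
    have "bergman_ip D g f = (LINT x|lborel. cnj (indicator D x *\<^sub>R (f x * cnj (g x))))"
      unfolding bergman_ip_def set_lebesgue_integral_def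
      by (rule Bochner_Integration.integral_cong) (auto simp: mult.commute)
    then show ?thesis
      unfolding bergman_ip_def set_lebesgue_integral_def by (simp only: Bochner_Integration.integral_cnj)
  qed
next
  fix f assume "f \<in> bergman_space D"
  show "0 \<le> Re (bergman_ip D f f)"
    unfolding bergman_ip_self Re_complex_of_real set_lebesgue_integral_def
    by (rule integral_nonneg_AE) auto
qed

definition bergman_norm :: "(complex ^ 'n::finite) set \<Rightarrow> (complex ^ 'n \<Rightarrow> complex) \<Rightarrow> real" where
  "bergman_norm D f = sqrt (LINT x:D|lborel. (cmod (f x))\<^sup>2)"

lemma bergman_nrm:
  assumes "open D"
  shows "hermitian_function_space.nrm (bergman_ip D) = bergman_norm D"
  by (rule ext) (simp add: hermitian_function_space.nrm_def[OF bergman_space_hermitian[OF assms]]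
      bergman_norm_def bergman_ip_self)

lemma bergman_norm_nn_integral:
  assumes f: "f \<in> bergman_space D"
  shows "(\<integral>\<^sup>+x. indicator D x * ennreal ((cmod (f x))\<^sup>2) \<partial>lborel) = ennreal ((bergman_norm D f)\<^sup>2)"
proof -
  have "0 \<le> (LINT x:D|lborel. (cmod (f x))\<^sup>2)"
    unfolding set_lebesgue_integral_def by (rule integral_nonneg_AE) auto
  then have eq: "(bergman_norm D f)\<^sup>2 = (LINT x:D|lborel. (cmod (f x))\<^sup>2)"
    by (simp add: bergman_norm_def)
  have "(\<integral>\<^sup>+x. indicator D x * ennreal ((cmod (f x))\<^sup>2) \<partial>lborel)
      = (\<integral>\<^sup>+x. ennreal (indicator D x *\<^sub>R (cmod (f x))\<^sup>2) \<partial>lborel)"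
    by (rule nn_integral_cong) (auto simp: indicator_def)
  also have "\<dots> = ennreal (LINT x:D|lborel. (cmod (f x))\<^sup>2)"
    unfolding set_lebesgue_integral_def
    by (rule nn_integral_eq_integral)
      (use bergman_spaceD(2)[OF f] in \<open>auto simp: set_integrable_def\<close>)
  finally show ?thesis by (simp add: eq)
qed

lemma bergman_space_nn_integralI:
  assumes D: "open D" and f: "holo_fun D f" and "e \<ge> 0"
    and le: "(\<integral>\<^sup>+x. indicator D x * ennreal ((cmod (f x))\<^sup>2) \<partial>lborel) \<le> ennreal (e\<^sup>2)"
  shows "f \<in> bergman_space D" "bergman_norm D f \<le> e"
proof -
  have "(\<integral>\<^sup>+x. ennreal (norm (indicator D x *\<^sub>R (cmod (f x))\<^sup>2)) \<partial>lborel)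
      = (\<integral>\<^sup>+x. indicator D x * ennreal ((cmod (f x))\<^sup>2) \<partial>lborel)"
    by (rule nn_integral_cong) (auto simp: indicator_def)
  also have "\<dots> < \<infinity>"
    using le le_less_trans by fastforce
  finally have "set_integrable lborel D (\<lambda>z. (cmod (f z))\<^sup>2)"
    unfolding set_integrable_def
    by (intro integrableI_bounded measurable_on_open D continuous_intros holo_fun_continuous_on f)
  with f show *: "f \<in> bergman_space D" by (simp add: bergman_space_def)
  then have "(bergman_norm D f)\<^sup>2 \<le> e\<^sup>2"
    using le unfolding bergman_norm_nn_integral[OF *] by (simp add: ennreal_le_iff)
  then show "bergman_norm D f \<le> e"
    using \<open>e \<ge> 0\<close> by (rule power2_le_imp_le)
qed

text \<open>
  Cauchy's formula on the unit circle, parametrised by \<open>t \<mapsto> exp (2 \<pi> \<i> t)\<close>.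
\<close>

lemma circle_mean_bound:
  assumes g: "g holomorphic_on cball 0 1"
  shows "cmod (g 0) \<le> integral {0..1} (\<lambda>t. cmod (g (exp (2 * of_real pi * \<i> * of_real t))))"
proof -
  let ?e = "\<lambda>t. exp (2 * of_real pi * \<i> * of_real t) :: complex"
  have cont: "continuous_on {0..1} (\<lambda>t. g (?e t))"
    by (rule continuous_on_compose2[OF holomorphic_on_imp_continuous_on[OF g]])
      (auto intro!: continuous_intros simp: norm_exp_eq_Re)
  have "((\<lambda>u. g u / (u - 0)) has_contour_integral 2 * of_real pi * \<i> * g 0) (circlepath 0 1)"
    by (rule Cauchy_integral_circlepath)
      (use g in \<open>auto intro: holomorphic_on_imp_continuous_on holomorphic_on_subset\<close>)
  then have "((\<lambda>t. g (?e t) / ?e t * (2 * of_real pi * \<i> * ?e t)) has_integral 2 * of_real pi * \<i> * g 0) {0..1}"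
    unfolding has_contour_integral vector_derivative_circlepath
    by (rule has_integral_eq[rotated])
      (auto simp: circlepath)
  then have "((\<lambda>t. (2 * of_real pi * \<i>) * g (?e t)) has_integral 2 * of_real pi * \<i> * g 0) {0..1}"
    by (rule has_integral_eq[rotated]) auto
  then have "((\<lambda>t. (1 / (2 * of_real pi * \<i>)) * ((2 * of_real pi * \<i>) * g (?e t))) has_integral
      (1 / (2 * of_real pi * \<i>)) * (2 * of_real pi * \<i> * g 0)) {0..1}"
    by (rule has_integral_mult_right)
  then have "((\<lambda>t. g (?e t)) has_integral g 0) {0..1}"
    by simp
  then have "g 0 = integral {0..1} (\<lambda>t. g (?e t))"
    by (simp add: integral_unique)
  also have "cmod \<dots> \<le> integral {0..1} (\<lambda>t. cmod (g (?e t)))"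
    by (rule integral_norm_bound_integral)
      (auto intro!: integrable_continuous_interval continuous_intros cont)
  finally show ?thesis .
qed

text \<open>
  The map \<open>h \<mapsto> w + c h\<close> carries the ball about \<open>0\<close> onto the ball about \<open>w\<close> and preserves volume, its complex
  determinant being a power of \<open>c\<close>. The bound is therefore independent of \<open>c\<close>.
\<close>

lemma rotated_ball_integral:
  fixes f :: "complex ^ 'n::finite \<Rightarrow> complex"
  assumes f: "f \<in> bergman_space D" and D: "ball w r \<subseteq> D" "open D" and c: "cmod c = 1"
  shows "(\<integral>\<^sup>+h. indicator (ball 0 r) h * ennreal ((cmod (f (w + c *s h)))\<^sup>2) \<partial>lborel)
      \<le> ennreal ((bergman_norm D f)\<^sup>2)"
proof -
  define g where "g h = w + c *s h" for h :: "complex ^ 'n"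
  have c0: "c \<noteq> 0" using c by auto
  have img: "g ` ball 0 r = ball w r"
  proof
    show "g ` ball 0 r \<subseteq> ball w r"
      by (auto simp: g_def dist_norm norm_smult_vec c)
    show "ball w r \<subseteq> g ` ball 0 r"
    proof
      fix x assume "x \<in> ball w r"
      then have "(1 / c) *s (x - w) \<in> ball 0 r"
        using norm_smult_vec[of "1 / c" "x - w"]
        by (simp only: mem_ball dist_norm norm_minus_commute[of w] diff_0 norm_minus_cancel norm_divide c norm_one div_by_1 mult_1)
      moreover have "x = g ((1 / c) *s (x - w))"
        using c0 by (simp add: g_def vec_eq_iff)
      ultimately show "x \<in> g ` ball 0 r" by blast
    qed
  qed
  have der: "(g has_derivative ((*v) (mat c))) (at z)" for z
  proof -
    have eq: "(*v) (mat c :: complex ^ 'n ^ 'n) = (*s) (c::complex)"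
      by (auto simp: fun_eq_iff vec_eq_iff matrix_vector_mult_def mat_def if_distrib[of "\<lambda>x. x * _"] cong: if_cong)
    have "bounded_linear ((*s) c :: complex ^ 'n \<Rightarrow> _)"
      by (rule bounded_linear_intro[where K = "cmod c"])
        (auto simp: norm_smult_vec vec_eq_iff algebra_simps)
    then show ?thesis
      unfolding g_def eq by (auto intro!: derivative_eq_intros bounded_linear_imp_has_derivative)
  qed
  have inj: "inj_on g (ball 0 r)"
    using c0 by (auto simp: inj_on_def g_def)
  have det: "(cmod (det (mat c :: complex ^ 'n ^ 'n)))\<^sup>2 = 1"
    by (subst det_diagonal) (auto simp: mat_def norm_power c)
  have cont: "continuous_on (g ` ball 0 r) (\<lambda>z. (cmod (f z))\<^sup>2)"
    unfolding img by (intro continuous_intros continuous_on_subset[OF holo_fun_continuous_on[OF bergman_spaceD(1)[OF f]]] D)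
  have int: "set_integrable lborel (g ` ball 0 r) (\<lambda>z. (cmod (f z))\<^sup>2)"
    unfolding img by (rule set_integrable_subset[OF bergman_spaceD(2)[OF f]]) (use D in auto)
  note cov = complex_change_of_variables[OF _ _ der inj cont, unfolded det, simplified]
  have opg: "open (g ` ball 0 r)" unfolding img by simp
  have i1: "set_integrable lborel (ball 0 r) (\<lambda>h. (cmod (f (g h)))\<^sup>2)"
    using cov(1)[OF opg] int by simp
  have "(\<integral>\<^sup>+h. indicator (ball 0 r) h * ennreal ((cmod (f (g h)))\<^sup>2) \<partial>lborel)
     = (\<integral>\<^sup>+h. ennreal (indicator (ball 0 r) h *\<^sub>R (cmod (f (g h)))\<^sup>2) \<partial>lborel)"
    by (rule nn_integral_cong) (auto simp: indicator_def)
  also have "\<dots> = ennreal (LINT h:ball 0 r|lborel. (cmod (f (g h)))\<^sup>2)"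
    unfolding set_lebesgue_integral_def
    by (rule nn_integral_eq_integral) (use i1 in \<open>auto simp: set_integrable_def\<close>)
  also have "\<dots> = ennreal (LINT z:ball w r|lborel. (cmod (f z))\<^sup>2)"
    using cov(2)[OF opg int] by (simp add: img)
  also have "\<dots> = (\<integral>\<^sup>+z. ennreal (indicator (ball w r) z *\<^sub>R (cmod (f z))\<^sup>2) \<partial>lborel)"
    unfolding set_lebesgue_integral_def
    by (rule nn_integral_eq_integral[symmetric]) (use int in \<open>auto simp: set_integrable_def img\<close>)
  also have "\<dots> \<le> (\<integral>\<^sup>+z. indicator D z * ennreal ((cmod (f z))\<^sup>2) \<partial>lborel)"
    by (rule nn_integral_mono) (use D in \<open>auto simp: indicator_def\<close>)
  finally show ?thesis
    by (simp add: bergman_norm_nn_integral[OF f] g_def)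
qed

text \<open>
  The mean value inequality for \<open>f\<^sup>2\<close>. On each complex line through \<open>w\<close> the value \<open>f(w)\<^sup>2\<close> is a mean
  over circles; integrating over the direction \<open>h\<close> in the ball and exchanging the integrals leaves, for each
  angle, the integral over a rotated ball, which does not depend on the angle.
\<close>

theorem point_evaluation_bound:
  fixes f :: "complex ^ 'n::finite \<Rightarrow> complex"
  assumes f: "f \<in> bergman_space D" and D: "cball w r \<subseteq> D" "open D" and r: "r > 0"
  shows "(cmod (f w))\<^sup>2 * measure lborel (ball (0 :: complex ^ 'n) r) \<le> (bergman_norm D f)\<^sup>2"
proof -
  let ?e = "\<lambda>t. exp (2 * of_real pi * \<i> * of_real t) :: complex"
  let ?B = "ball (0 :: complex ^ 'n) r"
  define \<Phi> where "\<Phi> p = (indicator ({0..1} \<times> ?B) p *\<^sub>R (cmod (f (w + ?e (fst p) *s snd p)))\<^sup>2)" for p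
  have inD: "w + c *s h \<in> D" if "h \<in> ?B" "cmod c \<le> 1" for c h
  proof -
    have "norm (c *s h) \<le> 1 * norm h"
      unfolding norm_smult_vec using that by (intro mult_right_mono) auto
    then show ?thesis using that D by (auto simp: subset_iff dist_norm)
  qed
  have contf: "continuous_on D f" by (rule holo_fun_continuous_on[OF bergman_spaceD(1)[OF f]])
  have "continuous_on ({0..1} \<times> ?B) (\<lambda>p. (cmod (f (w + ?e (fst p) *s snd p)))\<^sup>2)"
  proof (intro continuous_intros continuous_on_compose2[OF contf])
    have "continuous_on UNIV (\<lambda>p::real \<times> (complex ^ 'n). (\<chi> i. ?e (fst p) * snd p $ i))"
      by (intro continuous_on_vec_lambda continuous_intros)
    then show "continuous_on ({0..1} \<times> ?B) (\<lambda>p. ?e (fst p) *s snd p)"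
      unfolding vector_scalar_mult_def by (rule continuous_on_subset) auto
    show "(\<lambda>p. w + ?e (fst p) *s snd p) ` ({0..1} \<times> ?B) \<subseteq> D"
      using inD by (auto simp: norm_exp_eq_Re)
  qed
  then have "\<Phi> \<in> borel_measurable borel"
    unfolding \<Phi>_def by (intro borel_measurable_continuous_on_indicator borel_Times) auto
  then have meas: "(\<lambda>p. ennreal (\<Phi> p)) \<in> borel_measurable (lborel \<Otimes>\<^sub>M lborel)"
    by (simp add: lborel_prod)
  have Phi: "ennreal (\<Phi> (t, h)) = indicator {0..1} t * (indicator ?B h * ennreal ((cmod (f (w + ?e t *s h)))\<^sup>2))" for t h
    by (auto simp: \<Phi>_def indicator_def)
  have lower: "indicator ?B h * ennreal ((cmod (f w))\<^sup>2) \<le> (\<integral>\<^sup>+t. ennreal (\<Phi> (t, h)) \<partial>lborel)" for h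
  proof (cases "h \<in> ?B")
    case True
    define g where "g t = (f (w + t *s h))\<^sup>2" for t
    have hol: "g holomorphic_on cball 0 1"
      unfolding g_def
    proof (intro holomorphic_intros)
      show "(\<lambda>t. f (w + t *s h)) holomorphic_on cball 0 1"
        using holo_fun_line[OF bergman_spaceD(1)[OF f]] inD[OF True]
        by (intro holomorphic_onI) (metis field_differentiable_at_within field_differentiable_def mem_cball_0)
    qed
    have cont: "continuous_on {0..1} (\<lambda>t. cmod (g (?e t)))"
      by (intro continuous_intros continuous_on_compose2[OF holomorphic_on_imp_continuous_on[OF hol]])
        (auto simp: norm_exp_eq_Re)
    then have I: "((\<lambda>t. cmod (g (?e t))) has_integral integral {0..1} (\<lambda>t. cmod (g (?e t)))) {0..1}"
      by (intro integrable_integral integrable_continuous_interval)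
    have "ennreal ((cmod (f w))\<^sup>2) = ennreal (cmod (g 0))"
      by (simp add: g_def norm_power)
    also have "\<dots> \<le> ennreal (integral {0..1} (\<lambda>t. cmod (g (?e t))))"
      by (intro ennreal_leI circle_mean_bound hol)
    also have "\<dots> = (\<integral>\<^sup>+t. indicator {0..1} t * ennreal (cmod (g (?e t))) \<partial>lborel)"
      using nn_integral_has_integral_lebesgue'[OF _ I] by (simp add: mult.commute)
    also have "\<dots> = (\<integral>\<^sup>+t. ennreal (\<Phi> (t, h)) \<partial>lborel)"
      unfolding Phi using True by (simp add: g_def norm_power)
    finally show ?thesis using True by simp
  qed simp
  have "ennreal ((cmod (f w))\<^sup>2 * measure lborel ?B) = (\<integral>\<^sup>+h. indicator ?B h * ennreal ((cmod (f w))\<^sup>2) \<partial>lborel)"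
  proof -
    have "emeasure lborel ?B = ennreal (measure lborel ?B)"
      by (rule emeasure_eq_ennreal_measure) (use emeasure_lborel_ball_finite[of "0 :: complex ^ 'n" r] in auto)
    moreover have "(\<integral>\<^sup>+h. indicator ?B h * ennreal ((cmod (f w))\<^sup>2) \<partial>lborel) = emeasure lborel ?B * ennreal ((cmod (f w))\<^sup>2)"
      by (subst nn_integral_multc) (auto intro!: borel_measurable_indicator)
    ultimately show ?thesis by (simp add: ennreal_mult mult.commute)
  qed
  also have "\<dots> \<le> (\<integral>\<^sup>+h. (\<integral>\<^sup>+t. ennreal (\<Phi> (t, h)) \<partial>lborel) \<partial>lborel)"
    by (rule nn_integral_mono) (rule lower)
  also have "\<dots> = (\<integral>\<^sup>+t. (\<integral>\<^sup>+h. ennreal (\<Phi> (t, h)) \<partial>lborel) \<partial>lborel)"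
    by (rule lborel_pair.Fubini'[symmetric]) (use meas in simp)
  also have "\<dots> \<le> (\<integral>\<^sup>+t. indicator {0..1::real} t * ennreal ((bergman_norm D f)\<^sup>2) \<partial>lborel)"
  proof (rule nn_integral_mono)
    fix t :: real
    show "(\<integral>\<^sup>+h. ennreal (\<Phi> (t, h)) \<partial>lborel) \<le> indicator {0..1} t * ennreal ((bergman_norm D f)\<^sup>2)"
    proof (cases "t \<in> {0..1}")
      case True
      then show ?thesis
        unfolding Phi
        using rotated_ball_integral[OF f subset_trans[OF ball_subset_cball D(1)] D(2), of "?e t"]
        by (auto simp: norm_exp_eq_Re)
    qed (simp add: Phi)
  qed
  also have "\<dots> = ennreal ((bergman_norm D f)\<^sup>2)"
    by (simp add: nn_integral_multc)
  finally show ?thesis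
    by (simp add: ennreal_le_iff)
qed


text \<open>
  The type argument carries the dimension of the ball.
\<close>

definition evaluation_constant :: "'n::finite itself \<Rightarrow> real \<Rightarrow> real" where
  "evaluation_constant _ r = 1 / sqrt (measure lborel (ball (0 :: complex ^ 'n) r))"

lemma evaluation_constant_pos: "r > 0 \<Longrightarrow> evaluation_constant TYPE('n::finite) r > 0"
  using content_ball_pos[of r "0 :: complex ^ 'n"] by (simp add: evaluation_constant_def)

lemma bergman_norm_nonneg [simp]: "0 \<le> bergman_norm D f"
  unfolding bergman_norm_def set_lebesgue_integral_def
  by (intro real_sqrt_ge_zero integral_nonneg_AE) auto

lemma point_evaluation_bound':
  fixes f :: "complex ^ 'n::finite \<Rightarrow> complex"
  assumes f: "f \<in> bergman_space D" and D: "cball w r \<subseteq> D" "open D" and r: "r > 0"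
  shows "cmod (f w) \<le> evaluation_constant TYPE('n) r * bergman_norm D f"
proof -
  let ?m = "measure lborel (ball (0 :: complex ^ 'n) r)"
  have m: "?m > 0" using content_ball_pos[OF r, of "0 :: complex ^ 'n"] by simp
  have "sqrt ((cmod (f w))\<^sup>2 * ?m) \<le> sqrt ((bergman_norm D f)\<^sup>2)"
    by (rule real_sqrt_le_mono) (rule point_evaluation_bound[OF assms])
  then have "cmod (f w) * sqrt ?m \<le> bergman_norm D f"
    by (simp add: real_sqrt_mult)
  then show ?thesis
    using m by (simp add: evaluation_constant_def pos_le_divide_eq)
qed

text \<open>
  By the evaluation bound a Cauchy sequence converges locally uniformly, so its pointwise limit is
  holomorphic; Fatou's lemma turns this into convergence in norm.
\<close>

theorem bergman_space_complete:
  fixes F :: "nat \<Rightarrow> complex ^ 'n::finite \<Rightarrow> complex"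
  assumes D: "open D" and F: "\<And>n. F n \<in> bergman_space D"
    and cauchy: "\<And>e. e > 0 \<Longrightarrow> \<exists>N. \<forall>m\<ge>N. \<forall>n\<ge>N. bergman_norm D (\<lambda>x. F m x - F n x) < e"
  shows "\<exists>g\<in>bergman_space D. (\<lambda>n. bergman_norm D (\<lambda>x. F n x - g x)) \<longlonglongrightarrow> 0"
proof -
  interpret hermitian_function_space "bergman_space D" "bergman_ip D"
    by (rule bergman_space_hermitian[OF D])
  define g where "g x = lim (\<lambda>n. F n x)" for x
  have unif: "\<exists>R>0. cball z R \<subseteq> D \<and> uniform_limit (cball z R) F g sequentially" if z: "z \<in> D" for z
  proof -
    obtain R where R: "R > 0" "cball z R \<subseteq> D"
      using D z open_contains_cball by blast
    have sub: "cball w (R/2) \<subseteq> D" if "w \<in> cball z (R/2)" for w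
      using half_cball[OF that] R by blast
    let ?C = "evaluation_constant TYPE('n) (R/2)"
    have C: "?C > 0" using R by (intro evaluation_constant_pos) simp
    have "uniformly_Cauchy_on (cball z (R/2)) F"
    proof (rule uniformly_Cauchy_onI)
      fix e :: real assume "e > 0"
      then obtain N where N: "\<forall>m\<ge>N. \<forall>n\<ge>N. bergman_norm D (\<lambda>x. F m x - F n x) < e / ?C"
        using cauchy[of "e / ?C"] C by auto
      have "dist (F m x) (F n x) < e" if "x \<in> cball z (R/2)" "m \<ge> N" "n \<ge> N" for x m n
      proof -
        have "cmod (F m x - F n x) \<le> ?C * bergman_norm D (\<lambda>x. F m x - F n x)"
          by (rule point_evaluation_bound'[OF H_diff[OF F F] sub[OF that(1)] D]) (use R in simp)
        also have "\<dots> < ?C * (e / ?C)"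
          using N that C by (intro mult_strict_left_mono) auto
        finally show ?thesis using C by (simp add: dist_norm)
      qed
      then show "\<exists>M. \<forall>x\<in>cball z (R/2). \<forall>m\<ge>M. \<forall>n\<ge>M. dist (F m x) (F n x) < e" by blast
    qed
    then have "uniformly_convergent_on (cball z (R/2)) F"
      by (rule Cauchy_uniformly_convergent)
    then have "uniform_limit (cball z (R/2)) F g sequentially"
      unfolding uniformly_convergent_uniform_limit_iff g_def .
    then show ?thesis
      using R sub[of z] by (intro exI[of _ "R/2"]) auto
  qed
  have lim: "(\<lambda>n. F n x) \<longlonglongrightarrow> g x" if x: "x \<in> D" for x
  proof -
    obtain R where "R > 0" "uniform_limit (cball x R) F g sequentially"
      using unif[OF x] by blast
    then show ?thesis by (auto elim!: tendsto_uniform_limitI)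
  qed
  have g: "holo_fun D g"
  proof (rule holo_fun_locally)
    fix z assume "z \<in> D"
    then obtain R where R: "R > 0" "cball z R \<subseteq> D" "uniform_limit (cball z R) F g sequentially"
      using unif by blast
    have "holo_fun (ball z (R/2)) g"
      by (rule holo_fun_uniform_limit_ball[OF _ R(2,1,3)]) (use F bergman_spaceD in blast)
    then show "\<exists>r>0. holo_fun (ball z r) g"
      using R(1) by (intro exI[of _ "R/2"]) auto
  qed
  (* Fatou: the distance to the limit is at most the lower limit of the mutual distances *)
  have close: "(\<lambda>x. F n x - g x) \<in> bergman_space D \<and> bergman_norm D (\<lambda>x. F n x - g x) \<le> e"
    if e: "e > 0" and N: "\<forall>m\<ge>N. \<forall>n\<ge>N. bergman_norm D (\<lambda>x. F m x - F n x) < e" and n: "n \<ge> N" for e N n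
  proof -
    have hol: "holo_fun D (\<lambda>x. F n x - g x)"
      by (intro holo_fun_diff g bergman_spaceD(1) F)
    let ?u = "\<lambda>m x. indicator D x * ennreal ((cmod (F n x - F m x))\<^sup>2)"
    have "(\<integral>\<^sup>+x. indicator D x * ennreal ((cmod (F n x - g x))\<^sup>2) \<partial>lborel) = (\<integral>\<^sup>+x. liminf (\<lambda>m. ?u m x) \<partial>lborel)"
    proof (rule nn_integral_cong)
      fix x
      show "indicator D x * ennreal ((cmod (F n x - g x))\<^sup>2) = liminf (\<lambda>m. ?u m x)"
      proof (cases "x \<in> D")
        case True
        have "(\<lambda>m. ennreal ((cmod (F n x - F m x))\<^sup>2)) \<longlonglongrightarrow> ennreal ((cmod (F n x - g x))\<^sup>2)"
          by (intro tendsto_ennrealI tendsto_intros lim[OF True])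
        from lim_imp_Liminf[OF sequentially_bot this] True show ?thesis
          by simp
      qed (simp add: Liminf_const)
    qed
    also have "\<dots> \<le> liminf (\<lambda>m. \<integral>\<^sup>+x. ?u m x \<partial>lborel)"
    proof (rule nn_integral_liminf)
      fix m
      have "(\<lambda>x. ennreal (indicator D x *\<^sub>R (cmod (F n x - F m x))\<^sup>2)) \<in> borel_measurable lborel"
        by (intro measurable_compose[OF _ measurable_ennreal] measurable_on_open D continuous_intros
            holo_fun_continuous_on bergman_spaceD(1) F)
      also have "(\<lambda>x. ennreal (indicator D x *\<^sub>R (cmod (F n x - F m x))\<^sup>2)) = ?u m"
        by (auto simp: indicator_def)
      finally show "?u m \<in> borel_measurable lborel" .
    qed
    also have "\<dots> \<le> liminf (\<lambda>m. ennreal (e\<^sup>2))"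
    proof (rule Liminf_mono, rule eventually_sequentiallyI)
      fix m assume "m \<ge> N"
      then have "bergman_norm D (\<lambda>x. F n x - F m x) \<le> e" using N n by (simp add: less_imp_le)
      then have "(bergman_norm D (\<lambda>x. F n x - F m x))\<^sup>2 \<le> e\<^sup>2"
        by (intro power_mono) auto
      then show "(\<integral>\<^sup>+x. ?u m x \<partial>lborel) \<le> ennreal (e\<^sup>2)"
        unfolding bergman_norm_nn_integral[OF H_diff[OF F F]] by (rule ennreal_leI)
    qed
    also have "\<dots> = ennreal (e\<^sup>2)" by (simp add: Liminf_const)
    finally show ?thesis
      using bergman_space_nn_integralI[OF D hol less_imp_le[OF e]] by blast
  qed
  obtain N1 where N1: "\<forall>m\<ge>N1. \<forall>n\<ge>N1. bergman_norm D (\<lambda>x. F m x - F n x) < 1"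
    using cauchy[of 1] by auto
  have "(\<lambda>x. F N1 x - (F N1 x - g x)) \<in> bergman_space D"
    by (rule H_diff[OF F]) (use close[OF _ N1, of N1] in auto)
  then have "g \<in> bergman_space D" by simp
  moreover have "(\<lambda>n. bergman_norm D (\<lambda>x. F n x - g x)) \<longlonglongrightarrow> 0"
  proof (rule LIMSEQ_I)
    fix e :: real assume e: "e > 0"
    then obtain N where N: "\<forall>m\<ge>N. \<forall>n\<ge>N. bergman_norm D (\<lambda>x. F m x - F n x) < e / 2"
      using cauchy[of "e/2"] by auto
    show "\<exists>no. \<forall>n\<ge>no. norm (bergman_norm D (\<lambda>x. F n x - g x) - 0) < e"
      using close[OF _ N] e by (intro exI[of _ N]) fastforce
  qed
  ultimately show ?thesis by blast
qed

theorem bergman_riesz: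
  fixes l :: "(complex ^ 'n::finite \<Rightarrow> complex) \<Rightarrow> complex"
  assumes D: "open D"
    and add: "\<And>f g. f \<in> bergman_space D \<Longrightarrow> g \<in> bergman_space D \<Longrightarrow> l (\<lambda>x. f x + g x) = l f + l g"
    and scale: "\<And>f c. f \<in> bergman_space D \<Longrightarrow> l (\<lambda>x. c * f x) = c * l f"
    and bounded: "\<And>f. f \<in> bergman_space D \<Longrightarrow> cmod (l f) \<le> C * bergman_norm D f"
  shows "\<exists>g\<in>bergman_space D. \<forall>f\<in>bergman_space D. l f = bergman_ip D f g"
proof -
  interpret hermitian_function_space "bergman_space D" "bergman_ip D"
    by (rule bergman_space_hermitian[OF D])
  show ?thesis
    by (rule riesz[where C = C])
      (use bergman_space_complete[OF D] add scale bounded in \<open>auto simp: bergman_nrm[OF D]\<close>)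
qed

section \<open>The Bergman metric as an extremal quantity\<close>

lemma norm_axis: "norm (axis k t :: complex ^ 'n::finite) = cmod t"
  using norm_smult_vec[of t "axis k 1 :: complex ^ 'n"] by (simp add: axis_eq_smult[of k t, symmetric])

text \<open>
  The Wirtinger derivatives are the coefficients of the complex linear and the conjugate linear part of
  the real derivative along the coordinate line.
\<close>

lemma wirtinger_eqI:
  assumes "((\<lambda>t. F (w + axis k t)) has_derivative (\<lambda>t. \<alpha> * t + \<beta> * cnj t)) (at 0)"
  shows "wirtinger k F w = \<alpha>" "wirtinger_bar k F w = \<beta>"
proof -
  have "((\<lambda>t::real. F (w + axis k (c * of_real t))) has_vector_derivative \<alpha> * c + \<beta> * cnj c) (at 0)" for c
  proof -
    have "((\<lambda>t::real. c * complex_of_real t) has_derivative (\<lambda>t. c * of_real t)) (at 0)"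
      by (intro bounded_linear_imp_has_derivative bounded_linear_const_mult bounded_linear_of_real)
    then have "((\<lambda>t. F (w + axis k t)) \<circ> (\<lambda>t::real. c * of_real t) has_derivative
        (\<lambda>t. \<alpha> * t + \<beta> * cnj t) \<circ> (\<lambda>t. c * of_real t)) (at 0)"
      by (rule diff_chain_at) (use assms in simp)
    then show ?thesis
      by (simp add: has_vector_derivative_def comp_def scaleR_conv_of_real algebra_simps)
  qed
  from this[of 1] this[of "\<i>"]
  have x: "partial_x k F w = \<alpha> + \<beta>" and y: "partial_y k F w = \<alpha> * \<i> - \<beta> * \<i>"
    unfolding partial_x_def partial_y_def by (auto intro!: vector_derivative_at)
  show "wirtinger k F w = \<alpha>" "wirtinger_bar k F w = \<beta>"
    by (simp_all add: wirtinger_def wirtinger_bar_def x y algebra_simps)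
qed

locale bergman_domain =
  fixes D :: "(complex ^ 'n::finite) set"
  assumes D_open: "open D" and D_bounded: "bounded D"
begin

abbreviation "H \<equiv> bergman_space D"
abbreviation "ip \<equiv> bergman_ip D"

sublocale hermitian_function_space "bergman_space D" "bergman_ip D"
  by (rule bergman_space_hermitian[OF D_open])

lemma nrm_eq: "nrm = bergman_norm D"
  by (rule bergman_nrm[OF D_open])

lemma bounded_holo_in_bergman:
  assumes f: "holo_fun D f" and M: "\<And>x. x \<in> D \<Longrightarrow> cmod (f x) \<le> M"
  shows "f \<in> H"
  unfolding bergman_space_def mem_Collect_eq
proof
  show "set_integrable lborel D (\<lambda>z. (cmod (f z))\<^sup>2)"
    unfolding set_integrable_def
  proof (rule Bochner_Integration.integrable_bound)
    have "integrable lborel (indicator D :: complex ^ 'n \<Rightarrow> real)"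
      using D_open emeasure_bounded_finite[OF D_bounded] by (intro integrable_real_indicator) auto
    then show "integrable lborel (\<lambda>x. indicator D x * M\<^sup>2)"
      by (rule integrable_mult_left)
    show "(\<lambda>x. indicator D x *\<^sub>R (cmod (f x))\<^sup>2) \<in> borel_measurable lborel"
      by (intro measurable_on_open D_open continuous_intros holo_fun_continuous_on f)
    show "AE x in lborel. norm (indicator D x *\<^sub>R (cmod (f x))\<^sup>2) \<le> norm (indicator D x * M\<^sup>2)"
      by (intro AE_I2) (auto simp: indicator_def intro!: power_mono M)
  qed
qed (rule f)

text \<open>
  The linear operators on the Bergman space whose point evaluations are locally uniformly bounded
  functionals. The identity is one, and the class is closed under directional derivatives; hence a single
  expansion lemma serves both for the kernel and for the representers of its derivatives.
\<close>

definition bergman_operator :: "((complex ^ 'n \<Rightarrow> complex) \<Rightarrow> complex ^ 'n \<Rightarrow> complex) \<Rightarrow> bool" where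
  "bergman_operator T \<longleftrightarrow>
     (\<forall>f\<in>H. holo_fun D (T f)) \<and>
     (\<forall>f\<in>H. \<forall>g\<in>H. \<forall>x\<in>D. T (\<lambda>x. f x + g x) x = T f x + T g x) \<and>
     (\<forall>f\<in>H. \<forall>c. \<forall>x\<in>D. T (\<lambda>x. c * f x) x = c * T f x) \<and>
     (\<forall>w\<in>D. \<exists>r>0. \<exists>C\<ge>0. cball w r \<subseteq> D \<and> (\<forall>f\<in>H. \<forall>x\<in>cball w r. cmod (T f x) \<le> C * nrm f))"

lemma bergman_operatorD:
  assumes "bergman_operator T"
  shows "f \<in> H \<Longrightarrow> holo_fun D (T f)"
    and "f \<in> H \<Longrightarrow> g \<in> H \<Longrightarrow> x \<in> D \<Longrightarrow> T (\<lambda>x. f x + g x) x = T f x + T g x"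
    and "f \<in> H \<Longrightarrow> x \<in> D \<Longrightarrow> T (\<lambda>x. c * f x) x = c * T f x"
    and "w \<in> D \<Longrightarrow> \<exists>r>0. \<exists>C\<ge>0. cball w r \<subseteq> D \<and> (\<forall>f\<in>H. \<forall>x\<in>cball w r. cmod (T f x) \<le> C * nrm f)"
  using assms unfolding bergman_operator_def by blast+

lemma bergman_operator_id: "bergman_operator (\<lambda>f. f)"
  unfolding bergman_operator_def
proof (intro conjI ballI allI)
  fix w assume "w \<in> D"
  then obtain R where R: "R > 0" "cball w R \<subseteq> D"
    using D_open open_contains_cball by blast
  let ?C = "evaluation_constant TYPE('n) (R/2)"
  have C: "?C > 0" using R by (intro evaluation_constant_pos) simp
  have "cmod (f x) \<le> ?C * nrm f" if "f \<in> H" "x \<in> cball w (R/2)" for f x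
    unfolding nrm_eq
    by (rule point_evaluation_bound'[OF that(1) subset_trans[OF half_cball[OF that(2)] R(2)] D_open])
      (use R in simp)
  moreover have "cball w (R/2) \<subseteq> D" using R by (auto simp: subset_iff)
  ultimately show "\<exists>r>0. \<exists>C\<ge>0. cball w r \<subseteq> D \<and> (\<forall>f\<in>H. \<forall>x\<in>cball w r. cmod (f x) \<le> C * nrm f)"
    using R C by (intro exI[of _ "R/2"] conjI exI[of _ ?C]) auto
qed (auto intro: bergman_spaceD(1))

text \<open>
  The local bound for the derivative is the Cauchy estimate on balls of half the radius.
\<close>

lemma bergman_operator_gradient:
  assumes T: "bergman_operator T"
  shows "bergman_operator (\<lambda>f x. gradient_app (T f) x u)"
  unfolding bergman_operator_def
proof (intro conjI ballI allI)
  fix f assume "f \<in> H"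
  then show "holo_fun D (\<lambda>x. gradient_app (T f) x u)"
    by (intro holo_fun_gradient D_open bergman_operatorD(1)[OF T])
next
  fix f g x assume fg: "f \<in> H" "g \<in> H" "x \<in> D"
  have "gradient_app (T (\<lambda>x. f x + g x)) x = gradient_app (\<lambda>x. T f x + T g x) x"
    by (rule gradient_app_cong[OF D_open fg(3)])
      (use fg in \<open>auto intro: bergman_operatorD(1,2)[OF T] H_add\<close>)
  then show "gradient_app (T (\<lambda>x. f x + g x)) x u = gradient_app (T f) x u + gradient_app (T g) x u"
    using gradient_app_add[OF bergman_operatorD(1)[OF T fg(1)] bergman_operatorD(1)[OF T fg(2)] fg(3)] by simp
next
  fix f c x assume fg: "f \<in> H" "x \<in> D"
  have "gradient_app (T (\<lambda>x. c * f x)) x = gradient_app (\<lambda>x. c * T f x) x"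
    by (rule gradient_app_cong[OF D_open fg(2)])
      (use fg in \<open>auto intro: bergman_operatorD(1,3)[OF T] H_scale\<close>)
  then show "gradient_app (T (\<lambda>x. c * f x)) x u = c * gradient_app (T f) x u"
    using gradient_app_cmult[OF bergman_operatorD(1)[OF T fg(1)] fg(2)] by simp
next
  fix w assume "w \<in> D"
  from bergman_operatorD(4)[OF T this] obtain r C where r: "r > 0" "C \<ge> 0" "cball w r \<subseteq> D"
    and C: "\<And>f x. f \<in> H \<Longrightarrow> x \<in> cball w r \<Longrightarrow> cmod (T f x) \<le> C * nrm f" by blast
  have "cmod (gradient_app (T f) x u) \<le> (C / (r/2) * norm u) * nrm f"
    if f: "f \<in> H" and x: "x \<in> cball w (r/2)" for f x
  proof -
    have "cmod (gradient_app (T f) x u) \<le> C * nrm f / (r/2) * norm u"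
      by (rule gradient_bound[OF bergman_operatorD(1)[OF T f]])
        (use half_cball[OF x] r C[OF f] in auto)
    then show ?thesis by (simp add: field_simps)
  qed
  moreover have "cball w (r/2) \<subseteq> D" using r by (auto simp: subset_iff)
  ultimately show "\<exists>r>0. \<exists>C\<ge>0. cball w r \<subseteq> D \<and> (\<forall>f\<in>H. \<forall>x\<in>cball w r. cmod (gradient_app (T f) x u) \<le> C * nrm f)"
    using r by (intro exI[of _ "r/2"] conjI exI[of _ "C / (r/2) * norm u"]) auto
qed

text \<open>
  Representers are unique only on \<open>D\<close>. The choice is made by the same description as in
  \<open>bergman_kernel\<close>, so that the representers of point evaluations are literally the kernel functions.
\<close>

definition repr :: "((complex ^ 'n \<Rightarrow> complex) \<Rightarrow> complex ^ 'n \<Rightarrow> complex) \<Rightarrow> complex ^ 'n \<Rightarrow> complex ^ 'n \<Rightarrow> complex" where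
  "repr T w = (SOME g. g \<in> H \<and> (\<forall>f\<in>H. T f w = ip f g))"

lemma repr:
  assumes T: "bergman_operator T" and w: "w \<in> D"
  shows "repr T w \<in> H" and "f \<in> H \<Longrightarrow> T f w = ip f (repr T w)"
proof -
  obtain r C where rC: "r > 0" "\<forall>f\<in>H. \<forall>x\<in>cball w r. cmod (T f x) \<le> C * nrm f"
    using bergman_operatorD(4)[OF T w] by blast
  have "\<exists>g\<in>H. \<forall>f\<in>H. T f w = ip f g"
  proof (rule bergman_riesz[OF D_open])
    show "cmod (T f w) \<le> C * bergman_norm D f" if "f \<in> H" for f
      using rC that unfolding nrm_eq by auto
  qed (use bergman_operatorD(2,3)[OF T] w in auto)
  then have "\<exists>g. g \<in> H \<and> (\<forall>f\<in>H. T f w = ip f g)" by blast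
  from someI_ex[OF this] show "repr T w \<in> H" "f \<in> H \<Longrightarrow> T f w = ip f (repr T w)"
    unfolding repr_def by blast+
qed

text \<open>
  The remainder is controlled in norm: paired with any \<open>f\<close> it is the second order Taylor remainder of
  \<open>T f\<close> at \<open>w\<close>, which is at most a multiple of \<open>\<bar>t\<bar>\<^sup>2 \<parallel>f\<parallel>\<close>.
\<close>

lemma repr_expansion:
  assumes T: "bergman_operator T" and w: "w \<in> D"
  obtains \<delta> C where "\<delta> > 0"
    "\<And>t. cmod t < \<delta> \<Longrightarrow> w + axis k t \<in> D"
    "\<And>t. cmod t < \<delta> \<Longrightarrow> nrm (\<lambda>x. repr T (w + axis k t) x - repr T w x
        - cnj t * repr (\<lambda>f x. gradient_app (T f) x (axis k 1)) w x) \<le> C * (cmod t)\<^sup>2"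
proof -
  let ?G = "\<lambda>f x. gradient_app (T f) x (axis k 1)"
  have G: "bergman_operator ?G" by (rule bergman_operator_gradient[OF T])
  obtain r C where r: "r > 0" "C \<ge> 0" "cball w r \<subseteq> D"
    and C: "\<And>f x. f \<in> H \<Longrightarrow> x \<in> cball w r \<Longrightarrow> cmod (T f x) \<le> C * nrm f"
    using bergman_operatorD(4)[OF T w] by blast
  have inD: "w + axis k t \<in> D" if "cmod t < r / 2" for t
  proof -
    have "w + axis k t \<in> cball w r" using that r(1) by (simp add: dist_norm norm_axis)
    then show ?thesis using r by blast
  qed
  have "nrm (\<lambda>x. repr T (w + axis k t) x - repr T w x - cnj t * repr ?G w x)
      \<le> (8 * C / r\<^sup>2) * (cmod t)\<^sup>2" if t: "cmod t < r / 2" for t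
  proof (rule nrm_le_of_functional)
    show "(\<lambda>x. repr T (w + axis k t) x - repr T w x - cnj t * repr ?G w x) \<in> H"
      by (intro H_diff H_scale repr T G w inD t)
    show "0 \<le> (8 * C / r\<^sup>2) * (cmod t)\<^sup>2" using r by simp
    fix f assume f: "f \<in> H"
    have "ip f (\<lambda>x. repr T (w + axis k t) x - repr T w x - cnj t * repr ?G w x)
        = T f (w + axis k t) - T f w - t * ?G f w"
      using f by (simp add: ip_diff_right ip_scale_right H_diff H_scale repr[OF T] repr[OF G] w inD[OF t])
    also have "t * ?G f w = gradient_app (T f) w (axis k t)"
      unfolding axis_eq_smult[of k t] by (simp add: gradient_app_smult)
    also have "cmod (T f (w + axis k t) - T f w - gradient_app (T f) w (axis k t))
        \<le> 8 * (C * nrm f) / r\<^sup>2 * (norm (axis k t :: complex ^ 'n))\<^sup>2"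
      by (rule taylor_bound[OF bergman_operatorD(1)[OF T f] r(3,1) C[OF f]])
        (use t in \<open>auto simp: norm_axis\<close>)
    finally show "cmod (ip f (\<lambda>x. repr T (w + axis k t) x - repr T w x - cnj t * repr ?G w x))
        \<le> 8 * C / r\<^sup>2 * (cmod t)\<^sup>2 * nrm f"
      by (simp add: norm_axis mult_ac)
  qed
  with inD r that[of "r/2" "8 * C / r\<^sup>2"] show ?thesis by simp
qed

lemma ip_repr_has_derivative:
  assumes T: "bergman_operator T" and S: "bergman_operator S" and w: "w \<in> D"
  shows "((\<lambda>t. ip (repr T (w + axis k t)) (repr S (w + axis k t))) has_derivative
     (\<lambda>t. cnj t * ip (repr (\<lambda>f x. gradient_app (T f) x (axis k 1)) w) (repr S w)
        + t * ip (repr T w) (repr (\<lambda>f x. gradient_app (S f) x (axis k 1)) w))) (at 0)"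
proof -
  obtain d1 C1 where d1: "d1 > 0" "\<And>t. cmod t < d1 \<Longrightarrow> w + axis k t \<in> D"
    "\<And>t. cmod t < d1 \<Longrightarrow> nrm (\<lambda>x. repr T (w + axis k t) x - repr T w x
        - cnj t * repr (\<lambda>f x. gradient_app (T f) x (axis k 1)) w x) \<le> C1 * (cmod t)\<^sup>2"
    using repr_expansion[OF T w] by blast
  obtain d2 C2 where d2: "d2 > 0" "\<And>t. cmod t < d2 \<Longrightarrow> w + axis k t \<in> D"
    "\<And>t. cmod t < d2 \<Longrightarrow> nrm (\<lambda>x. repr S (w + axis k t) x - repr S w x
        - cnj t * repr (\<lambda>f x. gradient_app (S f) x (axis k 1)) w x) \<le> C2 * (cmod t)\<^sup>2"
    using repr_expansion[OF S w] by blast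
  have m1: "C1 * (cmod t)\<^sup>2 \<le> max C1 C2 * (cmod t)\<^sup>2" and m2: "C2 * (cmod t)\<^sup>2 \<le> max C1 C2 * (cmod t)\<^sup>2" for t
    by (auto intro!: mult_right_mono)
  have a0: "axis k (0::complex) = 0" by (simp add: vec_eq_iff axis_def)
  have b1: "nrm (\<lambda>x. repr T (w + axis k t) x - repr T w x
        - cnj t * repr (\<lambda>f x. gradient_app (T f) x (axis k 1)) w x) \<le> max C1 C2 * (cmod t)\<^sup>2"
    if "cmod t < min d1 d2" for t
    using d1(3)[of t] m1[of t] that by linarith
  have b2: "nrm (\<lambda>x. repr S (w + axis k t) x - repr S w x
        - cnj t * repr (\<lambda>f x. gradient_app (S f) x (axis k 1)) w x) \<le> max C1 C2 * (cmod t)\<^sup>2"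
    if "cmod t < min d1 d2" for t
    using d2(3)[of t] m2[of t] that by linarith
  have "((\<lambda>t. ip (repr T (w + axis k t)) (repr S (w + axis k t))) has_derivative
     (\<lambda>t. cnj t * ip (repr (\<lambda>f x. gradient_app (T f) x (axis k 1)) w) (repr S (w + axis k 0))
        + t * ip (repr T (w + axis k 0)) (repr (\<lambda>f x. gradient_app (S f) x (axis k 1)) w))) (at 0)"
  proof (rule ip_has_derivative[where \<delta> = "min d1 d2" and C = "max C1 C2"])
    show "min d1 d2 > 0" using d1 d2 by simp
    show "repr T (w + axis k t) \<in> H" "repr S (w + axis k t) \<in> H" if "cmod t < min d1 d2" for t
      using that by (auto intro!: repr(1) T S d1(2))
  qed (use b1 b2 in \<open>simp_all only: a0 add_0_right repr(1)[OF bergman_operator_gradient[OF T] w]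
      repr(1)[OF bergman_operator_gradient[OF S] w]\<close>)
  then show ?thesis by (simp only: a0 add_0_right)
qed

definition kern :: "complex ^ 'n \<Rightarrow> complex ^ 'n \<Rightarrow> complex" where
  "kern = repr (\<lambda>f. f)"

definition dkern :: "complex ^ 'n \<Rightarrow> complex ^ 'n \<Rightarrow> complex ^ 'n \<Rightarrow> complex" where
  "dkern u = repr (\<lambda>f x. gradient_app f x u)"

lemma bergman_kernel_eq: "bergman_kernel D z w = kern w z"
  by (simp add: bergman_kernel_def kern_def repr_def bergman_ip_def)

lemma kern_in: "w \<in> D \<Longrightarrow> kern w \<in> H" and kern: "w \<in> D \<Longrightarrow> f \<in> H \<Longrightarrow> ip f (kern w) = f w"
  using repr[OF bergman_operator_id] by (simp_all add: kern_def)

lemma dkern_in: "w \<in> D \<Longrightarrow> dkern u w \<in> H"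
  and dkern: "w \<in> D \<Longrightarrow> f \<in> H \<Longrightarrow> ip f (dkern u w) = gradient_app f w u"
  using repr[OF bergman_operator_gradient[OF bergman_operator_id]] by (simp_all add: dkern_def)

lemma kern_diag: "w \<in> D \<Longrightarrow> kern w w = of_real ((nrm (kern w))\<^sup>2)"
  using kern[OF _ kern_in, of w w] ip_self[OF kern_in, of w] by simp

text \<open>
  The domain is bounded, so the constant \<open>1\<close> lies in the Bergman space, and its value at \<open>w\<close> is not \<open>0\<close>.
\<close>

lemma kern_nonzero: "w \<in> D \<Longrightarrow> nrm (kern w) > 0"
proof -
  assume w: "w \<in> D"
  have one: "(\<lambda>x. 1) \<in> H" by (rule bounded_holo_in_bergman[of _ 1]) auto
  have "nrm (kern w) \<noteq> 0"
    using kern[OF w one] cauchy_schwarz[OF one kern_in[OF w]] by auto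
  then show ?thesis using nrm_nonneg[OF kern_in[OF w]] by simp
qed

lemma log_kernel_wirtinger_bar:
  assumes w: "w \<in> D"
  shows "wirtinger_bar k (\<lambda>w. complex_of_real (ln (Re (bergman_kernel D w w)))) w
     = ip (dkern (axis k 1) w) (kern w) / ip (kern w) (kern w)"
proof (rule wirtinger_eqI(2))
  let ?K = "\<lambda>t. ip (kern (w + axis k t)) (kern (w + axis k t))"
  let ?a = "ip (dkern (axis k 1) w) (kern w)"
  have a0: "axis k (0::complex) = 0" by (simp add: vec_eq_iff axis_def)
  have K0: "ip (kern w) (kern w) = of_real ((nrm (kern w))\<^sup>2)" by (rule ip_self[OF kern_in[OF w]])
  have "(?K has_derivative (\<lambda>t. cnj t * ?a + t * cnj ?a)) (at 0)"
    using ip_repr_has_derivative[OF bergman_operator_id bergman_operator_id w, of k]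
      ip_cnj[OF dkern_in[OF w] kern_in[OF w], of "axis k 1"] by (simp add: kern_def dkern_def)
  then have "((\<lambda>t. Re (?K t)) has_derivative (\<lambda>t. Re (cnj t * ?a + t * cnj ?a))) (at 0)"
    by (rule has_derivative_Re)
  then have "((\<lambda>t. ln (Re (?K t))) has_derivative (\<lambda>t. Re (cnj t * ?a + t * cnj ?a) * inverse (Re (?K 0)))) (at 0)"
    by (rule has_derivative_ln[rotated]) (use kern_nonzero[OF w] in \<open>simp add: a0 K0\<close>)
  then have "((\<lambda>t. complex_of_real (ln (Re (?K t)))) has_derivative
      (\<lambda>t. of_real (Re (cnj t * ?a + t * cnj ?a) * inverse (Re (?K 0))))) (at 0)"
    by (rule has_derivative_of_real)
  also have "(\<lambda>t. complex_of_real (Re (cnj t * ?a + t * cnj ?a) * inverse (Re (?K 0))))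
      = (\<lambda>t. cnj ?a / ip (kern w) (kern w) * t + ?a / ip (kern w) (kern w) * cnj t)"
  proof
    fix t
    have "complex_of_real (Re (cnj t * ?a + t * cnj ?a)) = cnj t * ?a + t * cnj ?a"
      by (simp add: complex_eq_iff)
    moreover have "complex_of_real (Re (?K 0)) = ip (kern w) (kern w)"
      by (simp add: a0 K0)
    ultimately show "complex_of_real (Re (cnj t * ?a + t * cnj ?a) * inverse (Re (?K 0)))
      = cnj ?a / ip (kern w) (kern w) * t + ?a / ip (kern w) (kern w) * cnj t"
      unfolding of_real_mult of_real_inverse by (simp add: field_simps add_divide_distrib)
  qed
  finally have *: "((\<lambda>t. complex_of_real (ln (Re (?K t)))) has_derivative
      (\<lambda>t. cnj ?a / ip (kern w) (kern w) * t + ?a / ip (kern w) (kern w) * cnj t)) (at 0)" .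
  obtain r where r: "r > 0" "cball w r \<subseteq> D" using w D_open open_contains_cball by blast
  show "((\<lambda>t. complex_of_real (ln (Re (bergman_kernel D (w + axis k t) (w + axis k t))))) has_derivative
      (\<lambda>t. cnj ?a / ip (kern w) (kern w) * t + ?a / ip (kern w) (kern w) * cnj t)) (at 0)"
  proof (rule has_derivative_transform_within_open[OF *, of "ball 0 r"])
    fix t :: complex assume "t \<in> ball 0 r"
    then have "w + axis k t \<in> cball w r" by (simp add: dist_norm norm_axis)
    then have "w + axis k t \<in> D" using r by blast
    then show "complex_of_real (ln (Re (?K t))) = complex_of_real (ln (Re (bergman_kernel D (w + axis k t) (w + axis k t))))"
      by (simp add: bergman_kernel_eq kern kern_in)
  qed (use r in auto)
qed

text \<open>
  Near \<open>w\<close> the inner derivative is a quotient of two products of representers, so the quotient rule applies;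
  it brings in the representer of a second derivative, but only in the conjugate linear part.
\<close>

lemma log_kernel_wirtinger:
  assumes w: "w \<in> D"
  shows "wirtinger j (wirtinger_bar k (\<lambda>w. complex_of_real (ln (Re (bergman_kernel D w w))))) w
     = (ip (dkern (axis k 1) w) (dkern (axis j 1) w) * ip (kern w) (kern w)
        - ip (dkern (axis k 1) w) (kern w) * ip (kern w) (dkern (axis j 1) w)) / (ip (kern w) (kern w))\<^sup>2"
proof -
  let ?L = "\<lambda>w. complex_of_real (ln (Re (bergman_kernel D w w)))"
  let ?N = "\<lambda>t. ip (dkern (axis k 1) (w + axis j t)) (kern (w + axis j t))"
  let ?K = "\<lambda>t. ip (kern (w + axis j t)) (kern (w + axis j t))"
  \<comment> \<open>\<open>q\<close> and \<open>a\<close> contribute to the coefficient of \<open>cnj t\<close>, and hence to \<open>wirtinger_bar j\<close>\<close>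
  define q where "q = ip (repr (\<lambda>f x. gradient_app (\<lambda>x. gradient_app f x (axis k 1)) x (axis j 1)) w) (kern w)"
  define p where "p = ip (dkern (axis k 1) w) (dkern (axis j 1) w)"
  define a where "a = ip (dkern (axis j 1) w) (kern w)"
  define b where "b = ip (kern w) (dkern (axis j 1) w)"
  define \<kappa> where "\<kappa> = ip (kern w) (kern w)"
  define n where "n = ip (dkern (axis k 1) w) (kern w)"
  have a0: "axis j (0::complex) = 0" by (simp add: vec_eq_iff axis_def)
  have \<kappa>: "\<kappa> \<noteq> 0" using ip_self[OF kern_in[OF w]] kern_nonzero[OF w] by (simp add: \<kappa>_def)
  have K: "(?K has_derivative (\<lambda>t. cnj t * a + t * b)) (at 0)"
    using ip_repr_has_derivative[OF bergman_operator_id bergman_operator_id w, of j]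
    by (simp add: kern_def dkern_def a_def b_def)
  have N: "(?N has_derivative (\<lambda>t. cnj t * q + t * p)) (at 0)"
    using ip_repr_has_derivative[OF bergman_operator_gradient[OF bergman_operator_id] bergman_operator_id w, of "axis k 1" j]
    by (simp add: kern_def dkern_def q_def p_def)
  have *: "((\<lambda>t. ?N t / ?K t) has_derivative
     (\<lambda>t. ((p * \<kappa> - n * b) / \<kappa>\<^sup>2) * t + ((q * \<kappa> - n * a) / \<kappa>\<^sup>2) * cnj t)) (at 0)"
    by (rule has_derivative_eq_rhs[OF has_derivative_divide[OF N K]])
      (use \<kappa> in \<open>simp_all add: a0 \<kappa>_def[symmetric] n_def[symmetric] fun_eq_iff power2_eq_square field_simps\<close>)
  obtain r where r: "r > 0" "cball w r \<subseteq> D" using w D_open open_contains_cball by blast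
  have "wirtinger j (wirtinger_bar k ?L) w = (p * \<kappa> - n * b) / \<kappa>\<^sup>2"
  proof (rule wirtinger_eqI(1))
    show "((\<lambda>t. wirtinger_bar k ?L (w + axis j t)) has_derivative
      (\<lambda>t. ((p * \<kappa> - n * b) / \<kappa>\<^sup>2) * t + ((q * \<kappa> - n * a) / \<kappa>\<^sup>2) * cnj t)) (at 0)"
    proof (rule has_derivative_transform_within_open[OF *, of "ball 0 r"])
      fix t :: complex assume "t \<in> ball 0 r"
      then have "w + axis j t \<in> cball w r" by (simp add: dist_norm norm_axis)
      then have "w + axis j t \<in> D" using r by blast
      from log_kernel_wirtinger_bar[OF this, of k] show "?N t / ?K t = wirtinger_bar k ?L (w + axis j t)" by simp
    qed (use r in auto)
  qed
  then show ?thesis by (simp only: p_def \<kappa>_def n_def b_def)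
qed

text \<open>
  By sesquilinearity the double sum over coordinate directions collapses to the Gram determinant of
  \<open>dkern u z\<close> and \<open>kern z\<close>, divided by \<open>2 \<parallel>kern z\<parallel>\<^sup>4\<close>.
\<close>

theorem bergman_metric_eq_residual:
  assumes z: "z \<in> D"
  shows "bergman_metric D z u u = of_real (residual_energy (dkern u z) (kern z) / (2 * (nrm (kern z))\<^sup>2))"
proof -
  let ?d = "\<lambda>k. dkern (axis k 1) z" and ?k = "kern z" and ?p = "dkern u z"
  have lin: "ip f ?p = (\<Sum>j\<in>UNIV. u $ j * ip f (?d j))" if "f \<in> H" for f
    using gradient_app_expand[of f z u] by (simp add: dkern[OF z that])
  have lin': "ip ?p f = (\<Sum>k\<in>UNIV. cnj (u $ k) * ip (?d k) f)" if "f \<in> H" for f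
    using ip_cnj[OF that dkern_in[OF z], of u] lin[OF that] ip_cnj[OF that dkern_in[OF z]]
    by simp
  have pp: "ip ?p ?p = (\<Sum>j\<in>UNIV. \<Sum>k\<in>UNIV. u $ j * cnj (u $ k) * ip (?d k) (?d j))"
    by (simp add: lin[OF dkern_in[OF z]] lin'[OF dkern_in[OF z]] sum_distrib_left mult.assoc)
  have pk: "ip ?p ?k * ip ?k ?p = (\<Sum>j\<in>UNIV. \<Sum>k\<in>UNIV. u $ j * cnj (u $ k) * (ip (?d k) ?k * ip ?k (?d j)))"
    by (simp add: lin[OF kern_in[OF z]] lin'[OF kern_in[OF z]] sum_product mult_ac)
  define \<kappa> where "\<kappa> = (nrm ?k)\<^sup>2"
  have \<kappa>: "ip ?k ?k = of_real \<kappa>" "\<kappa> > 0"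
    using ip_self[OF kern_in[OF z]] kern_nonzero[OF z] by (auto simp: \<kappa>_def)
  have "2 * bergman_metric D z u u * (of_real \<kappa>)\<^sup>2 =
      (\<Sum>j\<in>UNIV. \<Sum>k\<in>UNIV. (ip (?d k) (?d j) * of_real \<kappa> - ip (?d k) ?k * ip ?k (?d j)) * u $ j * cnj (u $ k))"
    unfolding bergman_metric_def log_kernel_wirtinger[OF z] \<kappa>(1)
    using \<kappa>(2) by (simp add: sum_distrib_right sum_distrib_left)
  also have "\<dots> = ip ?p ?p * of_real \<kappa> - ip ?p ?k * ip ?k ?p"
    unfolding pp pk sum_distrib_right sum_subtractf[symmetric]
    by (intro sum.cong refl) (simp add: algebra_simps)
  also have "\<dots> = of_real (Re (ip ?p ?p) * \<kappa> - (cmod (ip ?p ?k))\<^sup>2)"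
    using ip_cnj[OF dkern_in[OF z] kern_in[OF z], of u] ip_self_real[OF dkern_in[OF z], of u]
    unfolding of_real_diff complex_norm_square of_real_mult by (simp only:)
  also have "Re (ip ?p ?p) * \<kappa> - (cmod (ip ?p ?k))\<^sup>2 = residual_energy ?p ?k * \<kappa>"
    using \<kappa> by (simp add: residual_energy_def left_diff_distrib)
  finally have "2 * bergman_metric D z u u * (of_real \<kappa>)\<^sup>2 = of_real (residual_energy ?p ?k * \<kappa>)" .
  then have "bergman_metric D z u u = of_real (residual_energy ?p ?k / (2 * \<kappa>))"
    using \<kappa>(2) by (simp add: power2_eq_square field_simps)
  then show ?thesis by (simp only: \<kappa>_def)
qed

lemma bergman_length_eq:
  assumes "z \<in> D"
  shows "bergman_length D z u = sqrt (residual_energy (dkern u z) (kern z) / (2 * (nrm (kern z))\<^sup>2))"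
  unfolding bergman_length_def bergman_metric_eq_residual[OF assms] by simp

text \<open>
  The residual energy is pinned down by functions vanishing at \<open>z\<close> and their derivatives alone, so it can be
  transported by pulling such functions back along automorphisms.
\<close>

lemma residual_energy_kern:
  assumes z: "z \<in> D"
  shows "f \<in> H \<Longrightarrow> f z = 0 \<Longrightarrow> (cmod (gradient_app f z u))\<^sup>2 \<le> residual_energy (dkern u z) (kern z) * (nrm f)\<^sup>2"
    and "\<exists>q\<in>H. q z = 0 \<and> gradient_app q z u = of_real (residual_energy (dkern u z) (kern z))
       \<and> (nrm q)\<^sup>2 = residual_energy (dkern u z) (kern z)"
proof -
  have nz: "nrm (kern z) \<noteq> 0" using kern_nonzero[OF z] by simp
  note ext = residual_energy_extremal[OF dkern_in[OF z, of u] kern_in[OF z] nz]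
  show "f \<in> H \<Longrightarrow> f z = 0 \<Longrightarrow> (cmod (gradient_app f z u))\<^sup>2 \<le> residual_energy (dkern u z) (kern z) * (nrm f)\<^sup>2"
    using ext(1)[of f] by (simp add: kern[OF z] dkern[OF z])
  show "\<exists>q\<in>H. q z = 0 \<and> gradient_app q z u = of_real (residual_energy (dkern u z) (kern z))
       \<and> (nrm q)\<^sup>2 = residual_energy (dkern u z) (kern z)"
    using ext(2) by (metis kern[OF z] dkern[OF z])
qed

text \<open>
  The affine function with linear part \<open>x \<mapsto> \<Sum>\<^sub>k cnj (u\<^sub>k) x\<^sub>k\<close> that vanishes at \<open>z\<close> has derivative \<open>\<parallel>u\<parallel>\<^sup>2\<close> along \<open>u\<close>,
  so the extremal constant cannot be \<open>0\<close>.
\<close>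

theorem bergman_length_pos:
  assumes z: "z \<in> D" and u: "u \<noteq> 0"
  shows "bergman_length D z u > 0"
proof -
  let ?R = "residual_energy (dkern u z) (kern z)"
  define f where "f x = (\<Sum>k\<in>UNIV. cnj (u $ k) * (x $ k - z $ k))" for x
  have holo: "holo_fun UNIV f"
    unfolding f_def by (intro holo_fun_sum holo_fun_cmult holo_fun_diff) auto
  have der: "(f has_derivative (\<lambda>h. \<Sum>k\<in>UNIV. cnj (u $ k) * h $ k)) (at z)"
    unfolding f_def by (auto intro!: derivative_eq_intros has_derivative_coord)
  have grad: "gradient_app f z u = of_real ((norm u)\<^sup>2)"
  proof -
    have "gradient_app f z u = (\<Sum>k\<in>UNIV. cnj (u $ k) * u $ k)"
      using gradient_app_eqI[OF der] by (simp add: sum_distrib_left mult.left_commute)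
    also have "\<dots> = (\<Sum>k\<in>UNIV. of_real ((cmod (u $ k))\<^sup>2))"
      by (intro sum.cong refl) (simp only: complex_norm_square mult.commute)
    also have "\<dots> = of_real ((norm u)\<^sup>2)"
      by (simp add: norm_vec_def L2_set_def sum_nonneg)
    finally show ?thesis .
  qed
  have "bounded (f ` D)"
  proof (rule bounded_subset)
    show "bounded (f ` closure D)"
      using D_bounded holo_fun_continuous_on[OF holo]
      by (intro compact_imp_bounded compact_continuous_image) (auto intro: continuous_on_subset)
  qed (use closure_subset in blast)
  then obtain M where "\<forall>y\<in>f ` D. cmod y \<le> M"
    unfolding bounded_iff by blast
  then have "f \<in> H"
    by (intro bounded_holo_in_bergman[of f M] holo_fun_subset[OF holo]) auto
  moreover have "f z = 0" by (simp add: f_def)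
  ultimately have le: "(cmod (gradient_app f z u))\<^sup>2 \<le> ?R * (nrm f)\<^sup>2"
    by (rule residual_energy_kern(1)[OF z])
  have "0 < (cmod (gradient_app f z u))\<^sup>2"
    using u by (simp add: grad)
  with le have "0 < ?R * (nrm f)\<^sup>2" by linarith
  then have "?R > 0"
    using zero_le_power2[of "nrm f"] by (metis mult_nonpos_nonneg not_less)
  then show ?thesis
    using kern_nonzero[OF z] by (simp add: bergman_length_eq[OF z])
qed

end

section \<open>Invariance of the Bergman metric and the Bloch seminorm\<close>

context bergman_domain
begin

text \<open>
  A symmetric form of being an automorphism: every one-sided estimate for \<open>S\<close> yields the opposite one
  when it is applied to \<open>S'\<close>.
\<close>

definition biholo_pair :: "(complex ^ 'n \<Rightarrow> complex ^ 'n) \<Rightarrow> (complex ^ 'n \<Rightarrow> complex ^ 'n) \<Rightarrow> bool" where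
  "biholo_pair S S' \<longleftrightarrow> holo_map D S \<and> holo_map D S' \<and>
     (\<forall>x\<in>D. S x \<in> D \<and> S' x \<in> D \<and> S' (S x) = x \<and> S (S' x) = x)"

lemma biholo_pair_sym: "biholo_pair S S' \<Longrightarrow> biholo_pair S' S"
  by (auto simp: biholo_pair_def)

lemma Aut_biholo_pair: "S \<in> Aut D \<Longrightarrow> biholo_pair S (inv_into D S)"
  unfolding Aut_def biholo_pair_def bij_betw_def
  by (auto simp: inv_into_f_f f_inv_into_f inv_into_into)

lemma biholo_image: "biholo_pair S S' \<Longrightarrow> S ` D = D"
  unfolding biholo_pair_def by force

lemma biholo_inj: "biholo_pair S S' \<Longrightarrow> inj_on S D"
  unfolding biholo_pair_def by (metis inj_onI)

lemma jacobian_inverse: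
  assumes S: "biholo_pair S S'" and z: "z \<in> D"
  shows "jacobian S' (S z) ** jacobian S z = mat 1"
proof -
  have Sz: "S z \<in> D" using S z by (auto simp: biholo_pair_def)
  have "((S' \<circ> S) has_derivative ((*v) (jacobian S' (S z)) \<circ> (*v) (jacobian S z))) (at z)"
    using S z Sz by (intro diff_chain_at holo_map_has_derivative) (auto simp: biholo_pair_def)
  then have "((\<lambda>x. x) has_derivative ((*v) (jacobian S' (S z)) \<circ> (*v) (jacobian S z))) (at z)"
    by (rule has_derivative_transform_within_open[OF _ D_open z])
      (use S in \<open>auto simp: biholo_pair_def\<close>)
  then have "(*v) (jacobian S' (S z)) \<circ> (*v) (jacobian S z) = (\<lambda>x. x)"
    using has_derivative_ident has_derivative_unique by blast
  then have "(jacobian S' (S z) ** jacobian S z) *v x = mat 1 *v x" for x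
    by (simp add: matrix_vector_mul_assoc[symmetric] fun_eq_iff)
  then show ?thesis by (rule matrix_ext)
qed

lemma holo_fun_det_jacobian:
  assumes "holo_map D S"
  shows "holo_fun D (\<lambda>x. det (jacobian S x))"
proof -
  have entry: "jacobian S x $ i $ k = gradient_app (\<lambda>w. S w $ i) x (axis k 1)" for x i k
    by (simp add: jacobian_def gradient_app_def axis_def if_distrib cong: if_cong)
  show ?thesis
    unfolding det_def entry
    by (intro holo_fun_sum holo_fun_cmult holo_fun_prod holo_fun_gradient D_open)
      (use assms in \<open>auto simp: holo_map_def\<close>)
qed

text \<open>
  Sections of the canonical bundle transform in this way, which is why the \<open>L\<^sup>2\<close> norm is preserved.
\<close>

definition pullback :: "(complex ^ 'n \<Rightarrow> complex ^ 'n) \<Rightarrow> (complex ^ 'n \<Rightarrow> complex) \<Rightarrow> complex ^ 'n \<Rightarrow> complex" where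
  "pullback S f x = det (jacobian S x) * (f \<circ> S) x"

lemma pullback_isometry:
  assumes S: "biholo_pair S S'" and f: "f \<in> H"
  shows "pullback S f \<in> H" "nrm (pullback S f) = nrm f"
proof -
  have hS: "holo_map D S" using S by (simp add: biholo_pair_def)
  note img = biholo_image[OF S] and inj = biholo_inj[OF S]
  have fS: "holo_fun D (f \<circ> S)"
    by (rule holo_fun_compose[OF hS bergman_spaceD(1)[OF f]]) (simp add: img)
  have hol: "holo_fun D (pullback S f)"
    unfolding pullback_def by (intro holo_fun_mult holo_fun_det_jacobian hS fS)
  have cf: "continuous_on (S ` D) (\<lambda>z. (cmod (f z))\<^sup>2)"
    unfolding img by (intro continuous_intros holo_fun_continuous_on bergman_spaceD(1) f)
  have cd: "continuous_on D (\<lambda>z. det (jacobian S z))"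
    by (intro holo_fun_continuous_on holo_fun_det_jacobian hS)
  have opn: "open (S ` D)" by (simp add: img D_open)
  note cov = complex_change_of_variables[OF D_open opn holo_map_has_derivative[OF hS] inj cf cd]
  have eq: "(cmod (det (jacobian S z)))\<^sup>2 * (cmod (f (S z)))\<^sup>2 = (cmod (pullback S f z))\<^sup>2" for z
    by (simp add: pullback_def norm_mult power_mult_distrib)
  have int: "set_integrable lborel (S ` D) (\<lambda>z. (cmod (f z))\<^sup>2)"
    unfolding img by (rule bergman_spaceD(2)[OF f])
  show "pullback S f \<in> H"
    using hol cov(1) int unfolding eq bergman_space_def by blast
  show "nrm (pullback S f) = nrm f"
    using cov(2)[OF _ int] unfolding eq img nrm_eq bergman_norm_def by simp
qed

text \<open>
  Pull the kernel at \<open>S z\<close> back to \<open>z\<close> and use it as a competitor for evaluation at \<open>z\<close>.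
\<close>

lemma kern_transform_le:
  assumes S: "biholo_pair S S'" and z: "z \<in> D"
  shows "cmod (det (jacobian S z)) * nrm (kern (S z)) \<le> nrm (kern z)"
proof -
  have Sz: "S z \<in> D" using S z by (auto simp: biholo_pair_def)
  let ?f = "kern (S z)"
  have f: "?f \<in> H" by (rule kern_in[OF Sz])
  have "cmod (pullback S ?f z) \<le> nrm ?f * nrm (kern z)"
    using cauchy_schwarz[OF pullback_isometry(1)[OF S f] kern_in[OF z]]
    by (simp add: kern[OF z pullback_isometry(1)[OF S f]] pullback_isometry(2)[OF S f])
  moreover have "cmod (pullback S ?f z) = cmod (det (jacobian S z)) * (nrm ?f)\<^sup>2"
    by (simp add: pullback_def kern_diag[OF Sz] norm_mult norm_power)
  ultimately have "nrm ?f * (cmod (det (jacobian S z)) * nrm ?f) \<le> nrm ?f * nrm (kern z)"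
    by (simp add: power2_eq_square mult_ac)
  then show ?thesis
    using kern_nonzero[OF Sz] by simp
qed

abbreviation "residual z u \<equiv> residual_energy (dkern u z) (kern z)"

lemma residual_nonneg: "z \<in> D \<Longrightarrow> 0 \<le> residual z u"
  using residual_energy_kern(2)[of z u] by (metis zero_le_power2)

text \<open>
  Pull the extremal function at \<open>S z\<close> back to \<open>z\<close>. The derivative of the factor \<open>det (JS)\<close> drops out
  because that function vanishes at \<open>S z\<close>.
\<close>

lemma residual_transform_le:
  assumes S: "biholo_pair S S'" and z: "z \<in> D"
  shows "(cmod (det (jacobian S z)))\<^sup>2 * residual (S z) (jacobian S z *v u) \<le> residual z u"
proof -
  let ?R = "residual (S z) (jacobian S z *v u)"
  have Sz: "S z \<in> D" and hS: "holo_map D S" using S z by (auto simp: biholo_pair_def)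
  obtain q where q: "q \<in> H" "q (S z) = 0"
    "gradient_app q (S z) (jacobian S z *v u) = of_real ?R" "(nrm q)\<^sup>2 = ?R"
    using residual_energy_kern(2)[OF Sz] by blast
  note V = pullback_isometry[OF S q(1)]
  have img: "S ` D \<subseteq> D" using biholo_image[OF S] by simp
  have qS: "holo_fun D (q \<circ> S)" by (rule holo_fun_compose[OF hS bergman_spaceD(1)[OF q(1)] img])
  have "gradient_app (pullback S q) z u = det (jacobian S z) * of_real ?R"
    unfolding pullback_def gradient_app_mult[OF holo_fun_det_jacobian[OF hS] qS z]
      gradient_app_compose[OF hS bergman_spaceD(1)[OF q(1)] img z]
    using q by simp
  moreover have "pullback S q z = 0" by (simp add: pullback_def q)
  ultimately have "(cmod (det (jacobian S z) * of_real ?R))\<^sup>2 \<le> residual z u * (nrm (pullback S q))\<^sup>2"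
    using residual_energy_kern(1)[OF z V(1), of u] by simp
  then have "((cmod (det (jacobian S z)))\<^sup>2 * ?R) * ?R \<le> residual z u * ?R"
    unfolding V(2) q(4)
    by (simp add: norm_mult power_mult_distrib power2_eq_square[of ?R] mult.assoc)
  then show ?thesis
    using residual_nonneg[OF z, of u] residual_nonneg[OF Sz, of "jacobian S z *v u"]
    by (cases "?R = 0") auto
qed

text \<open>
  The two transformation inequalities become equalities by applying them to the inverse, whose Jacobian
  determinant at \<open>S z\<close> is the reciprocal; the factor \<open>\<bar>det (JS(z))\<bar>\<^sup>2\<close> then cancels in the quotient.
\<close>

theorem bergman_length_invariant:
  assumes S: "biholo_pair S S'" and z: "z \<in> D"
  shows "bergman_length D (S z) (jacobian S z *v u) = bergman_length D z u"
proof -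
  let ?j = "cmod (det (jacobian S z))" and ?j' = "cmod (det (jacobian S' (S z)))"
  have Sz: "S z \<in> D" and inv: "S' (S z) = z" using S z by (auto simp: biholo_pair_def)
  note S' = biholo_pair_sym[OF S]
  have jj: "?j' * ?j = 1"
    using jacobian_inverse[OF S z] by (metis det_I det_mul norm_mult norm_one)
  then have jj': "?j * ?j' = 1" by (simp only: mult.commute)
  from jj have j: "?j \<noteq> 0" by auto
  have undo: "jacobian S' (S z) *v (jacobian S z *v u) = u"
    using jacobian_inverse[OF S z] by (simp add: matrix_vector_mul_assoc)
  have "?j * nrm (kern (S z)) = nrm (kern z)"
  proof (rule antisym)
    show "?j * nrm (kern (S z)) \<le> nrm (kern z)" by (rule kern_transform_le[OF S z])
    have "?j' * nrm (kern z) \<le> nrm (kern (S z))"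
      using kern_transform_le[OF S' Sz] by (simp add: inv)
    then have "?j * (?j' * nrm (kern z)) \<le> ?j * nrm (kern (S z))"
      by (rule mult_left_mono) simp
    then show "nrm (kern z) \<le> ?j * nrm (kern (S z))"
      unfolding mult.assoc[symmetric] jj' by simp
  qed
  moreover have "?j\<^sup>2 * residual (S z) (jacobian S z *v u) = residual z u"
  proof (rule antisym)
    show "?j\<^sup>2 * residual (S z) (jacobian S z *v u) \<le> residual z u"
      by (rule residual_transform_le[OF S z])
    have "?j'\<^sup>2 * residual z u \<le> residual (S z) (jacobian S z *v u)"
      using residual_transform_le[OF S' Sz, of "jacobian S z *v u"] by (simp add: inv undo)
    then have "?j\<^sup>2 * (?j'\<^sup>2 * residual z u) \<le> ?j\<^sup>2 * residual (S z) (jacobian S z *v u)"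
      by (rule mult_left_mono) simp
    then show "residual z u \<le> ?j\<^sup>2 * residual (S z) (jacobian S z *v u)"
      unfolding mult.assoc[symmetric] power_mult_distrib[symmetric] jj' by simp
  qed
  ultimately have "residual z u / (2 * (nrm (kern z))\<^sup>2)
      = (?j\<^sup>2 * residual (S z) (jacobian S z *v u)) / (2 * (?j * nrm (kern (S z)))\<^sup>2)"
    by simp
  also have "\<dots> = residual (S z) (jacobian S z *v u) / (2 * (nrm (kern (S z)))\<^sup>2)"
    using j by (simp add: power_mult_distrib)
  finally show ?thesis
    by (simp add: bergman_length_eq[OF z] bergman_length_eq[OF Sz])
qed

lemma bloch_beta_ge:
  assumes "z \<in> D" "u \<noteq> 0"
  shows "ennreal (cmod (gradient_app f z u) / bergman_length D z u) \<le> bloch_beta D f"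
  unfolding bloch_beta_def bloch_Q_def
  by (rule SUP_upper2[OF assms(1)], rule SUP_upper2[of u]) (use assms in auto)

lemma bloch_beta_leI:
  assumes "\<And>z u. z \<in> D \<Longrightarrow> u \<noteq> 0 \<Longrightarrow> ennreal (cmod (gradient_app f z u) / bergman_length D z u) \<le> b"
  shows "bloch_beta D f \<le> b"
  unfolding bloch_beta_def bloch_Q_def using assms by (intro SUP_least) auto

text \<open>
  Positivity of the Bergman length matters twice: it turns the bound on the Bergman constant into an
  inequality between lengths, and it excludes the value \<open>x / 0 = 0\<close> in the quotient at \<open>\<phi> z\<close>.
\<close>

lemma bloch_beta_compose_le:
  assumes \<phi>: "holo_map D \<phi>" "\<phi> ` D \<subseteq> D" and f: "holo_fun D f" and B: "bergman_constant D \<phi> \<le> 1"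
  shows "bloch_beta D (f \<circ> \<phi>) \<le> bloch_beta D f"
proof (rule bloch_beta_leI)
  fix z u :: "complex ^ 'n" assume z: "z \<in> D" and u: "u \<noteq> 0"
  let ?v = "jacobian \<phi> z *v u"
  have \<phi>z: "\<phi> z \<in> D" using \<phi> z by blast
  have grad: "gradient_app (f \<circ> \<phi>) z u = gradient_app f (\<phi> z) ?v"
    by (rule gradient_app_compose[OF \<phi>(1) f \<phi>(2) z])
  show "ennreal (cmod (gradient_app (f \<circ> \<phi>) z u) / bergman_length D z u) \<le> bloch_beta D f"
  proof (cases "?v = 0")
    case True
    then show ?thesis unfolding grad by (simp add: gradient_app_def)
  next
    case False
    have "ennreal (bergman_length D (\<phi> z) ?v / bergman_length D z u) \<le> bergman_constant D \<phi>"
      unfolding bergman_constant_def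
      by (rule SUP_upper2[OF z], rule SUP_upper2[of u]) (use u in auto)
    with B have "ennreal (bergman_length D (\<phi> z) ?v / bergman_length D z u) \<le> 1" by (rule order_trans[rotated])
    then have le: "bergman_length D (\<phi> z) ?v \<le> bergman_length D z u"
      using bergman_length_pos[OF z u] by (simp add: ennreal_le_1)
    have "cmod (gradient_app f (\<phi> z) ?v) / bergman_length D z u
        \<le> cmod (gradient_app f (\<phi> z) ?v) / bergman_length D (\<phi> z) ?v"
      using le bergman_length_pos[OF \<phi>z False] bergman_length_pos[OF z u]
      by (intro divide_left_mono) auto
    then have "ennreal (cmod (gradient_app (f \<circ> \<phi>) z u) / bergman_length D z u)
        \<le> ennreal (cmod (gradient_app f (\<phi> z) ?v) / bergman_length D (\<phi> z) ?v)"
      unfolding grad by (rule ennreal_leI)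
    also have "\<dots> \<le> bloch_beta D f"
      by (rule bloch_beta_ge[OF \<phi>z False])
    finally show ?thesis .
  qed
qed

lemma bloch_beta_Aut_ge:
  assumes S: "S \<in> Aut D" and f: "holo_fun D f" and z: "z \<in> D" and u: "u \<noteq> 0"
  shows "ennreal (cmod (gradient_app (f \<circ> S) z u) / bergman_length D z u) \<le> bloch_beta D f"
proof -
  note bi = Aut_biholo_pair[OF S]
  have hS: "holo_map D S" and Sz: "S z \<in> D" and img: "S ` D \<subseteq> D"
    using bi z by (auto simp: biholo_pair_def)
  have "jacobian S z *v u \<noteq> 0"
  proof
    assume "jacobian S z *v u = 0"
    then have "(jacobian (inv_into D S) (S z) ** jacobian S z) *v u = 0"
      by (simp add: matrix_vector_mul_assoc[symmetric])
    with jacobian_inverse[OF bi z] u show False by simp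
  qed
  from bloch_beta_ge[OF Sz this, of f] show ?thesis
    unfolding gradient_app_compose[OF hS f img z] bergman_length_invariant[OF bi z] .
qed

text \<open>
  Uniform continuity of \<open>f\<close> on a larger closed ball makes \<open>f \<circ> F j\<close> converge to \<open>f\<close> uniformly on a
  smaller one; the Cauchy estimate for the difference does the rest.
\<close>

lemma gradient_tendsto:
  assumes f: "holo_fun D f" and F: "\<And>j. holo_map D (F j)" "\<And>j. F j ` D \<subseteq> D"
    and lim: "locally_uniform_limit D F (\<lambda>x. x)" and z: "z \<in> D"
  shows "(\<lambda>j. gradient_app (f \<circ> F j) z u) \<longlonglongrightarrow> gradient_app f z u"
proof -
  obtain U where U: "open U" "z \<in> U" "U \<subseteq> D" "uniform_limit U F (\<lambda>x. x) sequentially"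
    using lim z unfolding locally_uniform_limit_def by blast
  obtain R where R: "R > 0" "cball z R \<subseteq> U"
    using U open_contains_cball by blast
  define r where "r = R / 2"
  have "cball z r \<subseteq> cball z R" using R by (intro subset_cball) (simp add: r_def)
  then have r: "r > 0" "cball z r \<subseteq> D" "cball z (2 * r) \<subseteq> D"
    using R U(3) by (auto simp: r_def)
  have uc: "uniformly_continuous_on (cball z (2 * r)) f"
    by (intro compact_uniformly_continuous continuous_on_subset[OF holo_fun_continuous_on[OF f]] r) simp
  show ?thesis
  proof (rule LIMSEQ_I)
    fix e :: real assume e: "e > 0"
    define e' where "e' = e * r / (norm u + 1)"
    have nu: "norm u + 1 > 0" by (simp add: add_nonneg_pos)
    have e': "e' > 0" using e r nu by (simp add: e'_def)
    obtain d where d: "d > 0" "\<And>x y. x \<in> cball z (2 * r) \<Longrightarrow> y \<in> cball z (2 * r) \<Longrightarrow> dist y x < d \<Longrightarrow> dist (f y) (f x) < e'"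
      using uc e' unfolding uniformly_continuous_on_def by metis
    have "min d r > 0" using d r by simp
    then obtain N where N: "\<And>j x. j \<ge> N \<Longrightarrow> x \<in> U \<Longrightarrow> dist (F j x) x < min d r"
      using U(4) unfolding uniform_limit_sequentially_iff by blast
    have "cmod (gradient_app (f \<circ> F j) z u - gradient_app f z u) < e" if j: "j \<ge> N" for j
    proof -
      have fF: "holo_fun D (f \<circ> F j)" by (rule holo_fun_compose[OF F(1) f F(2)])
      have "cmod (gradient_app (\<lambda>x. (f \<circ> F j) x - f x) z u) \<le> e' / r * norm u"
      proof (rule gradient_bound[OF holo_fun_diff[OF fF f] r(2) r(1)])
        fix x assume x: "x \<in> cball z r"
        have xU: "x \<in> U" using x R by (auto simp: r_def)
        have x2: "x \<in> cball z (2 * r)" using x r by auto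
        have dx: "dist (F j x) x < min d r" by (rule N[OF j xU])
        have "dist z (F j x) \<le> dist z x + dist x (F j x)" by (rule dist_triangle)
        also have "\<dots> \<le> 2 * r" using x dx by (simp add: dist_commute)
        finally have "F j x \<in> cball z (2 * r)" by simp
        from d(2)[OF x2 this] dx show "cmod ((f \<circ> F j) x - f x) \<le> e'"
          by (simp add: dist_norm)
      qed
      also have "e' / r * norm u < e' / r * (norm u + 1)"
        using e' r by (intro mult_strict_left_mono) auto
      also have "\<dots> = e" using r nu by (simp add: e'_def)
      finally show ?thesis
        unfolding gradient_app_diff[OF fF f z] .
    qed
    then show "\<exists>no. \<forall>j\<ge>no. norm (gradient_app (f \<circ> F j) z u - gradient_app f z u) < e" by blast
  qed
qed

lemma bloch_beta_compose_ge:
  assumes \<phi>: "holo_map D \<phi>" "\<phi> ` D \<subseteq> D" and f: "holo_fun D f"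
    and S: "\<And>j. S j \<in> Aut D" and lim: "locally_uniform_limit D (\<lambda>j. \<phi> \<circ> S j) (\<lambda>x. x)"
  shows "bloch_beta D f \<le> bloch_beta D (f \<circ> \<phi>)"
proof (rule bloch_beta_leI)
  fix z u :: "complex ^ 'n" assume z: "z \<in> D" and u: "u \<noteq> 0"
  have f\<phi>: "holo_fun D (f \<circ> \<phi>)" by (rule holo_fun_compose[OF \<phi>(1) f \<phi>(2)])
  have hS: "holo_map D (S j)" "S j ` D = D" for j
    using S[of j] by (auto simp: Aut_def bij_betw_def)
  have hF: "holo_map D (\<phi> \<circ> S j)" for j
    unfolding holo_map_def
  proof
    fix i
    have "holo_fun D ((\<lambda>w. \<phi> w $ i) \<circ> S j)"
      by (rule holo_fun_compose[OF hS(1)]) (use \<phi> hS in \<open>auto simp: holo_map_def\<close>)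
    then show "holo_fun D (\<lambda>w. (\<phi> \<circ> S j) w $ i)" by (simp add: comp_def)
  qed
  have imF: "(\<phi> \<circ> S j) ` D \<subseteq> D" for j
  proof clarify
    fix x assume "x \<in> D"
    then have "S j x \<in> D" using hS(2)[of j] by blast
    then show "(\<phi> \<circ> S j) x \<in> D" using \<phi>(2) by auto
  qed
  have "(\<lambda>j. gradient_app (f \<circ> (\<phi> \<circ> S j)) z u) \<longlonglongrightarrow> gradient_app f z u"
    by (rule gradient_tendsto[OF f hF imF lim z])
  then have "(\<lambda>j. ennreal (cmod (gradient_app (f \<circ> (\<phi> \<circ> S j)) z u) / bergman_length D z u))
      \<longlonglongrightarrow> ennreal (cmod (gradient_app f z u) / bergman_length D z u)"
    by (intro tendsto_ennrealI tendsto_intros) (use bergman_length_pos[OF z u] in auto)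
  moreover have "ennreal (cmod (gradient_app (f \<circ> (\<phi> \<circ> S j)) z u) / bergman_length D z u) \<le> bloch_beta D (f \<circ> \<phi>)" for j
    using bloch_beta_Aut_ge[OF S[of j] f\<phi> z u] by (simp add: comp_assoc)
  ultimately show "ennreal (cmod (gradient_app f z u) / bergman_length D z u) \<le> bloch_beta D (f \<circ> \<phi>)"
    by (intro LIMSEQ_le_const2) auto
qed

end

theorem theorem5p4:
  fixes D :: "(complex ^ 'n) set"
    and \<phi> :: "complex ^ 'n \<Rightarrow> complex ^ 'n"
  assumes "bounded_homogeneous_domain D" and "0 \<in> D"
    and "holo_map D \<phi>" and "\<phi> ` D \<subseteq> D" and "\<phi> 0 = 0"
    and "\<exists>S :: nat \<Rightarrow> complex ^ 'n \<Rightarrow> complex ^ 'n.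
           (\<forall>j. S j \<in> Aut D) \<and> locally_uniform_limit D (\<lambda>j. \<phi> \<circ> S j) (\<lambda>z. z)"
    and "bergman_constant D \<phi> \<le> 1"
  shows "\<forall>f \<in> bloch_space D. f \<circ> \<phi> \<in> bloch_space D \<and> bloch_norm D (f \<circ> \<phi>) = bloch_norm D f"
proof
  fix f assume "f \<in> bloch_space D"
  then have f: "holo_fun D f" and fin: "bloch_beta D f < \<infinity>"
    by (auto simp: bloch_space_def)
  interpret bergman_domain D
    by unfold_locales (use assms(1) in \<open>auto simp: bounded_homogeneous_domain_def\<close>)
  obtain S :: "nat \<Rightarrow> complex ^ 'n \<Rightarrow> complex ^ 'n"
    where S: "\<And>j. S j \<in> Aut D" "locally_uniform_limit D (\<lambda>j. \<phi> \<circ> S j) (\<lambda>z. z)"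
    using assms(6) by blast
  have beta: "bloch_beta D (f \<circ> \<phi>) = bloch_beta D f"
    by (intro antisym bloch_beta_compose_le bloch_beta_compose_ge[OF _ _ _ S] assms f)
  have "holo_fun D (f \<circ> \<phi>)"
    by (rule holo_fun_compose[OF assms(3) f assms(4)])
  then show "f \<circ> \<phi> \<in> bloch_space D \<and> bloch_norm D (f \<circ> \<phi>) = bloch_norm D f"
    using fin by (simp add: bloch_space_def bloch_norm_def beta assms(5))
qed

end
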